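(* Let $X=N_{\mathbb R}/\Lambda$ be a real torus with integral structure and $\widehat X$ its dual. There exists a tropical Poincaré bundle $\mathcal P_X$ on $X\times\widehat X$, i.e. a tropical line bundle on $X\times\widehat X$ such that (1) $\mathcal P_X|_{X\times\{L\}}\simeq L$ for every $L\in\widehat X=\mathrm{Pic}^0(X)$, and (2) $\mathcal P_X|_{\{0\}\times\widehat X}$ is trivial. Moreover $\mathcal P_X$ is uniquely determined up to isomorphism.
   Context: For a lattice (finitely generated free abelian group) $M$ write $M_{\mathbb R}=M\otimes_{\mathbb Z}\mathbb R$, $M^*=\mathrm{Hom}(M,\mathbb Z)$. A real torus with integral structure is $X=N_{\mathbb R}/\Lambda$, where $N$ is a lattice and $\Lambda\subset N_{\mathbb R}$ is a second lattice of full rank, so $\Lambda_{\mathbb R}=N_{\mathbb R}$; its sheaf $\mathrm{Aff}_X$ of integral affine functions is induced by functions on $N_{\mathbb R}$ with slopes in $N^*$ and real constants. A tropical line bundle is an $\mathrm{Aff}_X$-torsor, and isomorphism classes form the group $\mathrm{Pic}(X)=H^1(X,\mathrm{Aff}_X)$. For $l\in\mathrm{Hom}(\Lambda,\mathbb R)$ and a symmetric bilinear form $E$ on $N_{\mathbb R}$ with $E(\Lambda\times N)\subseteq\mathbb Z$, $\mathscr L(E,l)$ is the quotient of $N_{\mathbb R}\times\mathbb R$ by the $\Lambda$-action $\lambda.(x,b)=(x+\lambda,b+a_{E,l}(\lambda,x))$, $a_{E,l}(\lambda,x)=l(\lambda)-E(\lambda,x)-\frac12E(\lambda,\lambda)$.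 By the tropical Appell--Humbert theorem (known) every tropical line bundle is isomorphic to some $\mathscr L(E,l)$, and $\mathscr L(E,l)\cong\mathscr L(E',l')$ iff $E=E'$ and the linear extension $(l-l')_{\mathbb R}:N_{\mathbb R}\to\mathbb R$ takes integer values on $N$. The first Chern class is $c_1(\mathscr L(E,l))=E$. The dual torus is $\widehat X=\Lambda^*_{\mathbb R}/N^*$ (integral structure $\Lambda^*$, and $N^*\subset N_{\mathbb R}^*=\Lambda_{\mathbb R}^*$), identified with the group $\mathrm{Pic}^0(X)$ of line bundles with trivial first Chern class by sending the class of $l\in\Lambda^*_{\mathbb R}$ to $\mathscr L(0,l)$. The product $X\times\widehat X=(N_{\mathbb R}\oplus\Lambda_{\mathbb R}^* )/(\Lambda\oplus N^* )$ has integral structure $N\oplus\Lambda^*$. Restrictions to $X\times\{L\}$ and $\{0\}\times\widehat X$ are pullbacks along the inclusions $X\cong X\times\{L\}$, $\widehat X\cong\{0\}\times\widehat X$. *)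

theory Defs
  imports "HOL-Analysis.Analysis"
begin

section \<open>Lattices and real tori with integral structure\<close>

text \<open>
  A full-rank lattice in a real vector space, as the integral span of a finite basis. Its existence
  forces the ambient space to be finite-dimensional (dimension 0 included), so that the norm
  topology is the standard one and every linear functional is bounded.
\<close>

definition full_lattice :: "'v::real_normed_vector set \<Rightarrow> bool" where
  "full_lattice L \<longleftrightarrow> (\<exists>B. finite B \<and> independent B \<and> span B = UNIV \<and>
     L = range (\<lambda>k :: 'v \<Rightarrow> int. \<Sum>b\<in>B. of_int (k b) *\<^sub>R b))"

text \<open>\<open>Hom(L, \<int>)\<close> as a subgroup of the dual of the ambient vector space.\<close>

definition dual_lattice :: "'v::real_normed_vector set \<Rightarrow> ('v \<Rightarrow>\<^sub>L real) set" where
  "dual_lattice L = {m. \<forall>x\<in>L. blinfun_apply m x \<in> \<int>}"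

text \<open>
  The type \<open>'v\<close> plays the role of \<open>N\<^sub>\<real>\<close>; the two lattices \<open>N\<close> (field \<open>integral_lattice\<close>) and
  \<open>\<Lambda>\<close> (field \<open>period_lattice\<close>) are subgroups of it.
\<close>

record 'v torus =
  integral_lattice :: "'v set"
  period_lattice :: "'v set"

definition real_torus :: "'v::real_normed_vector torus \<Rightarrow> bool" where
  "real_torus X \<longleftrightarrow> full_lattice (integral_lattice X) \<and> full_lattice (period_lattice X)"

definition torus_class :: "'v::real_normed_vector torus \<Rightarrow> 'v \<Rightarrow> 'v set" where
  "torus_class X x = (\<lambda>a. x + a) ` period_lattice X"

definition torus_points :: "'v::real_normed_vector torus \<Rightarrow> 'v set set" where
  "torus_points X = range (torus_class X)"

definition torus_topology :: "'v::real_normed_vector torus \<Rightarrow> 'v set topology" where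
  "torus_topology X = topology (\<lambda>U. U \<subseteq> torus_points X \<and> open (torus_class X -` U))"

lemma openin_torus_topology:
  "openin (torus_topology X) U \<longleftrightarrow> U \<subseteq> torus_points X \<and> open (torus_class X -` U)"
proof -
  have "istopology (\<lambda>U. U \<subseteq> torus_points X \<and> open (torus_class X -` U))"
    unfolding istopology_def by (auto simp: vimage_Union intro!: open_Int open_UN)
  then show ?thesis
    unfolding torus_topology_def by (simp add: topology_inverse')
qed

definition dual_torus :: "'v::real_normed_vector torus \<Rightarrow> ('v \<Rightarrow>\<^sub>L real) torus" where
  "dual_torus X = \<lparr>integral_lattice = dual_lattice (period_lattice X),
                   period_lattice = dual_lattice (integral_lattice X)\<rparr>"

text \<open>The class of \<open>(x, y)\<close> in the product torus is the set product of the classes of \<open>x\<close> and \<open>y\<close>.\<close>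

definition prod_torus :: "'v torus \<Rightarrow> 'w torus \<Rightarrow> ('v \<times> 'w) torus" where
  "prod_torus X Y = \<lparr>integral_lattice = integral_lattice X \<times> integral_lattice Y,
                     period_lattice = period_lattice X \<times> period_lattice Y\<rparr>"


section \<open>The sheaf of integral affine functions and its torsors\<close>

text \<open>
  Functions on an open subset \<open>U\<close> are total functions that are \<open>undefined\<close> outside \<open>U\<close>, so that
  equality of sections is equality in the logic.
\<close>

definition Aff :: "'v::real_normed_vector torus \<Rightarrow> 'v set set \<Rightarrow> ('v set \<Rightarrow> real) set" where
  "Aff X U = {f \<in> extensional U.
     \<forall>x. torus_class X x \<in> U \<longrightarrow>
       (\<exists>m \<in> dual_lattice (integral_lattice X). \<exists>c.
          \<forall>\<^sub>F y in nhds x. f (torus_class X y) = blinfun_apply m y + c)}"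

text \<open>
  A presheaf of sets on a space with points \<open>'p\<close>, with sections in \<open>'s\<close>, together with an action
  of real-valued functions: \<open>act F U f s\<close> is \<open>f + s\<close> for \<open>f \<in> Aff X U\<close> and \<open>s \<in> sections F U\<close>.
\<close>

record ('p, 's) aff_presheaf =
  sections :: "'p set \<Rightarrow> 's set"
  res :: "'p set \<Rightarrow> 'p set \<Rightarrow> 's \<Rightarrow> 's"
  act :: "'p set \<Rightarrow> ('p \<Rightarrow> real) \<Rightarrow> 's \<Rightarrow> 's"

definition presheaf_on :: "'p topology \<Rightarrow> ('p, 's) aff_presheaf \<Rightarrow> bool" where
  "presheaf_on T F \<longleftrightarrow>
     (\<forall>U V. openin T U \<longrightarrow> openin T V \<longrightarrow> V \<subseteq> U \<longrightarrow>
        (\<forall>s\<in>sections F U. res F U V s \<in> sections F V)) \<and>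
     (\<forall>U. openin T U \<longrightarrow> (\<forall>s\<in>sections F U. res F U U s = s)) \<and>
     (\<forall>U V W. openin T U \<longrightarrow> openin T V \<longrightarrow> openin T W \<longrightarrow> W \<subseteq> V \<longrightarrow> V \<subseteq> U \<longrightarrow>
        (\<forall>s\<in>sections F U. res F V W (res F U V s) = res F U W s))"

definition sheaf_on :: "'p topology \<Rightarrow> ('p, 's) aff_presheaf \<Rightarrow> bool" where
  "sheaf_on T F \<longleftrightarrow> presheaf_on T F \<and>
     (\<forall>\<U> t. (\<forall>U\<in>\<U>. openin T U \<and> t U \<in> sections F U) \<longrightarrow>
        (\<forall>U\<in>\<U>. \<forall>V\<in>\<U>. res F U (U \<inter> V) (t U) = res F V (U \<inter> V) (t V)) \<longrightarrow>
        (\<exists>!s. s \<in> sections F (\<Union>\<U>) \<and> (\<forall>U\<in>\<U>. res F (\<Union>\<U>) U s = t U)))"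

text \<open>Tropical line bundles are \<open>Aff X\<close>-torsors.\<close>

definition tropical_line_bundle ::
  "'v::real_normed_vector torus \<Rightarrow> ('v set, 's) aff_presheaf \<Rightarrow> bool" where
  "tropical_line_bundle X F \<longleftrightarrow> sheaf_on (torus_topology X) F \<and>
     (\<forall>U. openin (torus_topology X) U \<longrightarrow>
        (\<forall>s\<in>sections F U.
           act F U (\<lambda>p\<in>U. 0) s = s \<and>
           (\<forall>f\<in>Aff X U. act F U f s \<in> sections F U) \<and>
           (\<forall>f\<in>Aff X U. \<forall>g\<in>Aff X U.
              act F U (\<lambda>p\<in>U. f p + g p) s = act F U f (act F U g s)) \<and>
           (\<forall>f\<in>Aff X U. \<forall>V. openin (torus_topology X) V \<longrightarrow> V \<subseteq> U \<longrightarrow>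
              res F U V (act F U f s) = act F V (restrict f V) (res F U V s)) \<and>
           (\<forall>t\<in>sections F U. \<exists>!f. f \<in> Aff X U \<and> act F U f s = t))) \<and>
     (\<forall>p\<in>torus_points X. \<exists>U. openin (torus_topology X) U \<and> p \<in> U \<and> sections F U \<noteq> {})"

definition line_bundle_iso ::
  "'v::real_normed_vector torus \<Rightarrow> ('v set, 's) aff_presheaf \<Rightarrow> ('v set, 't) aff_presheaf \<Rightarrow> bool"
where
  "line_bundle_iso X F G \<longleftrightarrow> (\<exists>\<phi>. \<forall>U. openin (torus_topology X) U \<longrightarrow>
     bij_betw (\<phi> U) (sections F U) (sections G U) \<and>
     (\<forall>s\<in>sections F U.
        (\<forall>f\<in>Aff X U. \<phi> U (act F U f s) = act G U f (\<phi> U s)) \<and>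
        (\<forall>V. openin (torus_topology X) V \<longrightarrow> V \<subseteq> U \<longrightarrow>
           \<phi> V (res F U V s) = res G U V (\<phi> U s))))"

definition trivial_line_bundle ::
  "'v::real_normed_vector torus \<Rightarrow> ('v set, 'v set \<Rightarrow> real) aff_presheaf" where
  "trivial_line_bundle X =
     \<lparr>sections = Aff X,
      res = (\<lambda>U V s. restrict s V),
      act = (\<lambda>U f s. \<lambda>p\<in>U. f p + s p)\<rparr>"


section \<open>Pullbacks\<close>

text \<open>
  For a map \<open>\<iota> : Y \<rightarrow> X\<close> of tori and an \<open>Aff X\<close>-torsor \<open>F\<close>, the pullback is the contracted product
  of the inverse image sheaf of \<open>F\<close> with \<open>Aff Y\<close> over the inverse image of \<open>Aff X\<close>. It is
  constructed as the sheaf of functions into its stalks that are locally given by a section.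

  The tuple \<open>(V, s, W, g)\<close> represents the pair consisting of \<open>s \<in> F(V)\<close> and \<open>g \<in> Aff\<^sub>Y(W)\<close>, with
  \<open>W \<subseteq> \<iota>\<^sup>-\<^sup>1(V)\<close>. Two such pairs define the same element of the stalk at \<open>y\<close> iff near \<open>y\<close> they
  agree up to moving some \<open>h \<in> Aff\<^sub>X\<close> across, i.e. \<open>(h + s, g') \<sim> (s, h \<circ> \<iota> + g')\<close>.
\<close>

type_synonym ('p, 's, 'q) pb_pair = "'p set \<times> 's \<times> 'q set \<times> ('q \<Rightarrow> real)"

definition pb_pairs ::
  "'v::real_normed_vector torus \<Rightarrow> 'w::real_normed_vector torus \<Rightarrow> ('w set \<Rightarrow> 'v set)
    \<Rightarrow> ('v set, 's) aff_presheaf \<Rightarrow> ('v set, 's, 'w set) pb_pair set" where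
  "pb_pairs X Y \<iota> F = {(V, s, W, g). openin (torus_topology X) V \<and> s \<in> sections F V \<and>
     openin (torus_topology Y) W \<and> \<iota> ` W \<subseteq> V \<and> g \<in> Aff Y W}"

definition pb_equiv ::
  "'v::real_normed_vector torus \<Rightarrow> 'w::real_normed_vector torus \<Rightarrow> ('w set \<Rightarrow> 'v set)
    \<Rightarrow> ('v set, 's) aff_presheaf \<Rightarrow> 'w set
    \<Rightarrow> ('v set, 's, 'w set) pb_pair \<Rightarrow> ('v set, 's, 'w set) pb_pair \<Rightarrow> bool" where
  "pb_equiv X Y \<iota> F y = (\<lambda>(V, s, W, g) (V', s', W', g').
     \<exists>V0 W0 h. openin (torus_topology X) V0 \<and> V0 \<subseteq> V \<inter> V' \<and>
       openin (torus_topology Y) W0 \<and> y \<in> W0 \<and> W0 \<subseteq> W \<inter> W' \<and> \<iota> ` W0 \<subseteq> V0 \<and>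
       h \<in> Aff X V0 \<and> res F V' V0 s' = act F V0 h (res F V V0 s) \<and>
       (\<forall>z\<in>W0. g z = h (\<iota> z) + g' z))"

definition pb_germ ::
  "'v::real_normed_vector torus \<Rightarrow> 'w::real_normed_vector torus \<Rightarrow> ('w set \<Rightarrow> 'v set)
    \<Rightarrow> ('v set, 's) aff_presheaf \<Rightarrow> 'w set
    \<Rightarrow> ('v set, 's, 'w set) pb_pair \<Rightarrow> ('v set, 's, 'w set) pb_pair set" where
  "pb_germ X Y \<iota> F y r = {r' \<in> pb_pairs X Y \<iota> F. pb_equiv X Y \<iota> F y r r'}"

definition pullback ::
  "'v::real_normed_vector torus \<Rightarrow> 'w::real_normed_vector torus \<Rightarrow> ('w set \<Rightarrow> 'v set)
    \<Rightarrow> ('v set, 's) aff_presheaf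
    \<Rightarrow> ('w set, 'w set \<Rightarrow> ('v set, 's, 'w set) pb_pair set) aff_presheaf" where
  "pullback X Y \<iota> F =
     \<lparr>sections = (\<lambda>U. {\<sigma> \<in> extensional U.
        \<forall>y\<in>U. \<exists>V s W g. (V, s, W, g) \<in> pb_pairs X Y \<iota> F \<and> y \<in> W \<and> W \<subseteq> U \<and>
          (\<forall>z\<in>W. \<sigma> z = pb_germ X Y \<iota> F z (V, s, W, g))}),
      res = (\<lambda>U U' \<sigma>. restrict \<sigma> U'),
      act = (\<lambda>U f \<sigma>. \<lambda>z\<in>U. \<Union>(V, s, W, g) \<in> {(V, s, W, g) \<in> \<sigma> z. W \<subseteq> U}.
        pb_germ X Y \<iota> F z (V, s, W, \<lambda>w\<in>W. f w + g w))\<rparr>"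


section \<open>The line bundles \<open>\<L>(E, l)\<close>\<close>

definition ah_factor :: "('v \<Rightarrow> 'v \<Rightarrow> real) \<Rightarrow> ('v \<Rightarrow> real) \<Rightarrow> 'v \<Rightarrow> 'v \<Rightarrow> real" where
  "ah_factor E l a x = l a - E a x - E a a / 2"

text \<open>The point of the quotient of \<open>N\<^sub>\<real> \<times> \<real>\<close> by the action of \<open>\<Lambda>\<close> represented by \<open>(x, b)\<close>.\<close>

definition ah_orbit ::
  "'v::real_normed_vector torus \<Rightarrow> ('v \<Rightarrow> 'v \<Rightarrow> real) \<Rightarrow> ('v \<Rightarrow> real) \<Rightarrow> 'v \<Rightarrow> real
    \<Rightarrow> ('v \<times> real) set" where
  "ah_orbit X E l x b = (\<lambda>a. (x + a, b + ah_factor E l a x)) ` period_lattice X"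

text \<open>
  The torsor of those sections of the projection from this quotient to \<open>X\<close> that lift locally to
  the graph of an integral affine function on \<open>N\<^sub>\<real>\<close>.
\<close>

definition ah_bundle ::
  "'v::real_normed_vector torus \<Rightarrow> ('v \<Rightarrow> 'v \<Rightarrow> real) \<Rightarrow> ('v \<Rightarrow> real)
    \<Rightarrow> ('v set, 'v set \<Rightarrow> ('v \<times> real) set) aff_presheaf" where
  "ah_bundle X E l =
     \<lparr>sections = (\<lambda>U. {\<sigma> \<in> extensional U.
        \<forall>x. torus_class X x \<in> U \<longrightarrow>
          (\<exists>m \<in> dual_lattice (integral_lattice X). \<exists>c.
             \<forall>\<^sub>F y in nhds x. \<sigma> (torus_class X y) = ah_orbit X E l y (blinfun_apply m y + c))}),
      res = (\<lambda>U V \<sigma>. restrict \<sigma> V),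
      act = (\<lambda>U f \<sigma>. \<lambda>p\<in>U. (\<lambda>(y, b). (y, f p + b)) ` \<sigma> p)\<rparr>"


section \<open>Poincare bundles\<close>

text \<open>
  A point of the dual torus is a class \<open>L\<close> of functionals modulo \<open>N\<^sup>*\<close>; as an element of
  \<open>Pic\<^sup>0(X)\<close> it is the isomorphism class of \<open>\<L>(0, l)\<close> for any \<open>l \<in> L\<close>.
\<close>

definition poincare_bundle ::
  "'v::real_normed_vector torus
    \<Rightarrow> (('v \<times> ('v \<Rightarrow>\<^sub>L real)) set, 's) aff_presheaf \<Rightarrow> bool" where
  "poincare_bundle X P \<longleftrightarrow>
     tropical_line_bundle (prod_torus X (dual_torus X)) P \<and>
     (\<forall>L \<in> torus_points (dual_torus X). \<forall>l\<in>L.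
        line_bundle_iso X
          (pullback (prod_torus X (dual_torus X)) X (\<lambda>p. p \<times> L) P)
          (ah_bundle X (\<lambda>_ _. 0) (blinfun_apply l))) \<and>
     line_bundle_iso (dual_torus X)
       (pullback (prod_torus X (dual_torus X)) (dual_torus X) (\<lambda>q. torus_class X 0 \<times> q) P)
       (trivial_line_bundle (dual_torus X))"

end

theory Submission
  imports Defs
begin

text \<open>
  The pullback of a torsor to the universal cover \<open>N\<^sub>\<real>\<close> is trivial: local trivializations on open
  convex sets differ by affine functions, so they extend along segments issuing from \<open>0\<close> and then
  glue. Hence every tropical line bundle is described by an integral affine cocycle
  \<open>a(\<gamma>, x) = m\<^sub>\<gamma>(x) + c\<^sub>\<gamma>\<close>, determined up to adding \<open>\<gamma> \<mapsto> \<mu>(\<gamma>)\<close> with \<open>\<mu> \<in> N\<^sup>*\<close>, and pulling back the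
  bundle pulls back the cocycle. On \<open>X \<times> X^\<close> the condition on \<open>X \<times> {L}\<close> for a functional \<open>l\<close> gives
  \<open>m\<^sub>(\<^sub>\<lambda>\<^sub>,\<^sub>0\<^sub>)(0, l) = l(\<lambda>) - \<nu>\<^sub>l(\<lambda>)\<close> with \<open>\<nu>\<^sub>l \<in> N\<^sup>*\<close> linear in \<open>l\<close>; a linear family of integral
  functionals vanishes. The remaining part of \<open>m\<close> follows from the condition on \<open>{0} \<times> X^\<close> and the
  symmetry \<open>m\<^sub>\<gamma>(\<delta>) = m\<^sub>\<delta>(\<gamma>)\<close> forced by the cocycle identity, so the cocycle is that of
  \<open>\<L>(E, 0)\<close> with \<open>E((v, w), (v', w')) = -w(v') - w'(v)\<close>.
\<close>

section \<open>Integral affine functions\<close>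

text \<open>The torsor is never pulled back as a sheaf to the universal cover. A trivialization
  there is encoded as a family \<open>\<Phi> U s\<close> of real functions that is natural in the
  section \<open>s\<close> (\<open>chart_on\<close>); this suffices because two sections over a
  common open set differ by a unique affine function on the torus. Convexity replaces
  contractibility: overlaps stay connected, and on a connected open set the difference of two charts
  is one single affine function, determined by its germ at one point. The constant of such a
  function drops out of the cocycle, so only its slope \<open>\<mu>\<close> survives as an
  ambiguity. In the uniqueness proof the two lattices interact: the identities coming from the
  cocycle hold on \<open>\<Lambda>\<close>, integrality of \<open>\<nu>\<close> is known on
  \<open>N\<close>, and each lattice spans the space, so that a linear identity tested on one may be
  used on the other. Integrality then kills \<open>\<nu>\<close>, because all real multiples of one
  of its values would have to be integers. The remaining constants of the cocycle are the values of
  an integral functional and are removed as a coboundary.\<close>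

definition int_affine_at :: "'v::real_normed_vector torus \<Rightarrow> ('v \<Rightarrow> real) \<Rightarrow> 'v \<Rightarrow> bool" where
  "int_affine_at X u x \<longleftrightarrow> (\<exists>m \<in> dual_lattice (integral_lattice X). \<exists>c.
     \<forall>\<^sub>F y in nhds x. u y = blinfun_apply m y + c)"

lemma zero_in_dual_lattice [simp]: "0 \<in> dual_lattice L"
  by (simp add: dual_lattice_def)

lemma add_in_dual_lattice: "m \<in> dual_lattice L \<Longrightarrow> n \<in> dual_lattice L \<Longrightarrow> m + n \<in> dual_lattice L"
  by (simp add: dual_lattice_def blinfun.add_left)

lemma uminus_in_dual_lattice: "m \<in> dual_lattice L \<Longrightarrow> - m \<in> dual_lattice L"
  by (simp add: dual_lattice_def blinfun.minus_left)

lemma int_affine_at_affine: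
  "m \<in> dual_lattice (integral_lattice X) \<Longrightarrow> int_affine_at X (\<lambda>y. blinfun_apply m y + c) x"
  unfolding int_affine_at_def by (intro bexI[of _ m] exI[of _ c]) auto

lemma int_affine_at_zero: "int_affine_at X (\<lambda>y. 0) x"
  using int_affine_at_affine[of 0 X 0 x] by simp

lemma int_affine_at_cong:
  assumes "int_affine_at X u x" "\<forall>\<^sub>F y in nhds x. v y = u y"
  shows "int_affine_at X v x"
proof -
  from assms(1) obtain m c where m: "m \<in> dual_lattice (integral_lattice X)"
    "\<forall>\<^sub>F y in nhds x. u y = blinfun_apply m y + c" unfolding int_affine_at_def by blast
  have "\<forall>\<^sub>F y in nhds x. v y = blinfun_apply m y + c"
    using m(2) assms(2) by eventually_elim simp
  with m(1) show ?thesis unfolding int_affine_at_def by blast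
qed

lemma int_affine_at_add:
  assumes "int_affine_at X u x" "int_affine_at X v x"
  shows "int_affine_at X (\<lambda>y. u y + v y) x"
proof -
  from assms obtain m c n d where m: "m \<in> dual_lattice (integral_lattice X)"
    "\<forall>\<^sub>F y in nhds x. u y = blinfun_apply m y + c" and n: "n \<in> dual_lattice (integral_lattice X)"
    "\<forall>\<^sub>F y in nhds x. v y = blinfun_apply n y + d" unfolding int_affine_at_def by blast
  have "\<forall>\<^sub>F y in nhds x. u y + v y = blinfun_apply (m + n) y + (c + d)"
    using m(2) n(2) by eventually_elim (simp add: blinfun.add_left)
  then show ?thesis
    using add_in_dual_lattice[OF m(1) n(1)] unfolding int_affine_at_def by blast
qed

lemma int_affine_at_diff:
  assumes "int_affine_at X u x" "int_affine_at X v x"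
  shows "int_affine_at X (\<lambda>y. u y - v y) x"
proof -
  from assms obtain m c n d where m: "m \<in> dual_lattice (integral_lattice X)"
    "\<forall>\<^sub>F y in nhds x. u y = blinfun_apply m y + c" and n: "n \<in> dual_lattice (integral_lattice X)"
    "\<forall>\<^sub>F y in nhds x. v y = blinfun_apply n y + d" unfolding int_affine_at_def by blast
  have "\<forall>\<^sub>F y in nhds x. u y - v y = blinfun_apply (m + - n) y + (c - d)"
    using m(2) n(2) by eventually_elim (simp add: blinfun.diff_left)
  then show ?thesis
    using add_in_dual_lattice[OF m(1) uminus_in_dual_lattice[OF n(1)]]
    unfolding int_affine_at_def by blast
qed

text \<open>The slope of the composite is \<open>m o\<^sub>L A\<close>; it is integral on
  \<open>Y\<close> because \<open>A\<close> carries the integral lattice of \<open>Y\<close> into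
  that of \<open>X\<close>. The translation \<open>b\<close> only enters the constant.\<close>

lemma int_affine_at_compose:
  fixes A :: "'w::real_normed_vector \<Rightarrow>\<^sub>L 'v::real_normed_vector"
  assumes "int_affine_at X u (blinfun_apply A y + b)"
    and "blinfun_apply A ` integral_lattice Y \<subseteq> integral_lattice X"
  shows "int_affine_at Y (\<lambda>z. u (blinfun_apply A z + b)) y"
proof -
  from assms obtain m c where m: "m \<in> dual_lattice (integral_lattice X)"
    and ev: "\<forall>\<^sub>F z in nhds (blinfun_apply A y + b). u z = blinfun_apply m z + c"
    unfolding int_affine_at_def by blast
  have "((\<lambda>z. blinfun_apply A z + b) \<longlongrightarrow> blinfun_apply A y + b) (nhds y)"
    by (intro tendsto_intros filterlim_ident)
  then have "\<forall>\<^sub>F z in nhds y. u (blinfun_apply A z + b) = blinfun_apply m (blinfun_apply A z + b) + c"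
    using ev by (rule eventually_compose_filterlim[rotated])
  then have "\<forall>\<^sub>F z in nhds y. u (blinfun_apply A z + b)
      = blinfun_apply (m o\<^sub>L A) z + (blinfun_apply m b + c)"
    by eventually_elim (simp add: blinfun.add_right)
  moreover have "m o\<^sub>L A \<in> dual_lattice (integral_lattice Y)"
    using m assms(2) by (auto simp: dual_lattice_def)
  ultimately show ?thesis unfolding int_affine_at_def by blast
qed

text \<open>On each line through \<open>x\<close> both sides are affine in one real parameter, so
  agreement at \<open>x\<close> and at a single nearby point with \<open>t \<noteq> 0\<close>
  already gives equal slopes.\<close>

lemma affine_eventually_eqD:
  fixes m n :: "'v::real_normed_vector \<Rightarrow>\<^sub>L real"
  assumes "\<forall>\<^sub>F y in nhds x. blinfun_apply m y + c = blinfun_apply n y + d"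
  shows "m = n \<and> c = d"
proof -
  have x: "blinfun_apply m x + c = blinfun_apply n x + d"
    using eventually_nhds_x_imp_x[OF assms] .
  have "blinfun_apply m v = blinfun_apply n v" for v
  proof -
    have "((\<lambda>t::real. x + t *\<^sub>R v) \<longlongrightarrow> x + 0 *\<^sub>R v) (at 0)"
      by (intro tendsto_intros)
    then have "\<forall>\<^sub>F t in at (0::real). blinfun_apply m (x + t *\<^sub>R v) + c = blinfun_apply n (x + t *\<^sub>R v) + d"
      using assms eventually_compose_filterlim by force
    then have "\<forall>\<^sub>F t in at (0::real). t \<noteq> 0 \<and> blinfun_apply m (x + t *\<^sub>R v) + c = blinfun_apply n (x + t *\<^sub>R v) + d"
      using eventually_neq_at_within by (rule eventually_conj[rotated])
    then obtain t :: real where "t \<noteq> 0"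
      "blinfun_apply m (x + t *\<^sub>R v) + c = blinfun_apply n (x + t *\<^sub>R v) + d"
      using eventually_happens'[OF at_neq_bot] by blast
    with x have "t * blinfun_apply m v = t * blinfun_apply n v"
      unfolding blinfun.add_right blinfun.scaleR_right real_scaleR_def by linarith
    with \<open>t \<noteq> 0\<close> show ?thesis by simp
  qed
  then have "m = n" by (rule blinfun_eqI)
  with x show ?thesis by simp
qed

text \<open>By uniqueness of affine germs the pair of slope and constant is a locally constant
  function of the point, hence constant on a connected set.\<close>

lemma int_affine_on_connected:
  assumes "connected B" "open B" "\<And>x. x \<in> B \<Longrightarrow> int_affine_at X u x"
  shows "\<exists>m \<in> dual_lattice (integral_lattice X). \<exists>c. \<forall>x\<in>B. u x = blinfun_apply m x + c"
proof (cases "B = {}")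
  case True
  then show ?thesis using zero_in_dual_lattice by blast
next
  case False
  then obtain b where b: "b \<in> B" by blast
  have "\<forall>x. \<exists>p. x \<in> B \<longrightarrow> fst p \<in> dual_lattice (integral_lattice X) \<and>
      (\<forall>\<^sub>F y in nhds x. u y = blinfun_apply (fst p) y + snd p)"
    using assms(3) unfolding int_affine_at_def by (metis fst_conv snd_conv)
  then obtain p where p: "\<And>x. x \<in> B \<Longrightarrow> fst (p x) \<in> dual_lattice (integral_lattice X)"
    "\<And>x. x \<in> B \<Longrightarrow> \<forall>\<^sub>F y in nhds x. u y = blinfun_apply (fst (p x)) y + snd (p x)"
    by metis
  have const: "p x = p b" if x: "x \<in> B" for x
  proof (rule connected_local_const[OF assms(1) x b], rule ballI)
    fix a assume a: "a \<in> B"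
    \<comment> \<open>The nested filter says that the germ at every \<open>y\<close> close to
      \<open>a\<close> is still given by the data chosen at \<open>a\<close>; comparison with the
      data chosen at \<open>y\<close> yields \<open>p a = p y\<close>.\<close>
    have "\<forall>\<^sub>F y in nhds a. y \<in> B \<and> (\<forall>\<^sub>F z in nhds y. u z = blinfun_apply (fst (p a)) z + snd (p a))"
      using p(2)[OF a] assms(2) a by (auto simp: eventually_eventually eventually_nhds_in_open
          intro!: eventually_conj)
    then have "\<forall>\<^sub>F y in nhds a. p a = p y"
    proof eventually_elim
      case (elim y)
      then have "\<forall>\<^sub>F z in nhds y. blinfun_apply (fst (p a)) z + snd (p a)
          = blinfun_apply (fst (p y)) z + snd (p y)"
        using p(2)[of y] by (auto elim: eventually_elim2)
      from affine_eventually_eqD[OF this] show ?case by (simp add: prod_eq_iff)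
    qed
    then show "\<forall>\<^sub>F y in at a within B. p a = p y"
      by (simp add: eventually_at_filter eventually_mono)
  qed
  have "\<forall>x\<in>B. u x = blinfun_apply (fst (p b)) x + snd (p b)"
  proof
    fix x assume "x \<in> B"
    with eventually_nhds_x_imp_x[OF p(2)] const
    show "u x = blinfun_apply (fst (p b)) x + snd (p b)" by simp
  qed
  then show ?thesis using p(1)[OF b] by blast
qed

section \<open>Topology and affine functions on the quotient by a group of periods\<close>

locale period_group =
  fixes X :: "'v::real_normed_vector torus"
  assumes zero_period: "0 \<in> period_lattice X"
    and add_period: "a \<in> period_lattice X \<Longrightarrow> b \<in> period_lattice X \<Longrightarrow> a + b \<in> period_lattice X"
    and uminus_period: "a \<in> period_lattice X \<Longrightarrow> - a \<in> period_lattice X"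
begin

abbreviation "cl \<equiv> torus_class X"
abbreviation "opn \<equiv> openin (torus_topology X)"

lemma torus_class_eq_iff: "cl x = cl y \<longleftrightarrow> y - x \<in> period_lattice X"
proof
  assume "cl x = cl y"
  moreover have "y \<in> cl y" unfolding torus_class_def using zero_period by force
  ultimately have "y \<in> cl x" by simp
  then show "y - x \<in> period_lattice X" unfolding torus_class_def by auto
next
  assume d: "y - x \<in> period_lattice X"
  have "cl z \<subseteq> cl w" if "z - w \<in> period_lattice X" for z w
  proof
    fix p assume "p \<in> cl z"
    then obtain a where a: "a \<in> period_lattice X" "p = z + a" by (auto simp: torus_class_def)
    then have "p = w + ((z - w) + a)" by simp
    with add_period[OF that a(1)] show "p \<in> cl w" unfolding torus_class_def by blast
  qed
  from this[of y x] this[of x y] show "cl x = cl y"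
    using d uminus_period[OF d] by auto
qed

lemma torus_class_add [simp]: "a \<in> period_lattice X \<Longrightarrow> cl (x + a) = cl x"
  using torus_class_eq_iff[of x "x + a"] by simp

lemma torus_class_eqE:
  assumes "cl x = cl y"
  obtains a where "a \<in> period_lattice X" "y = x + a"
  using assms that[of "y - x"] by (simp add: torus_class_eq_iff)

lemma open_vimage_torus_class: "opn U \<Longrightarrow> open (cl -` U)"
  by (simp add: openin_torus_topology)

lemma eventually_torus_class: "opn U \<Longrightarrow> cl x \<in> U \<Longrightarrow> \<forall>\<^sub>F y in nhds x. cl y \<in> U"
  using eventually_nhds_in_open[OF open_vimage_torus_class, of U x] by simp

text \<open>The projection is open since the full preimage of the image of \<open>S\<close> is a
  union of translates of \<open>S\<close>.\<close>

lemma openin_torus_class_image: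
  assumes "open S"
  shows "opn (cl ` S)"
proof -
  have "cl -` (cl ` S) = (\<Union>a\<in>period_lattice X. (\<lambda>x. a + x) ` S)"
  proof (intro set_eqI iffI)
    fix x assume "x \<in> cl -` (cl ` S)"
    then obtain y where y: "y \<in> S" "cl y = cl x" by force
    then obtain a where "a \<in> period_lattice X" "x = y + a" by (meson torus_class_eqE)
    with y show "x \<in> (\<Union>a\<in>period_lattice X. (\<lambda>x. a + x) ` S)" by (force simp: add.commute)
  next
    fix x assume "x \<in> (\<Union>a\<in>period_lattice X. (\<lambda>x. a + x) ` S)"
    then obtain a y where "a \<in> period_lattice X" "y \<in> S" "x = y + a" by (auto simp: add.commute)
    then show "x \<in> cl -` (cl ` S)" by auto
  qed
  moreover have "open (\<Union>a\<in>period_lattice X. (\<lambda>x. a + x) ` S)"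
    using assms by (intro open_UN ballI open_translation)
  ultimately show ?thesis by (auto simp: openin_torus_topology torus_points_def)
qed

text \<open>Turns a condition near a point of the universal cover into one on an open set of the
  torus, by projecting a neighbourhood of \<open>x\<close>.\<close>

lemma eventually_torus_nbhd:
  assumes "\<forall>\<^sub>F y in nhds x. P (cl y)"
  obtains W where "opn W" "cl x \<in> W" "\<And>p. p \<in> W \<Longrightarrow> P p"
proof -
  from assms obtain S where S: "open S" "x \<in> S" "\<And>y. y \<in> S \<Longrightarrow> P (cl y)"
    by (auto simp: eventually_nhds)
  then show thesis by (intro that[of "cl ` S"] openin_torus_class_image) auto
qed

lemma openin_subset_points: "opn U \<Longrightarrow> p \<in> U \<Longrightarrow> \<exists>x. p = cl x"
  by (auto simp: openin_torus_topology torus_points_def)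

lemma Aff_iff: "f \<in> Aff X U \<longleftrightarrow>
    f \<in> extensional U \<and> (\<forall>x. cl x \<in> U \<longrightarrow> int_affine_at X (\<lambda>y. f (cl y)) x)"
  by (simp add: Aff_def int_affine_at_def)

lemma Aff_int_affine_at: "f \<in> Aff X U \<Longrightarrow> cl x \<in> U \<Longrightarrow> int_affine_at X (\<lambda>y. f (cl y)) x"
  by (simp add: Aff_iff)

lemma Aff_eqI:
  assumes "f \<in> Aff X U" "g \<in> Aff X U" "opn U" "\<And>x. cl x \<in> U \<Longrightarrow> f (cl x) = g (cl x)"
  shows "f = g"
proof (rule extensionalityI)
  show "f \<in> extensional U" "g \<in> extensional U" using assms by (auto simp: Aff_iff)
  show "f p = g p" if "p \<in> U" for p
    using openin_subset_points[OF assms(3) that] assms(4) that by blast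
qed

text \<open>A periodic function takes the same value at all representatives of a class, so the
  arbitrary choice made in \<open>f\<close> is harmless; affinity is a condition on germs upstairs
  and therefore carries over.\<close>

lemma Aff_descend:
  assumes U: "opn U" and inv: "\<And>x a. cl x \<in> U \<Longrightarrow> a \<in> period_lattice X \<Longrightarrow> u (x + a) = u x"
    and aff: "\<And>x. cl x \<in> U \<Longrightarrow> int_affine_at X u x"
  shows "\<exists>f \<in> Aff X U. \<forall>x. cl x \<in> U \<longrightarrow> f (cl x) = u x"
proof -
  define f where "f = (\<lambda>p\<in>U. u (SOME x. cl x = p))"
  have f: "f (cl x) = u x" if "cl x \<in> U" for x
  proof -
    have "cl (SOME y. cl y = cl x) = cl x" by (rule someI) simp
    then obtain a where "a \<in> period_lattice X" "(SOME y. cl y = cl x) = x + a"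
      by (metis torus_class_eqE)
    then show ?thesis using that inv by (simp add: f_def)
  qed
  have "f \<in> Aff X U" unfolding Aff_iff
  proof (intro conjI allI impI)
    show "f \<in> extensional U" by (simp add: f_def)
    fix x assume x: "cl x \<in> U"
    have "\<forall>\<^sub>F y in nhds x. f (cl y) = u y"
      using eventually_torus_class[OF U x] by eventually_elim (rule f)
    then show "int_affine_at X (\<lambda>y. f (cl y)) x"
      by (rule int_affine_at_cong[OF aff[OF x]])
  qed
  with f show ?thesis by blast
qed

lemma Aff_zero:
  assumes "opn U"
  shows "(\<lambda>p\<in>U. 0) \<in> Aff X U"
  unfolding Aff_iff
proof (intro conjI allI impI)
  fix x assume x: "cl x \<in> U"
  have "\<forall>\<^sub>F y in nhds x. (\<lambda>p\<in>U. 0 :: real) (cl y) = 0"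
    using eventually_torus_class[OF assms x] by eventually_elim simp
  then show "int_affine_at X (\<lambda>y. (\<lambda>p\<in>U. 0) (cl y)) x"
    by (rule int_affine_at_cong[OF int_affine_at_zero])
qed simp

lemma Aff_add:
  assumes "opn U" "f \<in> Aff X U" "g \<in> Aff X U"
  shows "(\<lambda>p\<in>U. f p + g p) \<in> Aff X U"
  unfolding Aff_iff
proof (intro conjI allI impI)
  fix x assume x: "cl x \<in> U"
  have "\<forall>\<^sub>F y in nhds x. (\<lambda>p\<in>U. f p + g p) (cl y) = f (cl y) + g (cl y)"
    using eventually_torus_class[OF assms(1) x] by eventually_elim simp
  then show "int_affine_at X (\<lambda>y. (\<lambda>p\<in>U. f p + g p) (cl y)) x"
    using assms x by (auto intro: int_affine_at_cong[OF int_affine_at_add] Aff_int_affine_at)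
qed simp

lemma Aff_restrict:
  assumes "opn V" "V \<subseteq> U" "f \<in> Aff X U"
  shows "restrict f V \<in> Aff X V"
  unfolding Aff_iff
proof (intro conjI allI impI)
  fix x assume x: "cl x \<in> V"
  have "\<forall>\<^sub>F y in nhds x. restrict f V (cl y) = f (cl y)"
    using eventually_torus_class[OF assms(1) x] by eventually_elim simp
  then show "int_affine_at X (\<lambda>y. restrict f V (cl y)) x"
    using assms x by (auto intro: int_affine_at_cong Aff_int_affine_at)
qed simp

end

section \<open>Cocycles\<close>

text \<open>A chart is an isomorphism from the pullback of \<open>F\<close> to \<open>B\<close> onto
  the affine functions, recorded only through its effect on pulled back sections. \<open>B\<close>
  lies in the universal cover; the conditions are imposed at points of \<open>B\<close> over
  \<open>U\<close>. Affinity refers to the germ in the whole space, also when \<open>B\<close> is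
  not open.\<close>

definition chart_on :: "'v::real_normed_vector torus \<Rightarrow> ('v set, 's) aff_presheaf \<Rightarrow> 'v set
    \<Rightarrow> ('v set set \<Rightarrow> 's \<Rightarrow> 'v \<Rightarrow> real) \<Rightarrow> bool" where
  "chart_on X F B \<Phi> \<longleftrightarrow> (\<forall>U. openin (torus_topology X) U \<longrightarrow>
     (\<forall>s\<in>sections F U. \<forall>x\<in>B. torus_class X x \<in> U \<longrightarrow>
        int_affine_at X (\<Phi> U s) x \<and>
        (\<forall>f\<in>Aff X U. \<Phi> U (act F U f s) x = f (torus_class X x) + \<Phi> U s x) \<and>
        (\<forall>V. openin (torus_topology X) V \<longrightarrow> V \<subseteq> U \<longrightarrow> torus_class X x \<in> V \<longrightarrow>
           \<Phi> V (res F U V s) x = \<Phi> U s x)))"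

text \<open>
  Sections of the torsor with cocycle \<open>a\<close>, as functions on the preimage of \<open>U\<close> in the universal
  cover.
\<close>

definition cocycle_sections :: "'v::real_normed_vector torus \<Rightarrow> ('v \<Rightarrow> 'v \<Rightarrow> real) \<Rightarrow> 'v set set
    \<Rightarrow> ('v \<Rightarrow> real) set" where
  "cocycle_sections X a U = {u \<in> extensional (torus_class X -` U). \<forall>x. torus_class X x \<in> U \<longrightarrow>
     int_affine_at X u x \<and> (\<forall>\<gamma>\<in>period_lattice X. u (x + \<gamma>) = u x + a \<gamma> x)}"

text \<open>An isomorphism of \<open>F\<close> with the torsor of the cocycle \<open>a\<close>. That
  \<open>act\<close> and \<open>res\<close> preserve sections is part of the notion, so it can be
  established for presheaves not yet known to be line bundles.\<close>

definition trivialization :: "'v::real_normed_vector torus \<Rightarrow> ('v \<Rightarrow> 'v \<Rightarrow> real)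
    \<Rightarrow> ('v set, 's) aff_presheaf \<Rightarrow> ('v set set \<Rightarrow> 's \<Rightarrow> 'v \<Rightarrow> real) \<Rightarrow> bool" where
  "trivialization X a F \<Phi> \<longleftrightarrow> (\<forall>U. openin (torus_topology X) U \<longrightarrow>
     bij_betw (\<Phi> U) (sections F U) (cocycle_sections X a U) \<and>
     (\<forall>s\<in>sections F U.
        (\<forall>f\<in>Aff X U. act F U f s \<in> sections F U \<and>
           (\<forall>x. torus_class X x \<in> U \<longrightarrow> \<Phi> U (act F U f s) x = f (torus_class X x) + \<Phi> U s x)) \<and>
        (\<forall>V. openin (torus_topology X) V \<longrightarrow> V \<subseteq> U \<longrightarrow> res F U V s \<in> sections F V \<and>
           (\<forall>x. torus_class X x \<in> V \<longrightarrow> \<Phi> V (res F U V s) x = \<Phi> U s x))))"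

lemma cocycle_sections_cong:
  assumes "\<And>\<gamma> x. \<gamma> \<in> period_lattice X \<Longrightarrow> a \<gamma> x = b \<gamma> x"
  shows "cocycle_sections X a = cocycle_sections X b"
  using assms by (auto simp: cocycle_sections_def)

lemma trivialization_bij: "trivialization X a F \<Phi> \<Longrightarrow> openin (torus_topology X) U \<Longrightarrow>
    bij_betw (\<Phi> U) (sections F U) (cocycle_sections X a U)"
  unfolding trivialization_def by blast

lemma trivialization_act:
  assumes "trivialization X a F \<Phi>" "openin (torus_topology X) U" "s \<in> sections F U" "f \<in> Aff X U"
  shows "act F U f s \<in> sections F U"
    and "torus_class X x \<in> U \<Longrightarrow> \<Phi> U (act F U f s) x = f (torus_class X x) + \<Phi> U s x"
  using assms unfolding trivialization_def by blast+

lemma trivialization_res: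
  assumes "trivialization X a F \<Phi>" "openin (torus_topology X) U" "s \<in> sections F U"
    "openin (torus_topology X) V" "V \<subseteq> U"
  shows "res F U V s \<in> sections F V"
    and "torus_class X x \<in> V \<Longrightarrow> \<Phi> V (res F U V s) x = \<Phi> U s x"
  using assms unfolding trivialization_def by blast+

lemma trivialization_cong:
  assumes "\<And>\<gamma> x. \<gamma> \<in> period_lattice X \<Longrightarrow> a \<gamma> x = b \<gamma> x" and "trivialization X a F \<Phi>"
  shows "trivialization X b F \<Phi>"
proof -
  have "cocycle_sections X a = cocycle_sections X b" by (rule cocycle_sections_cong[OF assms(1)])
  with assms(2) show ?thesis unfolding trivialization_def by simp
qed

context period_group
begin

lemma cocycle_sections_eqI:
  assumes "u \<in> cocycle_sections X a U" "v \<in> cocycle_sections X a U" "\<And>x. cl x \<in> U \<Longrightarrow> u x = v x"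
  shows "u = v"
  using assms by (intro extensionalityI[of _ "cl -` U"]) (auto simp: cocycle_sections_def)

lemma restrict_in_cocycle_sections:
  assumes U: "opn U"
    and "\<And>x. cl x \<in> U \<Longrightarrow> int_affine_at X u x"
    and "\<And>x \<gamma>. cl x \<in> U \<Longrightarrow> \<gamma> \<in> period_lattice X \<Longrightarrow> u (x + \<gamma>) = u x + a \<gamma> x"
  shows "restrict u (cl -` U) \<in> cocycle_sections X a U"
  unfolding cocycle_sections_def
proof (intro CollectI conjI allI impI ballI)
  fix x assume x: "cl x \<in> U"
  have "\<forall>\<^sub>F y in nhds x. restrict u (cl -` U) y = u y"
    using eventually_torus_class[OF U x] by eventually_elim simp
  then show "int_affine_at X (restrict u (cl -` U)) x"
    by (rule int_affine_at_cong[OF assms(2)[OF x]])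
  show "restrict u (cl -` U) (x + \<gamma>) = restrict u (cl -` U) x + a \<gamma> x"
    if "\<gamma> \<in> period_lattice X" for \<gamma>
    using assms(3) x that by simp
qed simp

lemma trivialization_chart_on:
  assumes "trivialization X a F \<Phi>"
  shows "chart_on X F B \<Phi>"
  unfolding chart_on_def
proof (intro allI impI ballI conjI)
  fix U s x assume h: "opn U" "s \<in> sections F U" "cl x \<in> U"
  then have "\<Phi> U s \<in> cocycle_sections X a U"
    using bij_betw_apply[OF trivialization_bij[OF assms]] by blast
  with h show "int_affine_at X (\<Phi> U s) x" by (simp add: cocycle_sections_def)
  show "\<Phi> U (act F U f s) x = f (cl x) + \<Phi> U s x" if "f \<in> Aff X U" for f
    using trivialization_act(2)[OF assms h(1,2) that h(3)] .
  show "\<Phi> V (res F U V s) x = \<Phi> U s x" if "opn V" "V \<subseteq> U" "cl x \<in> V" for V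
    using trivialization_res(2)[OF assms h(1,2) that] .
qed

lemma trivialization_cocycle:
  assumes "trivialization X a F \<Phi>" "opn U" "s \<in> sections F U" "cl x \<in> U" "\<gamma> \<in> period_lattice X"
  shows "\<Phi> U s (x + \<gamma>) = \<Phi> U s x + a \<gamma> x"
proof -
  have "\<Phi> U s \<in> cocycle_sections X a U"
    using bij_betw_apply[OF trivialization_bij[OF assms(1,2)]] assms(3) by blast
  with assms show ?thesis by (simp add: cocycle_sections_def)
qed

lemma trivialization_eqI:
  assumes "trivialization X a F \<Phi>" "opn U" "s \<in> sections F U" "t \<in> sections F U"
    and "\<And>x. cl x \<in> U \<Longrightarrow> \<Phi> U s x = \<Phi> U t x"
  shows "s = t"
proof -
  have b: "bij_betw (\<Phi> U) (sections F U) (cocycle_sections X a U)"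
    using trivialization_bij[OF assms(1,2)] .
  then have "\<Phi> U s = \<Phi> U t"
    using assms by (intro cocycle_sections_eqI[of _ a U] bij_betw_apply[of "\<Phi> U"]) auto
  with b assms show ?thesis by (auto simp: bij_betw_def dest: inj_onD)
qed

lemma trivialization_section:
  assumes "trivialization X a F \<Phi>" and U: "opn U"
    and "\<And>x. cl x \<in> U \<Longrightarrow> int_affine_at X u x"
    and "\<And>x \<gamma>. cl x \<in> U \<Longrightarrow> \<gamma> \<in> period_lattice X \<Longrightarrow> u (x + \<gamma>) = u x + a \<gamma> x"
  shows "\<exists>s\<in>sections F U. \<forall>x. cl x \<in> U \<longrightarrow> \<Phi> U s x = u x"
proof -
  have "restrict u (cl -` U) \<in> cocycle_sections X a U"
    using assms by (intro restrict_in_cocycle_sections)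
  moreover have "bij_betw (\<Phi> U) (sections F U) (cocycle_sections X a U)"
    using trivialization_bij[OF assms(1,2)] .
  ultimately have "restrict u (cl -` U) \<in> \<Phi> U ` sections F U"
    by (simp add: bij_betw_def)
  then obtain s where "s \<in> sections F U" "\<Phi> U s = restrict u (cl -` U)" by force
  then show ?thesis by (intro bexI[of _ s]) auto
qed

text \<open>The linear function \<open>m\<close> has coboundary
  \<open>m (x + \<gamma>) - m x = m \<gamma>\<close>, so adding it to all values changes the cocycle
  by a function of \<open>\<gamma>\<close> alone.\<close>

lemma trivialization_shift:
  assumes triv: "trivialization X a F \<Phi>" and m: "m \<in> dual_lattice (integral_lattice X)"
  shows "trivialization X (\<lambda>\<gamma> x. a \<gamma> x + blinfun_apply m \<gamma>) F
    (\<lambda>U s. \<lambda>x\<in>cl -` U. \<Phi> U s x + blinfun_apply m x)"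
  unfolding trivialization_def
proof (intro allI impI conjI ballI)
  fix U assume U: "opn U"
  have ch: "chart_on X F UNIV \<Phi>" using triv by (rule trivialization_chart_on)
  have aff: "int_affine_at X (\<lambda>x. \<Phi> U s x + blinfun_apply m x) x"
    if "s \<in> sections F U" "cl x \<in> U" for s x
    using ch int_affine_at_affine[OF m, of 0] that U unfolding chart_on_def
    by (intro int_affine_at_add) auto
  show "bij_betw (\<lambda>s. \<lambda>x\<in>cl -` U. \<Phi> U s x + blinfun_apply m x) (sections F U)
     (cocycle_sections X (\<lambda>\<gamma> x. a \<gamma> x + blinfun_apply m \<gamma>) U)"
    unfolding bij_betw_def
  proof (intro conjI inj_onI)
    fix s t assume st: "s \<in> sections F U" "t \<in> sections F U" and
      eq: "(\<lambda>x\<in>cl -` U. \<Phi> U s x + blinfun_apply m x) = (\<lambda>x\<in>cl -` U. \<Phi> U t x + blinfun_apply m x)"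
    have "\<Phi> U s x = \<Phi> U t x" if "cl x \<in> U" for x
      using fun_cong[OF eq, of x] that by simp
    then show "s = t" by (rule trivialization_eqI[OF triv U st])
  next
    show "(\<lambda>s. \<lambda>x\<in>cl -` U. \<Phi> U s x + blinfun_apply m x) ` sections F U =
      cocycle_sections X (\<lambda>\<gamma> x. a \<gamma> x + blinfun_apply m \<gamma>) U" (is "?f ` _ = ?C")
    proof
      show "?f ` sections F U \<subseteq> ?C"
        using aff U trivialization_cocycle[OF triv U]
        by (auto intro!: restrict_in_cocycle_sections simp: blinfun.add_right)
      show "?C \<subseteq> ?f ` sections F U"
      proof
        fix u assume u: "u \<in> ?C"
        have "\<exists>s\<in>sections F U. \<forall>x. cl x \<in> U \<longrightarrow> \<Phi> U s x = u x - blinfun_apply m x"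
          using u int_affine_at_affine[OF m, of 0]
          by (intro trivialization_section[OF triv U] int_affine_at_diff)
            (auto simp: cocycle_sections_def blinfun.add_right)
        then obtain s where s: "s \<in> sections F U"
          and eq: "\<And>x. cl x \<in> U \<Longrightarrow> \<Phi> U s x = u x - blinfun_apply m x" by blast
        have "u = ?f s"
          using u eq by (intro extensionalityI[of _ "cl -` U"]) (auto simp: cocycle_sections_def)
        with s show "u \<in> ?f ` sections F U" by blast
      qed
    qed
  qed
  fix s assume s: "s \<in> sections F U"
  fix f assume f: "f \<in> Aff X U"
  show "act F U f s \<in> sections F U" using triv U s f unfolding trivialization_def by blast
  show "(\<lambda>x\<in>cl -` U. \<Phi> U (act F U f s) x + blinfun_apply m x) x
      = f (cl x) + (\<lambda>x\<in>cl -` U. \<Phi> U s x + blinfun_apply m x) x" if "cl x \<in> U" for x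
    using triv U s f that unfolding trivialization_def by simp
next
  fix U s V assume "opn U" and s: "s \<in> sections F U" and V: "opn V" "V \<subseteq> U"
  then show "res F U V s \<in> sections F V" using triv unfolding trivialization_def by blast
  fix x assume x: "cl x \<in> V"
  then have "\<Phi> V (res F U V s) x = \<Phi> U s x"
    using \<open>opn U\<close> s V triv unfolding trivialization_def by blast
  then show "(\<lambda>x\<in>cl -` V. \<Phi> V (res F U V s) x + blinfun_apply m x) x
      = (\<lambda>x\<in>cl -` U. \<Phi> U s x + blinfun_apply m x) x"
    using x V by auto
qed

text \<open>The isomorphism sends \<open>s\<close> to the section of \<open>G\<close> with the same
  function on the universal cover; compatibility with \<open>act\<close> and \<open>res\<close> can
  then be checked on values, where both sides follow the same rule.\<close>

lemma trivialization_iso: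
  assumes F: "trivialization X a F \<Phi>" and G: "trivialization X a G \<Psi>"
  shows "line_bundle_iso X F G"
proof -
  define \<phi> where "\<phi> U = inv_into (sections G U) (\<Psi> U) \<circ> \<Phi> U" for U
  note bF = trivialization_bij[OF F] and bG = trivialization_bij[OF G]
  have bij: "bij_betw (\<phi> U) (sections F U) (sections G U)" if "opn U" for U
    unfolding \<phi>_def by (rule bij_betw_trans[OF bF[OF that] bij_betw_inv_into[OF bG[OF that]]])
  have eq: "\<Psi> U (\<phi> U s) = \<Phi> U s" if "opn U" "s \<in> sections F U" for U s
    unfolding \<phi>_def o_def
    by (rule bij_betw_inv_into_right[OF bG[OF that(1)] bij_betw_apply[OF bF[OF that(1)] that(2)]])
  show ?thesis unfolding line_bundle_iso_def
  proof (intro exI[of _ \<phi>] allI impI conjI ballI)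
    fix U assume U: "opn U"
    show "bij_betw (\<phi> U) (sections F U) (sections G U)" by (rule bij[OF U])
    fix s assume s: "s \<in> sections F U"
    then have t: "\<phi> U s \<in> sections G U" by (rule bij_betw_apply[OF bij[OF U]])
    {
      fix f assume f: "f \<in> Aff X U"
      note af = trivialization_act[OF F U s f] and ag = trivialization_act[OF G U t f]
      show "\<phi> U (act F U f s) = act G U f (\<phi> U s)"
      proof (rule trivialization_eqI[OF G U _ ag(1)])
        show "\<phi> U (act F U f s) \<in> sections G U" by (rule bij_betw_apply[OF bij[OF U] af(1)])
        show "\<Psi> U (\<phi> U (act F U f s)) x = \<Psi> U (act G U f (\<phi> U s)) x" if "cl x \<in> U" for x
          using af(2)[OF that] ag(2)[OF that] eq[OF U s] eq[OF U af(1)] by simp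
      qed
    }
    fix V assume V: "opn V" "V \<subseteq> U"
    note rs = trivialization_res[OF F U s V] and rt = trivialization_res[OF G U t V]
    show "\<phi> V (res F U V s) = res G U V (\<phi> U s)"
    proof (rule trivialization_eqI[OF G V(1) _ rt(1)])
      show "\<phi> V (res F U V s) \<in> sections G V" by (rule bij_betw_apply[OF bij[OF V(1)] rs(1)])
      show "\<Psi> V (\<phi> V (res F U V s)) x = \<Psi> V (res G U V (\<phi> U s)) x" if "cl x \<in> V" for x
        using rs(2)[OF that] rt(2)[OF that] eq[OF U s] eq[OF V(1) rs(1)] by simp
    qed
  qed
qed

end

section \<open>Trivialization on the universal cover\<close>

locale line_bundle = period_group X for X :: "'v::real_normed_vector torus" +
  fixes F :: "('v set, 's) aff_presheaf"
  assumes is_bundle: "tropical_line_bundle X F"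
begin

lemma sheaf: "sheaf_on (torus_topology X) F"
  using is_bundle unfolding tropical_line_bundle_def by (rule conjunct1)

lemma presheaf: "presheaf_on (torus_topology X) F"
  using sheaf unfolding sheaf_on_def by (rule conjunct1)

lemma res_in: "opn U \<Longrightarrow> opn V \<Longrightarrow> V \<subseteq> U \<Longrightarrow> s \<in> sections F U \<Longrightarrow> res F U V s \<in> sections F V"
  using conjunct1[OF presheaf[unfolded presheaf_on_def]] by simp

lemma res_res: "opn U \<Longrightarrow> opn V \<Longrightarrow> opn W \<Longrightarrow> W \<subseteq> V \<Longrightarrow> V \<subseteq> U \<Longrightarrow> s \<in> sections F U \<Longrightarrow>
    res F V W (res F U V s) = res F U W s"
  using conjunct2[OF conjunct2[OF presheaf[unfolded presheaf_on_def]]] by simp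

lemma glue:
  assumes "\<And>U. U \<in> \<U> \<Longrightarrow> opn U" "\<And>U. U \<in> \<U> \<Longrightarrow> t U \<in> sections F U"
    and "\<And>U V. U \<in> \<U> \<Longrightarrow> V \<in> \<U> \<Longrightarrow> res F U (U \<inter> V) (t U) = res F V (U \<inter> V) (t V)"
  shows "\<exists>s \<in> sections F (\<Union>\<U>). \<forall>U\<in>\<U>. res F (\<Union>\<U>) U s = t U"
proof -
  have "\<exists>!s. s \<in> sections F (\<Union>\<U>) \<and> (\<forall>U\<in>\<U>. res F (\<Union>\<U>) U s = t U)"
  proof (rule conjunct2[OF sheaf[unfolded sheaf_on_def], THEN spec[of _ \<U>], THEN spec[of _ t],
        THEN mp, THEN mp])
    show "\<forall>U\<in>\<U>. opn U \<and> t U \<in> sections F U" using assms(1,2) by blast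
    show "\<forall>U\<in>\<U>. \<forall>V\<in>\<U>. res F U (U \<inter> V) (t U) = res F V (U \<inter> V) (t V)" using assms(3) by blast
  qed
  then show ?thesis by (elim ex1E conjE) (rule bexI)
qed

lemma torsor:
  assumes "opn U" "s \<in> sections F U"
  shows act_zero: "act F U (\<lambda>p\<in>U. 0) s = s"
    and act_in: "f \<in> Aff X U \<Longrightarrow> act F U f s \<in> sections F U"
    and res_act: "f \<in> Aff X U \<Longrightarrow> opn V \<Longrightarrow> V \<subseteq> U \<Longrightarrow>
      res F U V (act F U f s) = act F V (restrict f V) (res F U V s)"
    and act_add: "f \<in> Aff X U \<Longrightarrow> g \<in> Aff X U \<Longrightarrow>
      act F U (\<lambda>p\<in>U. f p + g p) s = act F U f (act F U g s)"
    and ex1_act: "t \<in> sections F U \<Longrightarrow> \<exists>!f. f \<in> Aff X U \<and> act F U f s = t"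
  using bspec[OF mp[OF spec[OF conjunct1[OF conjunct2[OF is_bundle[unfolded tropical_line_bundle_def]]],
      of U] assms(1)] assms(2)]
  by simp_all

lemma ex_act: "opn U \<Longrightarrow> s \<in> sections F U \<Longrightarrow> t \<in> sections F U \<Longrightarrow> \<exists>f\<in>Aff X U. act F U f s = t"
  using ex1_act by blast

lemma act_cancel:
  assumes "opn U" "s \<in> sections F U" "f \<in> Aff X U" "g \<in> Aff X U" "act F U f s = act F U g s"
  shows "f = g"
  using ex1_act[OF assms(1,2) act_in[OF assms(1,2,3)]] assms(3-5) by metis

lemma local_section:
  obtains U s where "opn U" "cl x \<in> U" "s \<in> sections F U"
proof -
  have "cl x \<in> torus_points X" by (simp add: torus_points_def)
  with conjunct2[OF conjunct2[OF is_bundle[unfolded tropical_line_bundle_def]]]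
  have "\<exists>U. opn U \<and> cl x \<in> U \<and> sections F U \<noteq> {}" by (rule bspec)
  then show thesis using that by blast
qed

lemma trivialization_iso_transfer:
  assumes iso: "line_bundle_iso X F G"
    and G: "trivialization X a G \<Psi>"
  shows "\<exists>\<Phi>. trivialization X a F \<Phi>"
proof -
  from iso obtain \<phi> where iso': "\<forall>U. opn U \<longrightarrow>
     bij_betw (\<phi> U) (sections F U) (sections G U) \<and>
     (\<forall>s\<in>sections F U.
        (\<forall>f\<in>Aff X U. \<phi> U (act F U f s) = act G U f (\<phi> U s)) \<and>
        (\<forall>V. opn V \<longrightarrow> V \<subseteq> U \<longrightarrow> \<phi> V (res F U V s) = res G U V (\<phi> U s)))"
    unfolding line_bundle_iso_def ..
  have "trivialization X a F (\<lambda>U. \<Psi> U \<circ> \<phi> U)"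
    unfolding trivialization_def
  proof (intro allI impI conjI ballI)
    fix U assume U: "opn U"
    from iso' U have b: "bij_betw (\<phi> U) (sections F U) (sections G U)" by blast
    show "bij_betw (\<Psi> U \<circ> \<phi> U) (sections F U) (cocycle_sections X a U)"
      by (rule bij_betw_trans[OF b trivialization_bij[OF G U]])
    fix s assume s: "s \<in> sections F U"
    then have t: "\<phi> U s \<in> sections G U" by (rule bij_betw_apply[OF b])
    {
      fix f assume f: "f \<in> Aff X U"
      show "act F U f s \<in> sections F U" by (rule act_in[OF U s f])
      have "\<phi> U (act F U f s) = act G U f (\<phi> U s)" using iso' U s f by blast
      then show "(\<Psi> U \<circ> \<phi> U) (act F U f s) x = f (cl x) + (\<Psi> U \<circ> \<phi> U) s x" if "cl x \<in> U" for x
        using trivialization_act(2)[OF G U t f that] by simp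
    }
    fix V assume V: "opn V" "V \<subseteq> U"
    show "res F U V s \<in> sections F V"
      by (rule res_in[OF U V s])
    have "\<phi> V (res F U V s) = res G U V (\<phi> U s)" using iso' U s V by blast
    then show "(\<Psi> V \<circ> \<phi> V) (res F U V s) x = (\<Psi> U \<circ> \<phi> U) s x" if "cl x \<in> V" for x
      using trivialization_res(2)[OF G U t V that] by simp
  qed
  then show ?thesis by blast
qed

lemma chart_onD:
  assumes "chart_on X F B \<Phi>" "opn U" "s \<in> sections F U" "x \<in> B" "cl x \<in> U"
  shows chart_int_affine: "int_affine_at X (\<Phi> U s) x"
    and chart_act: "f \<in> Aff X U \<Longrightarrow> \<Phi> U (act F U f s) x = f (cl x) + \<Phi> U s x"
    and chart_res: "opn V \<Longrightarrow> V \<subseteq> U \<Longrightarrow> cl x \<in> V \<Longrightarrow> \<Phi> V (res F U V s) x = \<Phi> U s x"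
  using mp[OF bspec[OF bspec[OF mp[OF spec[OF assms(1)[unfolded chart_on_def]] assms(2)] assms(3)] assms(4)] assms(5)]
  by simp_all

text \<open>Passing from one section to another adds the same \<open>f\<close> to the values in both
  charts, so the difference of the charts depends only on the point of \<open>B\<close>.\<close>

lemma chart_difference:
  assumes \<Phi>: "chart_on X F B \<Phi>" and \<Psi>: "chart_on X F B \<Psi>" and B: "open B"
  obtains d where "\<And>x. x \<in> B \<Longrightarrow> int_affine_at X d x"
    "\<And>U s x. opn U \<Longrightarrow> s \<in> sections F U \<Longrightarrow> x \<in> B \<Longrightarrow> cl x \<in> U \<Longrightarrow> \<Psi> U s x = \<Phi> U s x + d x"
proof -
  have indep: "\<Psi> U s x - \<Phi> U s x = \<Psi> V t x - \<Phi> V t x"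
    if U: "opn U" "s \<in> sections F U" "cl x \<in> U" and V: "opn V" "t \<in> sections F V" "cl x \<in> V"
      and x: "x \<in> B" for U V s t x
  proof -
    define W where "W = U \<inter> V"
    have W: "opn W" "W \<subseteq> U" "W \<subseteq> V" "cl x \<in> W" using U V by (auto simp: W_def)
    have s': "res F U W s \<in> sections F W" and t': "res F V W t \<in> sections F W"
      using res_in U V W by auto
    obtain f where f: "f \<in> Aff X W" "act F W f (res F U W s) = res F V W t"
      using ex_act[OF W(1) s' t'] by blast
    have "\<Psi> V t x = f (cl x) + \<Psi> U s x"
      using chart_act[OF \<Psi> W(1) s' x W(4) f(1)] f(2) chart_res[OF \<Psi> U(1,2) x U(3) W(1,2,4)]
        chart_res[OF \<Psi> V(1,2) x V(3) W(1,3,4)] by simp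
    moreover have "\<Phi> V t x = f (cl x) + \<Phi> U s x"
      using chart_act[OF \<Phi> W(1) s' x W(4) f(1)] f(2) chart_res[OF \<Phi> U(1,2) x U(3) W(1,2,4)]
        chart_res[OF \<Phi> V(1,2) x V(3) W(1,3,4)] by simp
    ultimately show ?thesis by simp
  qed
  have "\<exists>d. \<forall>U s. opn U \<longrightarrow> s \<in> sections F U \<longrightarrow> x \<in> B \<longrightarrow> cl x \<in> U \<longrightarrow> \<Psi> U s x = \<Phi> U s x + d" for x
  proof -
    obtain V t where V: "opn V" "cl x \<in> V" "t \<in> sections F V" by (rule local_section)
    have "\<Psi> U s x = \<Phi> U s x + (\<Psi> V t x - \<Phi> V t x)"
      if "opn U" "s \<in> sections F U" "x \<in> B" "cl x \<in> U" for U s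
      using indep[OF that(1,2,4) V(1,3,2) that(3)] by simp
    then show ?thesis by blast
  qed
  then obtain d where d: "\<And>U s x. opn U \<Longrightarrow> s \<in> sections F U \<Longrightarrow> x \<in> B \<Longrightarrow> cl x \<in> U \<Longrightarrow>
      \<Psi> U s x = \<Phi> U s x + d x" by metis
  have "int_affine_at X d x" if x: "x \<in> B" for x
  proof -
    obtain V t where V: "opn V" "cl x \<in> V" "t \<in> sections F V" by (rule local_section)
    have "\<forall>\<^sub>F y in nhds x. d y = \<Psi> V t y - \<Phi> V t y"
      using eventually_torus_class[OF V(1,2)] eventually_nhds_in_open[OF B x]
      by eventually_elim (simp add: d[OF V(1,3)])
    then show ?thesis
      by (rule int_affine_at_cong[OF int_affine_at_diff[OF
        chart_int_affine[OF \<Psi> V(1,3) x V(2)] chart_int_affine[OF \<Phi> V(1,3) x V(2)]]])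
  qed
  with d that show thesis by blast
qed

lemma chart_difference_affine:
  assumes "chart_on X F B \<Phi>" "chart_on X F B \<Psi>" "open B" "connected B"
  obtains m c where "m \<in> dual_lattice (integral_lattice X)"
    "\<And>U s x. opn U \<Longrightarrow> s \<in> sections F U \<Longrightarrow> x \<in> B \<Longrightarrow> cl x \<in> U \<Longrightarrow>
      \<Psi> U s x = \<Phi> U s x + (blinfun_apply m x + c)"
proof -
  obtain d where d: "\<And>x. x \<in> B \<Longrightarrow> int_affine_at X d x"
    "\<And>U s x. opn U \<Longrightarrow> s \<in> sections F U \<Longrightarrow> x \<in> B \<Longrightarrow> cl x \<in> U \<Longrightarrow> \<Psi> U s x = \<Phi> U s x + d x"
    using chart_difference[OF assms(1-3)] by blast
  obtain m c where "m \<in> dual_lattice (integral_lattice X)" "\<forall>x\<in>B. d x = blinfun_apply m x + c"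
    using int_affine_on_connected[OF assms(4,3) d(1)] by blast
  with d(2) show thesis by (intro that[of m c]) auto
qed

text \<open>Two global charts differ by one affine function \<open>m x + c\<close>; its increment
  along a period is \<open>m \<gamma>\<close>, and the constant cancels.\<close>

lemma trivialization_difference:
  assumes "trivialization X a F \<Phi>" "trivialization X b F \<Psi>"
  obtains m where "m \<in> dual_lattice (integral_lattice X)"
    "\<And>\<gamma> x. \<gamma> \<in> period_lattice X \<Longrightarrow> b \<gamma> x = a \<gamma> x + blinfun_apply m \<gamma>"
proof -
  obtain m c where m: "m \<in> dual_lattice (integral_lattice X)" and
    eq: "\<And>U s x. opn U \<Longrightarrow> s \<in> sections F U \<Longrightarrow> x \<in> UNIV \<Longrightarrow> cl x \<in> U \<Longrightarrow>
      \<Psi> U s x = \<Phi> U s x + (blinfun_apply m x + c)"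
    using chart_difference_affine[OF trivialization_chart_on[OF assms(1)]
        trivialization_chart_on[OF assms(2)] open_UNIV connected_UNIV] by blast
  have "b \<gamma> x = a \<gamma> x + blinfun_apply m \<gamma>" if \<gamma>: "\<gamma> \<in> period_lattice X" for \<gamma> x
  proof -
    obtain V t where V: "opn V" "cl x \<in> V" "t \<in> sections F V" by (rule local_section)
    have V': "cl (x + \<gamma>) \<in> V" using V(2) \<gamma> by simp
    show ?thesis
      using trivialization_cocycle[OF assms(1) V(1,3,2) \<gamma>] trivialization_cocycle[OF assms(2) V(1,3,2) \<gamma>]
        eq[OF V(1,3) UNIV_I V(2)] eq[OF V(1,3) UNIV_I V'] by (simp add: blinfun.add_right)
  qed
  with m that show thesis by blast
qed

end

section \<open>Gluing charts over the universal cover\<close>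

context line_bundle
begin

text \<open>Charts are total functions with arbitrary values off their domain, so they can only be
  compared at points of \<open>B\<close> over \<open>U\<close>.\<close>

definition chart_eq_on :: "'v set \<Rightarrow> ('v set set \<Rightarrow> 's \<Rightarrow> 'v \<Rightarrow> real)
    \<Rightarrow> ('v set set \<Rightarrow> 's \<Rightarrow> 'v \<Rightarrow> real) \<Rightarrow> bool" where
  "chart_eq_on B \<Phi> \<Psi> \<longleftrightarrow> (\<forall>U s x. opn U \<longrightarrow> s \<in> sections F U \<longrightarrow> x \<in> B \<longrightarrow> cl x \<in> U \<longrightarrow>
     \<Phi> U s x = \<Psi> U s x)"

lemma chart_on_subset: "chart_on X F B \<Phi> \<Longrightarrow> B' \<subseteq> B \<Longrightarrow> chart_on X F B' \<Phi>"
  unfolding chart_on_def by fast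

text \<open>Holds because affinity refers to the germ of \<open>\<Phi> U s\<close> in the whole
  space and not within \<open>B\<close>; gluing thereby reduces to a check at each point.\<close>

lemma chart_on_pointwise: "chart_on X F B \<Phi> \<longleftrightarrow> (\<forall>x\<in>B. chart_on X F {x} \<Phi>)"
  unfolding chart_on_def by fast

text \<open>Openness of \<open>B\<close> turns agreement on \<open>B\<close> into agreement of
  germs, which is what affinity sees.\<close>

lemma chart_on_cong:
  assumes \<Phi>: "chart_on X F B \<Phi>" and eq: "chart_eq_on B \<Psi> \<Phi>" and B: "open B"
  shows "chart_on X F B \<Psi>"
  unfolding chart_on_def
proof (intro allI impI ballI conjI)
  fix U s x assume U: "opn U" and s: "s \<in> sections F U" and x: "x \<in> B" and xU: "cl x \<in> U"
  have eqs: "\<Psi> V t y = \<Phi> V t y" if "opn V" "t \<in> sections F V" "y \<in> B" "cl y \<in> V" for V t y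
    using eq that unfolding chart_eq_on_def by simp
  have "\<forall>\<^sub>F y in nhds x. \<Psi> U s y = \<Phi> U s y"
    using eventually_torus_class[OF U xU] eventually_nhds_in_open[OF B x]
    by eventually_elim (simp add: eqs U s)
  then show "int_affine_at X (\<Psi> U s) x"
    by (rule int_affine_at_cong[OF chart_int_affine[OF \<Phi> U s x xU]])
  show "\<Psi> U (act F U f s) x = f (cl x) + \<Psi> U s x" if f: "f \<in> Aff X U" for f
    using chart_act[OF \<Phi> U s x xU f] eqs[OF U s x xU] eqs[OF U act_in[OF U s f] x xU] by simp
  show "\<Psi> V (res F U V s) x = \<Psi> U s x" if V: "opn V" "V \<subseteq> U" "cl x \<in> V" for V
    using chart_res[OF \<Phi> U s x xU V] eqs[OF U s x xU] eqs[OF V(1) res_in[OF U V(1,2) s] x V(3)]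
    by simp
qed

lemma chart_on_shift:
  assumes \<Phi>: "chart_on X F B \<Phi>" and m: "m \<in> dual_lattice (integral_lattice X)"
  shows "chart_on X F B (\<lambda>U s x. \<Phi> U s x + (blinfun_apply m x + c))"
  unfolding chart_on_def
proof (intro allI impI ballI conjI)
  fix U s x assume U: "opn U" and s: "s \<in> sections F U" and x: "x \<in> B" and xU: "cl x \<in> U"
  show "int_affine_at X (\<lambda>x. \<Phi> U s x + (blinfun_apply m x + c)) x"
    by (intro int_affine_at_add[OF chart_int_affine[OF \<Phi> U s x xU]] int_affine_at_affine m)
qed (simp_all add: chart_act[OF \<Phi>] chart_res[OF \<Phi>])

text \<open>Analytic continuation for charts: \<open>\<Psi>\<close> and \<open>\<Phi>\<close> differ
  by one affine function on \<open>C\<close>, and the germ of that function at \<open>x\<close>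
  vanishes.\<close>

lemma chart_eq_onI_shift:
  assumes \<Phi>: "chart_on X F B \<Phi>" and B: "open B" "x \<in> B"
    and \<Psi>: "\<And>U s y. opn U \<Longrightarrow> s \<in> sections F U \<Longrightarrow> y \<in> C \<Longrightarrow> cl y \<in> U \<Longrightarrow>
      \<Psi> U s y = \<Phi> U s y + (blinfun_apply m y + c)"
    and eq: "chart_eq_on B \<Psi> \<Phi>" and C: "open C" "x \<in> C"
  shows "chart_eq_on C \<Psi> \<Phi>"
proof -
  obtain V t where V: "opn V" "cl x \<in> V" "t \<in> sections F V" by (rule local_section)
  have "\<forall>\<^sub>F y in nhds x. blinfun_apply m y + c = blinfun_apply 0 y + 0"
    using eventually_torus_class[OF V(1,2)] eventually_nhds_in_open[OF B] eventually_nhds_in_open[OF C]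
  proof eventually_elim
    case (elim y)
    have "\<Psi> V t y = \<Phi> V t y" using eq elim V unfolding chart_eq_on_def by simp
    with \<Psi>[OF V(1,3) elim(3,1)] show ?case by simp
  qed
  then have "m = 0 \<and> c = 0" by (rule affine_eventually_eqD)
  with \<Psi> show ?thesis unfolding chart_eq_on_def by simp
qed

text \<open>A section \<open>s0\<close> over \<open>U\<close> is used as origin: the chart sends
  \<open>s\<close> to the unique affine function \<open>f\<close> with
  \<open>f + s0 = s\<close>.\<close>

lemma chart_locally: "\<exists>B \<Phi>. open B \<and> convex B \<and> x \<in> B \<and> chart_on X F B \<Phi>"
proof -
  obtain U s0 where U: "opn U" "cl x \<in> U" "s0 \<in> sections F U" by (rule local_section)
  \<comment> \<open>\<open>D V s\<close> is the difference \<open>s - s0\<close>, a function on the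
    torus over \<open>V \<inter> U\<close>; the chart is its lift to the universal cover.\<close>
  define D where "D V s = (THE f. f \<in> Aff X (V \<inter> U) \<and>
      act F (V \<inter> U) f (res F U (V \<inter> U) s0) = res F V (V \<inter> U) s)" for V s
  have op: "opn (V \<inter> U)" if "opn V" for V using that U(1) by auto
  have s0: "res F U (V \<inter> U) s0 \<in> sections F (V \<inter> U)" if "opn V" for V
    by (rule res_in[OF U(1) op[OF that] Int_lower2 U(3)])
  have rs: "res F V (V \<inter> U) s \<in> sections F (V \<inter> U)" if "opn V" "s \<in> sections F V" for V s
    by (rule res_in[OF that(1) op[OF that(1)] Int_lower1 that(2)])
  have D: "D V s \<in> Aff X (V \<inter> U) \<and> act F (V \<inter> U) (D V s) (res F U (V \<inter> U) s0) = res F V (V \<inter> U) s"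
    if "opn V" "s \<in> sections F V" for V s
    unfolding D_def by (rule theI'[OF ex1_act[OF op[OF that(1)] s0[OF that(1)] rs[OF that]]])
  have Deq: "D V s = f" if "opn V" "s \<in> sections F V" "f \<in> Aff X (V \<inter> U)"
      "act F (V \<inter> U) f (res F U (V \<inter> U) s0) = res F V (V \<inter> U) s" for V s f
    using act_cancel[OF op[OF that(1)] s0[OF that(1)], of "D V s" f] D[OF that(1,2)] that(3,4) by simp
  have ch: "chart_on X F (cl -` U) (\<lambda>V s y. D V s (cl y))"
    unfolding chart_on_def
  proof (intro allI impI ballI conjI)
    fix V s y assume V: "opn V" and s: "s \<in> sections F V" and y: "y \<in> cl -` U" "cl y \<in> V"
    note DV = D[OF V s, THEN conjunct1] D[OF V s, THEN conjunct2]
    show "int_affine_at X (\<lambda>y. D V s (cl y)) y"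
      using y by (intro Aff_int_affine_at[OF DV(1)]) simp
    show "D V (act F V g s) (cl y) = g (cl y) + D V s (cl y)" if g: "g \<in> Aff X V" for g
    proof -
      note g' = Aff_restrict[OF op[OF V] Int_lower1 g]
      \<comment> \<open>By uniqueness of differences it is enough that \<open>g + (s - s0)\<close>
        moves \<open>s0\<close> to \<open>g + s\<close>.\<close>
      have "D V (act F V g s) = (\<lambda>p\<in>V \<inter> U. restrict g (V \<inter> U) p + D V s p)"
      proof (rule Deq[OF V act_in[OF V s g]])
        show "(\<lambda>p\<in>V \<inter> U. restrict g (V \<inter> U) p + D V s p) \<in> Aff X (V \<inter> U)"
          by (rule Aff_add[OF op[OF V] g' DV(1)])
        show "act F (V \<inter> U) (\<lambda>p\<in>V \<inter> U. restrict g (V \<inter> U) p + D V s p) (res F U (V \<inter> U) s0)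
            = res F V (V \<inter> U) (act F V g s)"
          using act_add[OF op[OF V] s0[OF V] g' DV(1)] DV(2) res_act[OF V s g op[OF V] Int_lower1]
          by simp
      qed
      then show ?thesis using y by simp
    qed
    show "D W (res F V W s) (cl y) = D V s (cl y)" if W: "opn W" "W \<subseteq> V" "cl y \<in> W" for W
    proof -
      have sub: "W \<inter> U \<subseteq> V \<inter> U" using W by blast
      have "D W (res F V W s) = restrict (D V s) (W \<inter> U)"
      proof (rule Deq[OF W(1) res_in[OF V W(1,2) s]])
        show "restrict (D V s) (W \<inter> U) \<in> Aff X (W \<inter> U)"
          by (rule Aff_restrict[OF op[OF W(1)] sub DV(1)])
        have "act F (W \<inter> U) (restrict (D V s) (W \<inter> U)) (res F (V \<inter> U) (W \<inter> U) (res F U (V \<inter> U) s0))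
            = res F (V \<inter> U) (W \<inter> U) (res F V (V \<inter> U) s)"
          using res_act[OF op[OF V] s0[OF V] DV(1) op[OF W(1)] sub] DV(2) by simp
        moreover have "res F (V \<inter> U) (W \<inter> U) (res F U (V \<inter> U) s0) = res F U (W \<inter> U) s0"
          by (rule res_res[OF U(1) op[OF V] op[OF W(1)] sub Int_lower2 U(3)])
        moreover have "res F (V \<inter> U) (W \<inter> U) (res F V (V \<inter> U) s) = res F V (W \<inter> U) s"
          by (rule res_res[OF V op[OF V] op[OF W(1)] sub Int_lower1 s])
        moreover have "res F W (W \<inter> U) (res F V W s) = res F V (W \<inter> U) s"
          by (rule res_res[OF V W(1) op[OF W(1)] Int_lower1 W(2) s])
        ultimately show "act F (W \<inter> U) (restrict (D V s) (W \<inter> U)) (res F U (W \<inter> U) s0)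
            = res F W (W \<inter> U) (res F V W s)" by simp
      qed
      then show ?thesis using y W by simp
    qed
  qed
  obtain e where "e > 0" "ball x e \<subseteq> cl -` U"
    using openE[OF open_vimage_torus_class[OF U(1)], of x] U(2) by auto
  then show ?thesis
    using chart_on_subset[OF ch] by (intro exI[of _ "ball x e"]) auto
qed

text \<open>On the connected overlap the two charts differ by one affine function, and adding it to
  \<open>\<Psi>\<close> on all of \<open>B\<close> makes them match. The chart on \<open>A\<close>
  stays as it is.\<close>

lemma chart_glue:
  assumes \<Phi>: "chart_on X F A \<Phi>" and \<Psi>: "chart_on X F B \<Psi>"
    and AB: "open A" "open B" "connected (A \<inter> B)"
  shows "\<exists>\<Theta>. chart_on X F (A \<union> B) \<Theta> \<and> chart_eq_on A \<Theta> \<Phi>"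
proof -
  obtain m c where m: "m \<in> dual_lattice (integral_lattice X)" and
    eq: "\<And>U s x. opn U \<Longrightarrow> s \<in> sections F U \<Longrightarrow> x \<in> A \<inter> B \<Longrightarrow> cl x \<in> U \<Longrightarrow>
      \<Phi> U s x = \<Psi> U s x + (blinfun_apply m x + c)"
    using chart_difference_affine[OF chart_on_subset[OF \<Psi>] chart_on_subset[OF \<Phi>] open_Int[OF AB(1,2)] AB(3)]
    by blast
  define \<Theta> where "\<Theta> U s x = (if x \<in> A then \<Phi> U s x else \<Psi> U s x + (blinfun_apply m x + c))" for U s x
  have A: "chart_eq_on A \<Theta> \<Phi>" by (simp add: chart_eq_on_def \<Theta>_def)
  have B: "chart_eq_on B \<Theta> (\<lambda>U s x. \<Psi> U s x + (blinfun_apply m x + c))"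
    using eq by (simp add: chart_eq_on_def \<Theta>_def)
  have "chart_on X F A \<Theta>" by (rule chart_on_cong[OF \<Phi> A AB(1)])
  moreover have "chart_on X F B \<Theta>" by (rule chart_on_cong[OF chart_on_shift[OF \<Psi> m] B AB(2)])
  ultimately have "chart_on X F (A \<union> B) \<Theta>" using chart_on_pointwise by blast
  with A show ?thesis by blast
qed

text \<open>Bisection along the segment from \<open>0\<close> to \<open>x\<close>. The union of two
  convex domains need not be convex, so each step shrinks it to a tube around the piece of the
  segment.\<close>

lemma chart_on_segment: "\<exists>B \<Phi>. open B \<and> convex B \<and> 0 \<in> B \<and> x \<in> B \<and> chart_on X F B \<Phi>"
proof -
  \<comment> \<open>Convexity is carried along because it makes the overlap of the domains of two
    adjacent pieces connected.\<close>
  define P where "P a b \<longleftrightarrow> (\<exists>B \<Phi>. open B \<and> convex B \<and> (\<lambda>t. t *\<^sub>R x) ` {a..b} \<subseteq> B \<and> chart_on X F B \<Phi>)"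
    for a b :: real
  have "P 0 1"
  proof (rule Bolzano)
    show "(0::real) \<le> 1" by simp
  next
    fix a b c :: real assume P: "P a b" "P b c" and abc: "a \<le> b" "b \<le> c"
    obtain A \<Phi> where A: "open A" "convex A" "(\<lambda>t. t *\<^sub>R x) ` {a..b} \<subseteq> A" "chart_on X F A \<Phi>"
      using P(1) unfolding P_def by blast
    obtain B \<Psi> where B: "open B" "convex B" "(\<lambda>t. t *\<^sub>R x) ` {b..c} \<subseteq> B" "chart_on X F B \<Psi>"
      using P(2) unfolding P_def by blast
    have "connected (A \<inter> B)" using A(2) B(2) by (intro convex_connected convex_Int)
    from chart_glue[OF A(4) B(4) A(1) B(1) this] obtain \<Theta> where \<Theta>: "chart_on X F (A \<union> B) \<Theta>" by blast
    let ?S = "(\<lambda>t. t *\<^sub>R x) ` {a..c}"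
    have S: "compact ?S" by (intro compact_continuous_image continuous_intros compact_Icc)
    have "{a..c} = {a..b} \<union> {b..c}" using abc by (simp add: ivl_disj_un)
    then have sub: "?S \<subseteq> A \<union> B" using A(3) B(3) by (auto simp: image_Un)
    \<comment> \<open>A tube of uniform radius fits into \<open>A \<union> B\<close> by compactness
      of the piece.\<close>
    obtain e where e: "e > 0" "(\<Union>y\<in>?S. ball y e) \<subseteq> A \<union> B"
      using compact_subset_open_imp_ball_epsilon_subset[OF S open_Un[OF A(1) B(1)] sub] by blast
    let ?T = "\<Union>y\<in>?S. ball y e"
    \<comment> \<open>The tube is the Minkowski sum of the piece and a ball, hence convex.\<close>
    have T: "?T = (\<Union>y\<in>?S. \<Union>z\<in>ball 0 e. {y + z})"
    proof (intro set_eqI iffI)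
      fix w assume "w \<in> ?T"
      then obtain y where "y \<in> ?S" "w \<in> ball y e" by blast
      then have "y \<in> ?S" "w - y \<in> ball 0 e" "w = y + (w - y)"
        by (auto simp: dist_norm norm_minus_commute)
      then show "w \<in> (\<Union>y\<in>?S. \<Union>z\<in>ball 0 e. {y + z})" by blast
    next
      fix w assume "w \<in> (\<Union>y\<in>?S. \<Union>z\<in>ball 0 e. {y + z})"
      then obtain y z where "y \<in> ?S" "z \<in> ball 0 e" "w = y + z" by blast
      then have "y \<in> ?S" "w \<in> ball y e" by (auto simp: dist_norm)
      then show "w \<in> ?T" by blast
    qed
    have "convex ?S" by (intro convex_linear_image linear_scaleR_left convex_real_interval)
    then have "convex ?T" unfolding T by (intro convex_sums convex_ball)
    moreover have "?S \<subseteq> ?T" using e(1) by force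
    moreover have "chart_on X F ?T \<Theta>" by (rule chart_on_subset[OF \<Theta> e(2)])
    moreover have "open ?T" by blast
    ultimately show "P a c" unfolding P_def by blast
  next
    fix t :: real
    obtain B \<Phi> where B: "open B" "convex B" "t *\<^sub>R x \<in> B" "chart_on X F B \<Phi>"
      using chart_locally by blast
    have "open ((\<lambda>t. t *\<^sub>R x) -` B)" by (intro open_vimage B(1) continuous_intros)
    then obtain d where d: "d > 0" "ball t d \<subseteq> (\<lambda>t. t *\<^sub>R x) -` B"
      using B(3) by (metis open_contains_ball vimageI2)
    have "P a b" if "a \<le> t" "t \<le> b" "b - a < d" for a b
    proof -
      have "{a..b} \<subseteq> ball t d" using that by (auto simp: dist_real_def)
      then have "(\<lambda>t. t *\<^sub>R x) ` {a..b} \<subseteq> B" using d(2) by blast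
      with B show ?thesis unfolding P_def by blast
    qed
    with d(1) show "\<exists>d>0. \<forall>a b. a \<le> t \<and> t \<le> b \<and> b - a < d \<longrightarrow> P a b" by blast
  qed
  then obtain B \<Phi> where B: "open B" "convex B" "(\<lambda>t. t *\<^sub>R x) ` {0..1} \<subseteq> B" "chart_on X F B \<Phi>"
    unfolding P_def by blast
  moreover have "0 \<in> (\<lambda>t. t *\<^sub>R x) ` {0..1}" "x \<in> (\<lambda>t. t *\<^sub>R x) ` {0..1}"
    by (auto simp: image_iff intro: bexI[of _ 0] bexI[of _ 1])
  ultimately show ?thesis by blast
qed

text \<open>Every point gets a convex domain containing \<open>0\<close>, and every chart is
  normalized to agree with \<open>\<Phi>0\<close> near \<open>0\<close>. Overlaps are convex and
  contain \<open>0\<close>, so agreement near \<open>0\<close> spreads over them.\<close>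

lemma chart_on_UNIV: "\<exists>\<Phi>. chart_on X F UNIV \<Phi>"
proof -
  obtain B0 \<Phi>0 where B0: "open B0" "convex B0" "0 \<in> B0" "chart_on X F B0 \<Phi>0"
    using chart_locally by blast
  \<comment> \<open>Gluing with \<open>\<Phi>0\<close> serves only as normalization: the union of
    the domains is cut back to the convex set \<open>B\<close>.\<close>
  have "\<exists>B \<Phi>. open B \<and> convex B \<and> 0 \<in> B \<and> x \<in> B \<and> chart_on X F B \<Phi> \<and> chart_eq_on (B \<inter> B0) \<Phi> \<Phi>0" for x
  proof -
    obtain B \<Psi> where B: "open B" "convex B" "0 \<in> B" "x \<in> B" "chart_on X F B \<Psi>"
      using chart_on_segment by blast
    have "connected (B0 \<inter> B)" using B(2) B0(2) by (intro convex_connected convex_Int)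
    from chart_glue[OF B0(4) B(5) B0(1) B(1) this]
    obtain \<Theta> where "chart_on X F (B0 \<union> B) \<Theta>" "chart_eq_on B0 \<Theta> \<Phi>0" by blast
    then have "chart_on X F B \<Theta>" "chart_eq_on (B \<inter> B0) \<Theta> \<Phi>0"
      by (auto intro: chart_on_subset simp: chart_eq_on_def)
    with B show ?thesis by blast
  qed
  then obtain B \<Phi> where B: "\<And>x. open (B x)" "\<And>x. convex (B x)" "\<And>x. 0 \<in> B x" "\<And>x. x \<in> B x"
    "\<And>x. chart_on X F (B x) (\<Phi> x)" "\<And>x. chart_eq_on (B x \<inter> B0) (\<Phi> x) \<Phi>0" by metis
  have agree: "chart_eq_on (B x \<inter> B y) (\<Phi> y) (\<Phi> x)" for x y
  proof -
    have xy: "open (B x \<inter> B y)" "connected (B x \<inter> B y)"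
      using B by (auto intro!: convex_connected convex_Int)
    have ch: "chart_on X F (B x \<inter> B y) (\<Phi> x)" "chart_on X F (B x \<inter> B y) (\<Phi> y)"
      using B(5) by (auto intro: chart_on_subset)
    obtain m c where "m \<in> dual_lattice (integral_lattice X)" and
      eq: "\<And>U s z. opn U \<Longrightarrow> s \<in> sections F U \<Longrightarrow> z \<in> B x \<inter> B y \<Longrightarrow> cl z \<in> U \<Longrightarrow>
        \<Phi> y U s z = \<Phi> x U s z + (blinfun_apply m z + c)"
      using chart_difference_affine[OF ch xy] by blast
    show ?thesis
    \<comment> \<open>Continuation starts at the point \<open>0\<close>, near which both charts
      equal \<open>\<Phi>0\<close>.\<close>
    proof (rule chart_eq_onI_shift[OF _ _ _ eq])
      show "chart_on X F (B x \<inter> B y \<inter> B0) (\<Phi> x)" using ch(1) by (rule chart_on_subset) blast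
      show "chart_eq_on (B x \<inter> B y \<inter> B0) (\<Phi> y) (\<Phi> x)"
        using B(6)[of x] B(6)[of y] unfolding chart_eq_on_def by simp
    qed (use B B0 xy in auto)
  qed
  \<comment> \<open>At each point \<open>y\<close> its own chart \<open>\<Phi> y\<close> is used; on
    \<open>B x\<close> this diagonal family agrees with \<open>\<Phi> x\<close>.\<close>
  have "chart_on X F (B x) (\<lambda>U s y. \<Phi> y U s y)" for x
  proof (rule chart_on_cong[OF B(5) _ B(1)])
    show "chart_eq_on (B x) (\<lambda>U s y. \<Phi> y U s y) (\<Phi> x)"
      using agree B(4) unfolding chart_eq_on_def by blast
  qed
  then have "chart_on X F UNIV (\<lambda>U s y. \<Phi> y U s y)"
    using chart_on_subset B(4) by (subst chart_on_pointwise) blast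
  then show ?thesis by blast
qed

end

section \<open>From a global chart to a cocycle\<close>

context line_bundle
begin

text \<open>Translation by a period does not move the class of a point, so it only exchanges the
  lifts at which the chart is evaluated.\<close>

lemma chart_on_translate:
  assumes \<Phi>: "chart_on X F UNIV \<Phi>" and \<gamma>: "\<gamma> \<in> period_lattice X"
  shows "chart_on X F UNIV (\<lambda>U s x. \<Phi> U s (x + \<gamma>))"
  unfolding chart_on_def
proof (intro allI impI ballI conjI)
  fix U s x assume U: "opn U" and s: "s \<in> sections F U" and x: "cl x \<in> U"
  have x': "cl (x + \<gamma>) \<in> U" using x \<gamma> by simp
  show "int_affine_at X (\<lambda>x. \<Phi> U s (x + \<gamma>)) x"
    using int_affine_at_compose[of X "\<Phi> U s" id_blinfun x \<gamma> X]
      chart_int_affine[OF \<Phi> U s UNIV_I x'] by simp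
  show "\<Phi> U (act F U f s) (x + \<gamma>) = f (cl x) + \<Phi> U s (x + \<gamma>)" if "f \<in> Aff X U" for f
    using chart_act[OF \<Phi> U s UNIV_I x' that] \<gamma> by simp
  show "\<Phi> V (res F U V s) (x + \<gamma>) = \<Phi> U s (x + \<gamma>)" if "opn V" "V \<subseteq> U" "cl x \<in> V" for V
    using chart_res[OF \<Phi> U s UNIV_I x' that(1,2)] that(3) \<gamma> by simp
qed

text \<open>Injectivity: sections with equal values differ by the zero function. Surjectivity: where
  \<open>F\<close> has a section \<open>s\<close>, the difference \<open>u - \<Phi> U s\<close> is
  periodic because both terms have the cocycle \<open>a\<close>, so it descends to an affine
  function that moves \<open>s\<close> to the wanted section; the sheaf axiom glues these.\<close>

lemma chart_trivialization:
  assumes \<Phi>: "chart_on X F UNIV \<Phi>"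
    and a: "\<And>U s x \<gamma>. opn U \<Longrightarrow> s \<in> sections F U \<Longrightarrow> cl x \<in> U \<Longrightarrow> \<gamma> \<in> period_lattice X \<Longrightarrow>
      \<Phi> U s (x + \<gamma>) = \<Phi> U s x + a \<gamma> x"
  shows "trivialization X a F (\<lambda>U s. restrict (\<Phi> U s) (cl -` U))"
proof -
  have inj: "s = t" if U: "opn U" and st: "s \<in> sections F U" "t \<in> sections F U"
      and eq: "\<And>x. cl x \<in> U \<Longrightarrow> \<Phi> U s x = \<Phi> U t x" for U s t
  proof -
    obtain f where f: "f \<in> Aff X U" "act F U f s = t" using ex_act[OF U st] by blast
    have "f = (\<lambda>p\<in>U. 0)"
    proof (rule Aff_eqI[OF f(1) Aff_zero[OF U] U])
      fix x assume x: "cl x \<in> U"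
      show "f (cl x) = (\<lambda>p\<in>U. 0) (cl x)"
        using chart_act[OF \<Phi> U st(1) UNIV_I x f(1)] f(2) eq[OF x] x by simp
    qed
    with f(2) act_zero[OF U st(1)] show ?thesis by simp
  qed
  have surj_local: "\<exists>s\<in>sections F U. \<forall>x. cl x \<in> U \<longrightarrow> \<Phi> U s x = u x"
    if U: "opn U" and s: "s \<in> sections F U" and V: "U \<subseteq> V" and u: "u \<in> cocycle_sections X a V"
    for U V s u
  proof -
    have "\<exists>f\<in>Aff X U. \<forall>x. cl x \<in> U \<longrightarrow> f (cl x) = u x - \<Phi> U s x"
    proof (rule Aff_descend[OF U])
      fix x assume x: "cl x \<in> U"
      show "int_affine_at X (\<lambda>x. u x - \<Phi> U s x) x"
        using u V x chart_int_affine[OF \<Phi> U s UNIV_I x]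
        by (auto simp: cocycle_sections_def intro!: int_affine_at_diff)
      show "u (x + \<gamma>) - \<Phi> U s (x + \<gamma>) = u x - \<Phi> U s x" if "\<gamma> \<in> period_lattice X" for \<gamma>
        using u V x a[OF U s x that] that by (auto simp: cocycle_sections_def)
    qed
    then obtain f where f: "f \<in> Aff X U" "\<And>x. cl x \<in> U \<Longrightarrow> f (cl x) = u x - \<Phi> U s x" by blast
    have "\<Phi> U (act F U f s) x = u x" if "cl x \<in> U" for x
      using chart_act[OF \<Phi> U s UNIV_I that f(1)] f(2)[OF that] by simp
    with act_in[OF U s f(1)] show ?thesis by blast
  qed
  have surj: "\<exists>s\<in>sections F U. \<forall>x. cl x \<in> U \<longrightarrow> \<Phi> U s x = u x"
    if U: "opn U" and u: "u \<in> cocycle_sections X a U" for U u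
  proof -
    \<comment> \<open>All open subsets of \<open>U\<close> that carry sections; they cover
      \<open>U\<close>, and the local solutions match on overlaps by injectivity.\<close>
    define \<U> where "\<U> = {V. opn V \<and> V \<subseteq> U \<and> sections F V \<noteq> {}}"
    have V: "opn V" "V \<subseteq> U" if "V \<in> \<U>" for V using that by (auto simp: \<U>_def)
    have "\<exists>s\<in>sections F V. \<forall>x. cl x \<in> V \<longrightarrow> \<Phi> V s x = u x" if "V \<in> \<U>" for V
    proof -
      obtain s where "s \<in> sections F V" using \<open>V \<in> \<U>\<close> by (auto simp: \<U>_def)
      from surj_local[OF V(1)[OF that] this V(2)[OF that] u] show ?thesis .
    qed
    then obtain t where t: "\<And>V. V \<in> \<U> \<Longrightarrow> t V \<in> sections F V"
      "\<And>V x. V \<in> \<U> \<Longrightarrow> cl x \<in> V \<Longrightarrow> \<Phi> V (t V) x = u x" by metis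
    have compat: "res F V (V \<inter> W) (t V) = res F W (V \<inter> W) (t W)" if VW: "V \<in> \<U>" "W \<in> \<U>" for V W
    proof -
      have op: "opn (V \<inter> W)" using V VW by blast
      show ?thesis
      proof (rule inj[OF op])
        show "res F V (V \<inter> W) (t V) \<in> sections F (V \<inter> W)"
          by (rule res_in[OF V(1)[OF VW(1)] op Int_lower1 t(1)[OF VW(1)]])
        show "res F W (V \<inter> W) (t W) \<in> sections F (V \<inter> W)"
          by (rule res_in[OF V(1)[OF VW(2)] op Int_lower2 t(1)[OF VW(2)]])
        fix x assume x: "cl x \<in> V \<inter> W"
        show "\<Phi> (V \<inter> W) (res F V (V \<inter> W) (t V)) x = \<Phi> (V \<inter> W) (res F W (V \<inter> W) (t W)) x"
          using chart_res[OF \<Phi> V(1)[OF VW(1)] t(1)[OF VW(1)] UNIV_I _ op Int_lower1 x]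
            chart_res[OF \<Phi> V(1)[OF VW(2)] t(1)[OF VW(2)] UNIV_I _ op Int_lower2 x]
            t(2)[OF VW(1)] t(2)[OF VW(2)] x by simp
      qed
    qed
    have cover: "\<exists>V\<in>\<U>. cl x \<in> V" if "cl x \<in> U" for x
    proof -
      obtain W s where W: "opn W" "cl x \<in> W" "s \<in> sections F W" by (rule local_section)
      have "opn (W \<inter> U)" using W U by blast
      moreover have "res F W (W \<inter> U) s \<in> sections F (W \<inter> U)"
        by (rule res_in[OF W(1) \<open>opn (W \<inter> U)\<close> Int_lower1 W(3)])
      ultimately have "W \<inter> U \<in> \<U>" by (auto simp: \<U>_def)
      with W that show ?thesis by blast
    qed
    have Un: "\<Union>\<U> = U"
    proof
      show "\<Union>\<U> \<subseteq> U" using V(2) by blast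
      show "U \<subseteq> \<Union>\<U>" using cover openin_subset_points[OF U] by blast
    qed
    obtain s where s: "s \<in> sections F (\<Union>\<U>)" "\<And>V. V \<in> \<U> \<Longrightarrow> res F (\<Union>\<U>) V s = t V"
      using glue[of \<U> t, OF V(1) t(1) compat] by blast
    have "\<Phi> U s x = u x" if x: "cl x \<in> U" for x
    proof -
      obtain W where W: "W \<in> \<U>" "cl x \<in> W" using cover[OF x] by blast
      show ?thesis
        using chart_res[OF \<Phi> U _ UNIV_I x V[OF W(1)] W(2), of s] s Un W t(2)[OF W] by simp
    qed
    with s Un show ?thesis by auto
  qed
  show ?thesis unfolding trivialization_def
  proof (intro allI impI conjI ballI)
    fix U assume U: "opn U"
    show "bij_betw (\<lambda>s. restrict (\<Phi> U s) (cl -` U)) (sections F U) (cocycle_sections X a U)"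
      unfolding bij_betw_def
    proof (intro conjI inj_onI equalityI subsetI)
      fix s t assume st: "s \<in> sections F U" "t \<in> sections F U"
        and eq: "restrict (\<Phi> U s) (cl -` U) = restrict (\<Phi> U t) (cl -` U)"
      show "s = t"
      proof (rule inj[OF U st])
        fix x assume "cl x \<in> U"
        then show "\<Phi> U s x = \<Phi> U t x" using fun_cong[OF eq, of x] by simp
      qed
    next
      fix u assume "u \<in> (\<lambda>s. restrict (\<Phi> U s) (cl -` U)) ` sections F U"
      then obtain s where s: "s \<in> sections F U" "u = restrict (\<Phi> U s) (cl -` U)" by blast
      show "u \<in> cocycle_sections X a U" unfolding s(2)
        by (intro restrict_in_cocycle_sections U chart_int_affine[OF \<Phi> U s(1) UNIV_I] a s(1))
    next
      fix u assume u: "u \<in> cocycle_sections X a U"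
      then obtain s where s: "s \<in> sections F U" "\<And>x. cl x \<in> U \<Longrightarrow> \<Phi> U s x = u x"
        using surj[OF U] by blast
      have "u = restrict (\<Phi> U s) (cl -` U)"
        using u s(2) by (intro extensionalityI[of _ "cl -` U"]) (auto simp: cocycle_sections_def)
      with s(1) show "u \<in> (\<lambda>s. restrict (\<Phi> U s) (cl -` U)) ` sections F U" by blast
    qed
    fix s assume s: "s \<in> sections F U"
    show "act F U f s \<in> sections F U" if "f \<in> Aff X U" for f by (rule act_in[OF U s that])
    show "restrict (\<Phi> U (act F U f s)) (cl -` U) x = f (cl x) + restrict (\<Phi> U s) (cl -` U) x"
      if "f \<in> Aff X U" "cl x \<in> U" for f x
      using chart_act[OF \<Phi> U s UNIV_I that(2,1)] that by simp
    show "res F U V s \<in> sections F V" if "opn V" "V \<subseteq> U" for V by (rule res_in[OF U that s])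
    show "restrict (\<Phi> V (res F U V s)) (cl -` V) x = restrict (\<Phi> U s) (cl -` U) x"
      if "opn V" "V \<subseteq> U" "cl x \<in> V" for V x
      using chart_res[OF \<Phi> U s UNIV_I _ that] that by auto
  qed
qed

text \<open>Translating the global chart by \<open>\<gamma>\<close> gives another global chart, and
  the affine difference of the two is the value of the cocycle at \<open>\<gamma>\<close>.\<close>

theorem ex_trivialization:
  obtains m c \<Phi> where "\<And>\<gamma>. \<gamma> \<in> period_lattice X \<Longrightarrow> m \<gamma> \<in> dual_lattice (integral_lattice X)"
    and "trivialization X (\<lambda>\<gamma> x. blinfun_apply (m \<gamma>) x + c \<gamma>) F \<Phi>"
proof -
  obtain \<Phi> where \<Phi>: "chart_on X F UNIV \<Phi>" using chart_on_UNIV by blast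
  have "\<exists>m c. \<gamma> \<in> period_lattice X \<longrightarrow> m \<in> dual_lattice (integral_lattice X) \<and>
    (\<forall>U s x. opn U \<longrightarrow> s \<in> sections F U \<longrightarrow> cl x \<in> U \<longrightarrow>
      \<Phi> U s (x + \<gamma>) = \<Phi> U s x + (blinfun_apply m x + c))" for \<gamma>
  proof (cases "\<gamma> \<in> period_lattice X")
    case True
    show ?thesis
      using chart_difference_affine[OF \<Phi> chart_on_translate[OF \<Phi> True] open_UNIV connected_UNIV]
      by (metis UNIV_I)
  qed simp
  then obtain m c where "\<And>\<gamma>. \<gamma> \<in> period_lattice X \<Longrightarrow> m \<gamma> \<in> dual_lattice (integral_lattice X)"
    and "\<And>\<gamma> U s x. \<gamma> \<in> period_lattice X \<Longrightarrow> opn U \<Longrightarrow> s \<in> sections F U \<Longrightarrow> cl x \<in> U \<Longrightarrow>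
      \<Phi> U s (x + \<gamma>) = \<Phi> U s x + (blinfun_apply (m \<gamma>) x + c \<gamma>)"
    by metis
  then show thesis using that[OF _ chart_trivialization[OF \<Phi>]] by blast
qed

text \<open>Both sides measure the change of one section value from \<open>x\<close> to
  \<open>x + \<gamma> + \<delta>\<close>, directly or in two steps.\<close>

lemma trivialization_cocycle_identity:
  assumes triv: "trivialization X a F \<Phi>" and \<gamma>: "\<gamma> \<in> period_lattice X" "\<delta> \<in> period_lattice X"
  shows "a (\<gamma> + \<delta>) x = a \<gamma> x + a \<delta> (x + \<gamma>)"
proof -
  obtain U s where U: "opn U" "cl x \<in> U" "s \<in> sections F U" by (rule local_section)
  have "cl (x + \<gamma>) \<in> U" using U \<gamma> by simp
  then show ?thesis
    using trivialization_cocycle[OF triv U(1,3,2) \<gamma>(1)] trivialization_cocycle[OF triv U(1,3) _ \<gamma>(2), of "x + \<gamma>"]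
      trivialization_cocycle[OF triv U(1,3,2) add_period[OF \<gamma>]]
    by (simp add: add.assoc)
qed

end

text \<open>Cocycle sections are honest functions with pointwise operations, so the sheaf and torsor
  axioms can be checked on values. Local existence of sections is not contained in a trivialization
  and enters through \<open>loc\<close>.\<close>

lemma (in period_group) trivialization_line_bundle:
  assumes triv: "trivialization X a F \<Phi>"
    and loc: "\<And>x. \<exists>U. opn U \<and> cl x \<in> U \<and> sections F U \<noteq> {}"
  shows "tropical_line_bundle X F"
proof -
  note res = trivialization_res[OF triv] and act = trivialization_act[OF triv]
    and eqI = trivialization_eqI[OF triv] and coc = trivialization_cocycle[OF triv]
  have affine: "int_affine_at X (\<Phi> U s) x" if "opn U" "s \<in> sections F U" "cl x \<in> U" for U s x
    using trivialization_chart_on[OF triv, of UNIV, unfolded chart_on_def] that by simp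
  have presheaf: "presheaf_on (torus_topology X) F"
    unfolding presheaf_on_def
  proof (intro conjI allI impI ballI)
    show "res F U V s \<in> sections F V" if "opn U" "opn V" "V \<subseteq> U" "s \<in> sections F U" for U V s
      by (rule res(1)[OF that(1,4,2,3)])
    show "res F U U s = s" if U: "opn U" and s: "s \<in> sections F U" for U s
      by (rule eqI[OF U res(1)[OF U s U order_refl] s]) (rule res(2)[OF U s U order_refl])
    show "res F V W (res F U V s) = res F U W s" if U: "opn U" and V: "opn V" and W: "opn W"
      and WV: "W \<subseteq> V" and VU: "V \<subseteq> U" and s: "s \<in> sections F U" for U V W s
    proof (rule eqI[OF W])
      have WU: "W \<subseteq> U" using WV VU by simp
      note r = res[OF U s V VU]
      show "res F V W (res F U V s) \<in> sections F W" by (rule res(1)[OF V r(1) W WV])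
      show "res F U W s \<in> sections F W" by (rule res(1)[OF U s W WU])
      show "\<Phi> W (res F V W (res F U V s)) x = \<Phi> W (res F U W s) x" if x: "cl x \<in> W" for x
        using res(2)[OF V r(1) W WV x] res(2)[OF U s W WU x] r(2)[of x] x WV by auto
    qed
  qed
  have glue: "\<exists>!s. s \<in> sections F (\<Union>\<U>) \<and> (\<forall>U\<in>\<U>. res F (\<Union>\<U>) U s = t U)"
    if op: "\<forall>U\<in>\<U>. opn U \<and> t U \<in> sections F U"
      and compat: "\<forall>U\<in>\<U>. \<forall>V\<in>\<U>. res F U (U \<inter> V) (t U) = res F V (U \<inter> V) (t V)" for \<U> t
  proof -
    have Un: "opn (\<Union>\<U>)" using op by (intro openin_Union) blast
    have sub: "U \<subseteq> \<Union>\<U>" if "U \<in> \<U>" for U using that by blast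
    \<comment> \<open>Any member of the cover containing the class of \<open>x\<close> may be
      chosen, by compatibility on intersections.\<close>
    define u where "u x = \<Phi> (SOME U. U \<in> \<U> \<and> cl x \<in> U) (t (SOME U. U \<in> \<U> \<and> cl x \<in> U)) x" for x
    have u: "u x = \<Phi> U (t U) x" if U: "U \<in> \<U>" and x: "cl x \<in> U" for U x
    proof -
      define V where "V = (SOME U. U \<in> \<U> \<and> cl x \<in> U)"
      have V: "V \<in> \<U>" "cl x \<in> V" using someI[of "\<lambda>U. U \<in> \<U> \<and> cl x \<in> U" U] U x by (auto simp: V_def)
      have o: "opn U" "opn V" "opn (U \<inter> V)" "t U \<in> sections F U" "t V \<in> sections F V"
        using op U V by auto
      have "\<Phi> U (t U) x = \<Phi> V (t V) x"
        using res(2)[OF o(1,4,3) Int_lower1, of x] res(2)[OF o(2,5,3) Int_lower2, of x]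
          compat[rule_format, OF U V(1)] V(2) x by simp
      then show ?thesis by (simp add: u_def V_def)
    qed
    have "\<exists>s\<in>sections F (\<Union>\<U>). \<forall>x. cl x \<in> \<Union>\<U> \<longrightarrow> \<Phi> (\<Union>\<U>) s x = u x"
    proof (rule trivialization_section[OF triv Un])
      fix x assume "cl x \<in> \<Union>\<U>"
      then obtain U where U: "U \<in> \<U>" "cl x \<in> U" by blast
      then have o: "opn U" "t U \<in> sections F U" using op by auto
      have "\<forall>\<^sub>F y in nhds x. u y = \<Phi> U (t U) y"
        using eventually_torus_class[OF o(1) U(2)] by eventually_elim (rule u[OF U(1)])
      then show "int_affine_at X u x"
        by (rule int_affine_at_cong[OF affine[OF o U(2)]])
      show "u (x + \<gamma>) = u x + a \<gamma> x" if "\<gamma> \<in> period_lattice X" for \<gamma>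
        using coc[OF o U(2) that] u[OF U] u[OF U(1), of "x + \<gamma>"] U that by simp
    qed
    then obtain s where s1: "s \<in> sections F (\<Union>\<U>)"
      and s2: "\<forall>x. cl x \<in> \<Union>\<U> \<longrightarrow> \<Phi> (\<Union>\<U>) s x = u x" by (elim bexE)
    note s = s1 s2[rule_format]
    show ?thesis
    proof (intro ex1I[of _ s] conjI ballI)
      show "s \<in> sections F (\<Union>\<U>)" by fact
      show "res F (\<Union>\<U>) U s = t U" if U: "U \<in> \<U>" for U
      proof (rule eqI)
        show "opn U" "t U \<in> sections F U" using op U by auto
        show "res F (\<Union>\<U>) U s \<in> sections F U" by (rule res(1)[OF Un s(1) \<open>opn U\<close> sub[OF U]])
        show "\<Phi> U (res F (\<Union>\<U>) U s) x = \<Phi> U (t U) x" if "cl x \<in> U" for x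
          using res(2)[OF Un s(1) \<open>opn U\<close> sub[OF U] that] s(2)[of x, OF subsetD[OF sub[OF U] that]] u[OF U that] by simp
      qed
      fix s' assume s': "s' \<in> sections F (\<Union>\<U>) \<and> (\<forall>U\<in>\<U>. res F (\<Union>\<U>) U s' = t U)"
      show "s' = s"
      proof (rule eqI[OF Un _ s(1)])
        show s'': "s' \<in> sections F (\<Union>\<U>)" using s' by blast
        fix x assume x: "cl x \<in> \<Union>\<U>"
        then obtain U where U: "U \<in> \<U>" "cl x \<in> U" by blast
        have "opn U" using op U by blast
        with res(2)[OF Un s'' _ sub[OF U(1)] U(2)] s' U u[OF U] s(2)[OF x]
        show "\<Phi> (\<Union>\<U>) s' x = \<Phi> (\<Union>\<U>) s x" by simp
      qed
    qed
  qed
  have sheaf: "sheaf_on (torus_topology X) F"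
    unfolding sheaf_on_def by (intro conjI presheaf allI impI glue)
  show ?thesis unfolding tropical_line_bundle_def
  proof (intro conjI allI impI ballI sheaf)
    fix U s assume U: "opn U" and s: "s \<in> sections F U"
    show "act F U (\<lambda>p\<in>U. 0) s = s"
      by (rule eqI[OF U act(1)[OF U s Aff_zero[OF U]] s]) (simp add: act(2)[OF U s Aff_zero[OF U]])
    show "act F U f s \<in> sections F U" if "f \<in> Aff X U" for f by (rule act(1)[OF U s that])
    show "act F U (\<lambda>p\<in>U. f p + g p) s = act F U f (act F U g s)"
      if f: "f \<in> Aff X U" and g: "g \<in> Aff X U" for f g
    proof (rule eqI[OF U])
      note fg = Aff_add[OF U f g]
      show "act F U (\<lambda>p\<in>U. f p + g p) s \<in> sections F U" by (rule act(1)[OF U s fg])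
      show "act F U f (act F U g s) \<in> sections F U" by (rule act(1)[OF U act(1)[OF U s g] f])
      show "\<Phi> U (act F U (\<lambda>p\<in>U. f p + g p) s) x = \<Phi> U (act F U f (act F U g s)) x" if "cl x \<in> U" for x
        using act(2)[OF U s fg that] act(2)[OF U s g that] act(2)[OF U act(1)[OF U s g] f that] that
        by simp
    qed
    show "res F U V (act F U f s) = act F V (restrict f V) (res F U V s)"
      if f: "f \<in> Aff X U" and V: "opn V" "V \<subseteq> U" for f V
    proof (rule eqI[OF V(1)])
      note f' = Aff_restrict[OF V f] and a = act[OF U s f] and r = res[OF U s V]
      show "res F U V (act F U f s) \<in> sections F V" by (rule res(1)[OF U a(1) V])
      show "act F V (restrict f V) (res F U V s) \<in> sections F V" by (rule act(1)[OF V(1) r(1) f'])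
      show "\<Phi> V (res F U V (act F U f s)) x = \<Phi> V (act F V (restrict f V) (res F U V s)) x"
        if x: "cl x \<in> V" for x
        using res(2)[OF U a(1) V x] a(2)[of x] act(2)[OF V(1) r(1) f' x] r(2)[OF x] x V(2) by auto
    qed
    show "\<exists>!f. f \<in> Aff X U \<and> act F U f s = t" if t: "t \<in> sections F U" for t
    proof -
      \<comment> \<open>The cocycle cancels in the difference of two sections, which is therefore
        periodic.\<close>
      have "\<exists>f\<in>Aff X U. \<forall>x. cl x \<in> U \<longrightarrow> f (cl x) = \<Phi> U t x - \<Phi> U s x"
        by (rule Aff_descend[OF U]) (simp_all add: coc U s t int_affine_at_diff affine)
      then obtain f where f: "f \<in> Aff X U" "\<And>x. cl x \<in> U \<Longrightarrow> f (cl x) = \<Phi> U t x - \<Phi> U s x" by blast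
      show ?thesis
      proof (intro ex1I[of _ f] conjI f(1))
        show "act F U f s = t"
          by (rule eqI[OF U act(1)[OF U s f(1)] t]) (simp add: act(2)[OF U s f(1)] f(2))
        fix g assume g: "g \<in> Aff X U \<and> act F U g s = t"
        show "g = f"
          by (rule Aff_eqI[OF _ f(1) U]) (use g f(2) act(2)[OF U s, of g] in auto)
      qed
    qed
  next
    fix p assume "p \<in> torus_points X"
    then show "\<exists>U. opn U \<and> p \<in> U \<and> sections F U \<noteq> {}" using loc by (auto simp: torus_points_def)
  qed
qed

section \<open>Pullbacks along affine maps\<close>

text \<open>The map \<open>\<iota>\<close> of tori is covered by the affine map
  \<open>A y + b\<close>. Only its linear part has to respect the two lattices; \<open>b\<close> is
  free, which allows the slice at an arbitrary point of the dual torus.\<close>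

locale pullback_map = Y: period_group Y + X: line_bundle X F
  for Y :: "'w::real_normed_vector torus" and X :: "'v::real_normed_vector torus"
    and F :: "('v set, 's) aff_presheaf" +
  fixes \<iota> :: "'w set \<Rightarrow> 'v set" and A :: "'w \<Rightarrow>\<^sub>L 'v" and b :: 'v
    and a :: "'v \<Rightarrow> 'v \<Rightarrow> real" and \<Phi> :: "'v set set \<Rightarrow> 's \<Rightarrow> 'v \<Rightarrow> real"
  assumes lattice: "blinfun_apply A ` integral_lattice Y \<subseteq> integral_lattice X"
    and period: "blinfun_apply A ` period_lattice Y \<subseteq> period_lattice X"
    and lift: "\<iota> (torus_class Y y) = torus_class X (blinfun_apply A y + b)"
    and triv: "trivialization X a F \<Phi>"
begin

abbreviation j :: "'w \<Rightarrow> 'v" where "j y \<equiv> blinfun_apply A y + b"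
abbreviation pairs :: "('v set, 's, 'w set) pb_pair set" where "pairs \<equiv> pb_pairs X Y \<iota> F"
abbreviation germ where "germ \<equiv> pb_germ X Y \<iota> F"
abbreviation P where "P \<equiv> pullback X Y \<iota> F"

text \<open>A pair of the contracted product is read as a sum, which does not change when some
  \<open>h\<close> is moved from one entry to the other.\<close>

definition pair_value :: "('v set, 's, 'w set) pb_pair \<Rightarrow> 'w \<Rightarrow> real" where
  "pair_value = (\<lambda>(V, s, W, g) y. \<Phi> V s (j y) + g (Y.cl y))"

text \<open>
  A stalk element of the pullback is the set of all pairs whose value in the trivialization has a
  given germ.
\<close>

definition germ_at :: "'w \<Rightarrow> ('w \<Rightarrow> real) \<Rightarrow> ('v set, 's, 'w set) pb_pair set" where
  "germ_at y u = {(V, s, W, g) \<in> pairs. Y.cl y \<in> W \<and> (\<forall>\<^sub>F z in nhds y. pair_value (V, s, W, g) z = u z)}"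

lemma chart: "chart_on X F UNIV \<Phi>"
  using triv by (rule X.trivialization_chart_on)

lemma pairsD:
  assumes "(V, s, W, g) \<in> pairs"
  shows "X.opn V" "s \<in> sections F V" "Y.opn W" "g \<in> Aff Y W"
    and "Y.cl y \<in> W \<Longrightarrow> X.cl (j y) \<in> V" and "p \<in> W \<Longrightarrow> \<iota> p \<in> V"
  using assms by (auto simp: pb_pairs_def simp flip: lift)

lemma pair_value_int_affine:
  assumes "(V, s, W, g) \<in> pairs" "Y.cl y \<in> W"
  shows "int_affine_at Y (pair_value (V, s, W, g)) y"
proof -
  note p = pairsD[OF assms(1)]
  have "int_affine_at Y (\<lambda>y. \<Phi> V s (j y)) y"
    using X.chart_int_affine[OF chart p(1,2) UNIV_I p(5)[OF assms(2)]] lattice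
    by (rule int_affine_at_compose)
  then show ?thesis
    using Y.Aff_int_affine_at[OF p(4) assms(2)] unfolding pair_value_def
    by (simp add: int_affine_at_add)
qed

lemma pair_value_cocycle:
  assumes "(V, s, W, g) \<in> pairs" "Y.cl y \<in> W" "\<gamma> \<in> period_lattice Y"
  shows "pair_value (V, s, W, g) (y + \<gamma>) = pair_value (V, s, W, g) y + a (blinfun_apply A \<gamma>) (j y)"
proof -
  note p = pairsD[OF assms(1)]
  have "blinfun_apply A \<gamma> \<in> period_lattice X" using period assms(3) by blast
  from X.trivialization_cocycle[OF triv p(1,2) p(5)[OF assms(2)] this] assms(3)
  show ?thesis by (simp add: pair_value_def blinfun.add_right add.assoc add.commute[of b])
qed

lemma germ_at_cong:
  assumes "\<forall>\<^sub>F z in nhds y. u z = v z"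
  shows "germ_at y u = germ_at y v"
proof -
  have "germ_at y u \<subseteq> germ_at y v" if "\<forall>\<^sub>F z in nhds y. u z = v z" for u v
    using that unfolding germ_at_def by (auto elim: eventually_elim2)
  from this[of u v] this[of v u] assms show ?thesis by (auto simp: eq_commute)
qed

text \<open>The only candidate for the \<open>h\<close> to be moved across is the difference of the
  two sections of \<open>F\<close>, and for it the condition on \<open>g\<close> and
  \<open>g'\<close> says exactly that the sums agree near \<open>y\<close>.\<close>

lemma pb_equiv_iff:
  assumes r: "(V, s, W, g) \<in> pairs" and r': "(V', s', W', g') \<in> pairs"
    and y: "Y.cl y \<in> W"
  shows "pb_equiv X Y \<iota> F (Y.cl y) (V, s, W, g) (V', s', W', g') \<longleftrightarrow>
    Y.cl y \<in> W' \<and> (\<forall>\<^sub>F z in nhds y. pair_value (V', s', W', g') z = pair_value (V, s, W, g) z)"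
proof
  note p = pairsD[OF r] and p' = pairsD[OF r']
  assume "pb_equiv X Y \<iota> F (Y.cl y) (V, s, W, g) (V', s', W', g')"
  then obtain V0 W0 h where V0: "X.opn V0" "V0 \<subseteq> V" "V0 \<subseteq> V'" and W0: "Y.opn W0" "Y.cl y \<in> W0"
      "W0 \<subseteq> W" "W0 \<subseteq> W'" "\<iota> ` W0 \<subseteq> V0" and h: "h \<in> Aff X V0"
      "res F V' V0 s' = act F V0 h (res F V V0 s)" "\<And>z. z \<in> W0 \<Longrightarrow> g z = h (\<iota> z) + g' z"
    unfolding pb_equiv_def by auto
  have "\<forall>\<^sub>F z in nhds y. pair_value (V', s', W', g') z = pair_value (V, s, W, g) z"
    using Y.eventually_torus_class[OF W0(1,2)]
  proof eventually_elim
    case (elim z)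
    have z: "X.cl (j z) \<in> V0" using elim W0(5) by (auto simp flip: lift)
    then have zV: "X.cl (j z) \<in> V" "X.cl (j z) \<in> V'" using V0 by auto
    note rs = X.res_in[OF p(1) V0(1,2) p(2)]
    have "\<Phi> V' s' (j z) = h (X.cl (j z)) + \<Phi> V s (j z)"
      using X.chart_res[OF chart p(1,2) UNIV_I zV(1) V0(1,2) z]
        X.chart_res[OF chart p'(1,2) UNIV_I zV(2) V0(1,3) z]
        X.chart_act[OF chart V0(1) rs UNIV_I z h(1)] h(2) by simp
    with h(3)[OF elim] show ?case by (simp add: pair_value_def lift)
  qed
  with W0 show "Y.cl y \<in> W' \<and> (\<forall>\<^sub>F z in nhds y. pair_value (V', s', W', g') z = pair_value (V, s, W, g) z)"
    by blast
next
  note p = pairsD[OF r] and p' = pairsD[OF r']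
  assume "Y.cl y \<in> W' \<and> (\<forall>\<^sub>F z in nhds y. pair_value (V', s', W', g') z = pair_value (V, s, W, g) z)"
  then have y': "Y.cl y \<in> W'"
    and eq: "\<forall>\<^sub>F z in nhds y. pair_value (V', s', W', g') z = pair_value (V, s, W, g) z" by auto
  define V0 where "V0 = V \<inter> V'"
  have V0: "X.opn V0" "V0 \<subseteq> V" "V0 \<subseteq> V'" using p p' by (auto simp: V0_def)
  note rs = X.res_in[OF p(1) V0(1,2) p(2)] and rs' = X.res_in[OF p'(1) V0(1,3) p'(2)]
  obtain h where h: "h \<in> Aff X V0" "act F V0 h (res F V V0 s) = res F V' V0 s'"
    using X.ex_act[OF V0(1) rs rs'] by blast
  have "\<forall>\<^sub>F z in nhds y. Y.cl z \<in> W \<and> Y.cl z \<in> W' \<and> g (Y.cl z) = h (\<iota> (Y.cl z)) + g' (Y.cl z)"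
    using eq Y.eventually_torus_class[OF p(3) y] Y.eventually_torus_class[OF p'(3) y']
  proof eventually_elim
    case (elim z)
    have zV: "X.cl (j z) \<in> V" "X.cl (j z) \<in> V'" using p(5) p'(5) elim by auto
    then have z: "X.cl (j z) \<in> V0" by (simp add: V0_def)
    have "\<Phi> V' s' (j z) = h (X.cl (j z)) + \<Phi> V s (j z)"
      using X.chart_res[OF chart p(1,2) UNIV_I zV(1) V0(1,2) z]
        X.chart_res[OF chart p'(1,2) UNIV_I zV(2) V0(1,3) z]
        X.chart_act[OF chart V0(1) rs UNIV_I z h(1)] h(2) by simp
    with elim show ?case by (simp add: pair_value_def lift)
  qed
  from Y.eventually_torus_nbhd[OF this] obtain W0 where W0: "Y.opn W0" "Y.cl y \<in> W0"
    "\<And>q. q \<in> W0 \<Longrightarrow> q \<in> W \<and> q \<in> W' \<and> g q = h (\<iota> q) + g' q" by blast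
  have "\<iota> ` W0 \<subseteq> V0" using W0(3) p(6) p'(6) by (auto simp: V0_def)
  then show "pb_equiv X Y \<iota> F (Y.cl y) (V, s, W, g) (V', s', W', g')"
    unfolding pb_equiv_def prod.case
    using V0 W0 h by (intro exI[of _ V0] exI[of _ W0] exI[of _ h]) auto
qed

lemma germ_eq_germ_at:
  assumes r: "(V, s, W, g) \<in> pairs" and y: "Y.cl y \<in> W"
  shows "germ (Y.cl y) (V, s, W, g) = germ_at y (pair_value (V, s, W, g))"
  unfolding pb_germ_def germ_at_def using pb_equiv_iff[OF r _ y] by auto

lemma sectionE:
  assumes "\<sigma> \<in> sections P U" "p \<in> U"
  obtains V s W g where "(V, s, W, g) \<in> pairs" "p \<in> W" "W \<subseteq> U"
    "\<And>q. q \<in> W \<Longrightarrow> \<sigma> q = germ q (V, s, W, g)"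
  using assms unfolding pullback_def by auto

lemma sectionI:
  assumes "\<sigma> \<in> extensional U"
    and "\<And>p. p \<in> U \<Longrightarrow> \<exists>V s W g. (V, s, W, g) \<in> pairs \<and> p \<in> W \<and> W \<subseteq> U \<and>
      (\<forall>q\<in>W. \<sigma> q = germ q (V, s, W, g))"
  shows "\<sigma> \<in> sections P U"
  using assms unfolding pullback_def by simp

text \<open>The representative is arbitrary: all representatives of one stalk element have the same
  germ of values at \<open>y\<close>.\<close>

definition section_value :: "('w set \<Rightarrow> ('v set, 's, 'w set) pb_pair set) \<Rightarrow> 'w \<Rightarrow> real" where
  "section_value \<sigma> y = pair_value (SOME r. r \<in> \<sigma> (Y.cl y)) y"

lemma section_value_eq:
  assumes r: "r \<in> \<sigma> (Y.cl y)" and \<sigma>: "\<sigma> (Y.cl y) = germ_at y u"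
  shows "section_value \<sigma> y = u y"
proof -
  have "(SOME r. r \<in> \<sigma> (Y.cl y)) \<in> germ_at y u" using r unfolding \<sigma> by (rule someI)
  then have "\<forall>\<^sub>F z in nhds y. pair_value (SOME r. r \<in> \<sigma> (Y.cl y)) z = u z"
    by (auto simp: germ_at_def)
  then show ?thesis unfolding section_value_def by (rule eventually_nhds_x_imp_x)
qed

lemma pair_in_germ_at: "(V, s, W, g) \<in> pairs \<Longrightarrow> Y.cl y \<in> W \<Longrightarrow>
    (V, s, W, g) \<in> germ_at y (pair_value (V, s, W, g))"
  by (simp add: germ_at_def)

lemma section_value_germ:
  assumes "(V, s, W, g) \<in> pairs" "Y.cl y \<in> W" "\<sigma> (Y.cl y) = germ (Y.cl y) (V, s, W, g)"
  shows "section_value \<sigma> y = pair_value (V, s, W, g) y"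
  using section_value_eq[of "(V, s, W, g)" \<sigma> y] pair_in_germ_at[OF assms(1,2)]
    assms(3)[unfolded germ_eq_germ_at[OF assms(1,2)]] by simp

lemma section_eq_germ_at:
  assumes "\<sigma> \<in> sections P U" "Y.cl y \<in> U"
  shows "\<sigma> (Y.cl y) = germ_at y (section_value \<sigma>)"
proof -
  obtain V s W g where r: "(V, s, W, g) \<in> pairs" "Y.cl y \<in> W" "W \<subseteq> U"
    "\<And>q. q \<in> W \<Longrightarrow> \<sigma> q = germ q (V, s, W, g)" using sectionE[OF assms] by blast
  have "\<forall>\<^sub>F z in nhds y. pair_value (V, s, W, g) z = section_value \<sigma> z"
    using Y.eventually_torus_class[OF pairsD(3)[OF r(1)] r(2)]
    by eventually_elim (simp add: section_value_germ[OF r(1)] r(4))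
  from germ_at_cong[OF this] r(4)[OF r(2)] germ_eq_germ_at[OF r(1,2)] show ?thesis by simp
qed

text \<open>Take any local section \<open>s\<close> of \<open>F\<close> near the image of
  \<open>y\<close>; the remainder of \<open>u\<close> after subtracting its values along
  \<open>j\<close> is periodic and descends to the affine entry \<open>g\<close>.\<close>

lemma ex_pair:
  assumes U: "Y.opn U" "Y.cl y \<in> U" and aff: "\<And>x. Y.cl x \<in> U \<Longrightarrow> int_affine_at Y u x"
    and coc: "\<And>x \<gamma>. Y.cl x \<in> U \<Longrightarrow> \<gamma> \<in> period_lattice Y \<Longrightarrow> u (x + \<gamma>) = u x + a (blinfun_apply A \<gamma>) (j x)"
  obtains V s W g where "(V, s, W, g) \<in> pairs" "Y.cl y \<in> W" "W \<subseteq> U"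
    "\<And>z. Y.cl z \<in> W \<Longrightarrow> pair_value (V, s, W, g) z = u z"
proof -
  obtain V s where V: "X.opn V" "X.cl (j y) \<in> V" "s \<in> sections F V" by (rule X.local_section)
  define W where "W = {p \<in> U. \<iota> p \<in> V}"
  have Wiff: "Y.cl z \<in> W \<longleftrightarrow> Y.cl z \<in> U \<and> X.cl (j z) \<in> V" for z by (simp add: W_def lift)
  have "Y.cl -` W = Y.cl -` U \<inter> j -` (X.cl -` V)" using Wiff by auto
  moreover have "open (j -` (X.cl -` V))"
    by (intro open_vimage X.open_vimage_torus_class[OF V(1)] continuous_intros)
  ultimately have W: "Y.opn W"
    using U(1) by (auto simp: openin_torus_topology W_def)
  note affs = X.chart_int_affine[OF chart V(1,3) UNIV_I]
  have "\<exists>g\<in>Aff Y W. \<forall>z. Y.cl z \<in> W \<longrightarrow> g (Y.cl z) = u z - \<Phi> V s (j z)"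
  proof (rule Y.Aff_descend[OF W])
    fix z assume z: "Y.cl z \<in> W"
    show "int_affine_at Y (\<lambda>z. u z - \<Phi> V s (j z)) z"
      using z int_affine_at_compose[OF affs lattice, of z] by (intro int_affine_at_diff aff) (auto simp: Wiff)
    fix \<gamma> assume \<gamma>: "\<gamma> \<in> period_lattice Y"
    then have "blinfun_apply A \<gamma> \<in> period_lattice X" using period by blast
    then have "\<Phi> V s (j z + blinfun_apply A \<gamma>) = \<Phi> V s (j z) + a (blinfun_apply A \<gamma>) (j z)"
      using X.trivialization_cocycle[OF triv V(1,3)] z Wiff by blast
    then show "u (z + \<gamma>) - \<Phi> V s (j (z + \<gamma>)) = u z - \<Phi> V s (j z)"
      using coc[OF _ \<gamma>, of z] z Wiff by (simp add: blinfun.add_right algebra_simps)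
  qed
  then obtain g where g: "g \<in> Aff Y W" "\<And>z. Y.cl z \<in> W \<Longrightarrow> g (Y.cl z) = u z - \<Phi> V s (j z)" by blast
  have "(V, s, W, g) \<in> pairs" using V W g(1) by (auto simp: pb_pairs_def W_def)
  then show thesis
    by (rule that) (use U V g(2) in \<open>auto simp: Wiff pair_value_def W_def lift\<close>)
qed

lemma pair_restrict:
  assumes r: "(V, s, W, g) \<in> pairs" and U: "Y.opn U"
  shows "(V, s, W \<inter> U, restrict g (W \<inter> U)) \<in> pairs"
proof -
  note p = pairsD[OF r]
  have W: "Y.opn (W \<inter> U)" using p(3) U by blast
  show ?thesis
    using p W Y.Aff_restrict[OF W Int_lower1 p(4)] by (auto simp: pb_pairs_def)
qed

lemma pair_act:
  assumes r: "(V, s, W, g) \<in> pairs" and f: "f \<in> Aff Y U" "W \<subseteq> U"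
  shows "(V, s, W, \<lambda>w\<in>W. f w + g w) \<in> pairs"
    and "Y.cl y \<in> W \<Longrightarrow> pair_value (V, s, W, \<lambda>w\<in>W. f w + g w) y = f (Y.cl y) + pair_value (V, s, W, g) y"
proof -
  note p = pairsD[OF r]
  have "(\<lambda>w\<in>W. restrict f W w + g w) \<in> Aff Y W"
    by (rule Y.Aff_add[OF p(3) Y.Aff_restrict[OF p(3) f(2,1)] p(4)])
  moreover have "(\<lambda>w\<in>W. restrict f W w + g w) = (\<lambda>w\<in>W. f w + g w)" by auto
  ultimately show "(V, s, W, \<lambda>w\<in>W. f w + g w) \<in> pairs"
    using p by (auto simp: pb_pairs_def)
qed (simp add: pair_value_def)

text \<open>The action is defined as a union over representatives with domain inside
  \<open>U\<close>. Adding \<open>f\<close> respects equality of germs, so all members of the union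
  coincide, and the given pair shows that there is at least one.\<close>

lemma pullback_act:
  assumes r: "(V, s, W, g) \<in> pairs" and W: "W \<subseteq> U" and f: "f \<in> Aff Y U"
    and y: "Y.cl y \<in> W" and \<sigma>: "\<sigma> (Y.cl y) = germ (Y.cl y) (V, s, W, g)"
  shows "act P U f \<sigma> (Y.cl y) = germ (Y.cl y) (V, s, W, \<lambda>w\<in>W. f w + g w)"
proof -
  let ?q = "Y.cl y"
  have \<sigma>': "\<sigma> ?q = germ_at y (pair_value (V, s, W, g))" by (simp add: \<sigma> germ_eq_germ_at[OF r y])
  have eq: "germ ?q (V', s', W', \<lambda>w\<in>W'. f w + g' w) = germ ?q (V, s, W, \<lambda>w\<in>W. f w + g w)"
    if r': "(V', s', W', g') \<in> \<sigma> ?q" "W' \<subseteq> U" for V' s' W' g'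
  proof -
    have p': "(V', s', W', g') \<in> pairs" "?q \<in> W'"
      and ev: "\<forall>\<^sub>F z in nhds y. pair_value (V', s', W', g') z = pair_value (V, s, W, g) z"
      using r'(1) unfolding \<sigma>' germ_at_def by auto
    note a = pair_act[OF r f W] and a' = pair_act[OF p'(1) f r'(2)]
    have "\<forall>\<^sub>F z in nhds y. pair_value (V', s', W', \<lambda>w\<in>W'. f w + g' w) z
        = pair_value (V, s, W, \<lambda>w\<in>W. f w + g w) z"
      using ev Y.eventually_torus_class[OF pairsD(3)[OF r] y]
        Y.eventually_torus_class[OF pairsD(3)[OF p'(1)] p'(2)]
      by eventually_elim (simp add: a(2) a'(2))
    from germ_at_cong[OF this] show ?thesis
      by (simp add: germ_eq_germ_at[OF a(1) y] germ_eq_germ_at[OF a'(1) p'(2)])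
  qed
  have mem: "(V, s, W, g) \<in> \<sigma> ?q" unfolding \<sigma>' by (rule pair_in_germ_at[OF r y])
  have q: "?q \<in> U" using y W by blast
  then have "act P U f \<sigma> ?q = (\<Union>(V, s, W, g) \<in> {(V, s, W, g) \<in> \<sigma> ?q. W \<subseteq> U}.
        germ ?q (V, s, W, \<lambda>w\<in>W. f w + g w))" by (simp add: pullback_def)
  also have "\<dots> = (\<Union>r \<in> {(V, s, W, g) \<in> \<sigma> ?q. W \<subseteq> U}. germ ?q (V, s, W, \<lambda>w\<in>W. f w + g w))"
    using eq by (intro SUP_cong) auto
  also have "\<dots> = germ ?q (V, s, W, \<lambda>w\<in>W. f w + g w)"
  proof -
    have "(V, s, W, g) \<in> {(V, s, W, g) \<in> \<sigma> ?q. W \<subseteq> U}" using mem W by simp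
    then show ?thesis by blast
  qed
  finally show ?thesis .
qed

theorem pullback_trivialization:
  "trivialization Y (\<lambda>\<gamma> y. a (blinfun_apply A \<gamma>) (blinfun_apply A y + b)) P
     (\<lambda>U \<sigma>. restrict (section_value \<sigma>) (Y.cl -` U))"
  (is "trivialization Y ?a P ?\<Psi>")
  unfolding trivialization_def
proof (intro allI impI conjI ballI)
  fix U assume U: "Y.opn U"
  show "bij_betw (?\<Psi> U) (sections P U) (cocycle_sections Y ?a U)"
    unfolding bij_betw_def
  proof (intro conjI inj_onI equalityI subsetI)
    fix \<sigma> \<tau> assume \<sigma>: "\<sigma> \<in> sections P U" and \<tau>: "\<tau> \<in> sections P U" and eq: "?\<Psi> U \<sigma> = ?\<Psi> U \<tau>"
    have val: "section_value \<sigma> y = section_value \<tau> y" if "Y.cl y \<in> U" for y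
      using fun_cong[OF eq, of y] that by simp
    show "\<sigma> = \<tau>"
    proof (rule extensionalityI)
      show "\<sigma> \<in> extensional U" "\<tau> \<in> extensional U" using \<sigma> \<tau> by (auto simp: pullback_def)
      fix p assume p: "p \<in> U"
      then obtain y where y: "p = Y.cl y" using Y.openin_subset_points[OF U] by blast
      have "\<forall>\<^sub>F z in nhds y. section_value \<sigma> z = section_value \<tau> z"
        using Y.eventually_torus_class[OF U, of y] p y by (auto elim: eventually_mono intro: val)
      from germ_at_cong[OF this] show "\<sigma> p = \<tau> p"
        using section_eq_germ_at[OF \<sigma>] section_eq_germ_at[OF \<tau>] p y by simp
    qed
  next
    fix u assume "u \<in> ?\<Psi> U ` sections P U"
    then obtain \<sigma> where \<sigma>: "\<sigma> \<in> sections P U" and u: "u = ?\<Psi> U \<sigma>" by blast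
    show "u \<in> cocycle_sections Y ?a U" unfolding u
    proof (rule Y.restrict_in_cocycle_sections[OF U])
      fix y assume y: "Y.cl y \<in> U"
      obtain V s W g where r: "(V, s, W, g) \<in> pairs" "Y.cl y \<in> W" "W \<subseteq> U"
        "\<And>q. q \<in> W \<Longrightarrow> \<sigma> q = germ q (V, s, W, g)" using sectionE[OF \<sigma> y] by blast
      have val: "section_value \<sigma> z = pair_value (V, s, W, g) z" if "Y.cl z \<in> W" for z
        by (rule section_value_germ[of V s W g z \<sigma>, OF r(1) that r(4)[OF that]])
      have "\<forall>\<^sub>F z in nhds y. section_value \<sigma> z = pair_value (V, s, W, g) z"
        using Y.eventually_torus_class[OF pairsD(3)[OF r(1)] r(2)] by eventually_elim (rule val)
      then show "int_affine_at Y (section_value \<sigma>) y"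
        by (rule int_affine_at_cong[OF pair_value_int_affine[OF r(1,2)]])
      show "section_value \<sigma> (y + \<gamma>) = section_value \<sigma> y + ?a \<gamma> y" if "\<gamma> \<in> period_lattice Y" for \<gamma>
        using pair_value_cocycle[OF r(1,2) that] val[OF r(2)] val[of "y + \<gamma>"] r(2) that by simp
    qed
  next
    fix u assume u: "u \<in> cocycle_sections Y ?a U"
    \<comment> \<open>The germ is taken at an arbitrary lift of \<open>p\<close>. Every lift gives
      the same stalk element, since it equals the germ of a pair, which depends on the class
      only.\<close>
    define \<sigma> where "\<sigma> = (\<lambda>p\<in>U. germ_at (SOME y. Y.cl y = p) u)"
    have rep: "\<exists>V s W g. (V, s, W, g) \<in> pairs \<and> p \<in> W \<and> W \<subseteq> U \<and>
        (\<forall>z. Y.cl z \<in> W \<longrightarrow> \<sigma> (Y.cl z) = germ (Y.cl z) (V, s, W, g) \<and> pair_value (V, s, W, g) z = u z)"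
      if p: "p \<in> U" for p
    proof -
      obtain y where y: "p = Y.cl y" using Y.openin_subset_points[OF U p] by blast
      have y': "Y.cl y \<in> U" using p y by simp
      obtain V s W g where r: "(V, s, W, g) \<in> pairs" "Y.cl y \<in> W" "W \<subseteq> U"
        "\<And>z. Y.cl z \<in> W \<Longrightarrow> pair_value (V, s, W, g) z = u z"
      proof (rule ex_pair[OF U y'])
        show "int_affine_at Y u x" if "Y.cl x \<in> U" for x
          using u that by (simp add: cocycle_sections_def)
        show "u (x + \<gamma>) = u x + a (blinfun_apply A \<gamma>) (j x)"
          if "Y.cl x \<in> U" "\<gamma> \<in> period_lattice Y" for x \<gamma>
          using u that by (simp add: cocycle_sections_def)
      qed blast
      have "\<sigma> (Y.cl z) = germ (Y.cl z) (V, s, W, g)" if z: "Y.cl z \<in> W" for z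
      proof -
        define x where "x = (SOME y. Y.cl y = Y.cl z)"
        have x: "Y.cl x = Y.cl z" unfolding x_def by (rule someI) simp
        then have xW: "Y.cl x \<in> W" using z by simp
        have "\<forall>\<^sub>F t in nhds x. pair_value (V, s, W, g) t = u t"
          using Y.eventually_torus_class[OF pairsD(3)[OF r(1)] xW] by eventually_elim (rule r(4))
        from germ_at_cong[OF this] have "germ (Y.cl x) (V, s, W, g) = germ_at x u"
          by (simp add: germ_eq_germ_at[OF r(1) xW])
        moreover have "\<sigma> (Y.cl z) = germ_at x u"
          using z r(3) by (auto simp: \<sigma>_def x_def)
        ultimately show ?thesis using x by simp
      qed
      with r y show ?thesis by blast
    qed
    have "\<sigma> \<in> sections P U"
    proof (rule sectionI)
      show "\<sigma> \<in> extensional U" by (simp add: \<sigma>_def)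
      fix p assume "p \<in> U"
      from rep[OF this] obtain V s W g where r: "(V, s, W, g) \<in> pairs" "p \<in> W" "W \<subseteq> U"
        "\<And>z. Y.cl z \<in> W \<Longrightarrow> \<sigma> (Y.cl z) = germ (Y.cl z) (V, s, W, g)" by blast
      have "\<sigma> q = germ q (V, s, W, g)" if "q \<in> W" for q
        using r(4) that Y.openin_subset_points[OF pairsD(3)[OF r(1)] that] by blast
      with r(1-3) show "\<exists>V s W g. (V, s, W, g) \<in> pairs \<and> p \<in> W \<and> W \<subseteq> U \<and>
        (\<forall>q\<in>W. \<sigma> q = germ q (V, s, W, g))" by blast
    qed
    moreover have "u = ?\<Psi> U \<sigma>"
    proof (rule extensionalityI)
      show "u \<in> extensional (Y.cl -` U)" using u by (simp add: cocycle_sections_def)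
      fix y assume "y \<in> Y.cl -` U"
      then have y: "Y.cl y \<in> U" by simp
      from rep[OF y] obtain V s W g where r: "(V, s, W, g) \<in> pairs" "Y.cl y \<in> W"
        "\<sigma> (Y.cl y) = germ (Y.cl y) (V, s, W, g)" "pair_value (V, s, W, g) y = u y" by blast
      then show "u y = ?\<Psi> U \<sigma> y" using section_value_germ[of V s W g y \<sigma>] y by simp
    qed simp
    ultimately show "u \<in> ?\<Psi> U ` sections P U" by blast
  qed
  fix \<sigma> assume \<sigma>: "\<sigma> \<in> sections P U"
  show "act P U f \<sigma> \<in> sections P U" if f: "f \<in> Aff Y U" for f
  proof (rule sectionI)
    show "act P U f \<sigma> \<in> extensional U" by (simp add: pullback_def)
    fix p assume "p \<in> U"
    from sectionE[OF \<sigma> this] obtain V s W g where r: "(V, s, W, g) \<in> pairs" "p \<in> W" "W \<subseteq> U"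
        "\<And>q. q \<in> W \<Longrightarrow> \<sigma> q = germ q (V, s, W, g)" by blast
    have "act P U f \<sigma> q = germ q (V, s, W, \<lambda>w\<in>W. f w + g w)" if q: "q \<in> W" for q
    proof -
      obtain y where "q = Y.cl y" using Y.openin_subset_points[OF pairsD(3)[OF r(1)] q] by blast
      then show ?thesis using pullback_act[OF r(1,3) f, of y \<sigma>] q r(4)[OF q] by simp
    qed
    with pair_act(1)[OF r(1) f r(3)] r(2,3)
    show "\<exists>V s W g. (V, s, W, g) \<in> pairs \<and> p \<in> W \<and> W \<subseteq> U \<and>
        (\<forall>q\<in>W. act P U f \<sigma> q = germ q (V, s, W, g))" by blast
  qed
  show "?\<Psi> U (act P U f \<sigma>) y = f (Y.cl y) + ?\<Psi> U \<sigma> y" if f: "f \<in> Aff Y U" and y: "Y.cl y \<in> U" for f y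
  proof -
    from sectionE[OF \<sigma> y] obtain V s W g where r: "(V, s, W, g) \<in> pairs" "Y.cl y \<in> W" "W \<subseteq> U"
        "\<And>q. q \<in> W \<Longrightarrow> \<sigma> q = germ q (V, s, W, g)" by blast
    note a = pair_act[OF r(1) f r(3)]
    show ?thesis
      using section_value_germ[of V s W g y \<sigma>, OF r(1,2) r(4)[OF r(2)]] a(2)[OF r(2)] y
        section_value_germ[where \<sigma> = "act P U f \<sigma>", OF a(1) r(2) pullback_act[of V s W g U f y \<sigma>, OF r(1,3) f r(2) r(4)[OF r(2)]]]
      by simp
  qed
  fix V assume V: "Y.opn V" "V \<subseteq> U"
  have res: "res P U V \<sigma> = restrict \<sigma> V" by (simp add: pullback_def)
  show "res P U V \<sigma> \<in> sections P V"
    unfolding res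
  proof (rule sectionI)
    fix p assume p: "p \<in> V"
    then have "p \<in> U" using V by blast
    from sectionE[OF \<sigma> this] obtain V' s W g where r: "(V', s, W, g) \<in> pairs" "p \<in> W" "W \<subseteq> U"
        "\<And>q. q \<in> W \<Longrightarrow> \<sigma> q = germ q (V', s, W, g)" by blast
    \<comment> \<open>The domain of the representing pair may exceed \<open>V\<close>, so it is cut
      down to \<open>W \<inter> V\<close>; germs are unaffected.\<close>
    note r' = pair_restrict[OF r(1) V(1)]
    have "restrict \<sigma> V q = germ q (V', s, W \<inter> V, restrict g (W \<inter> V))" if q: "q \<in> W \<inter> V" for q
    proof -
      obtain y where y: "q = Y.cl y" using Y.openin_subset_points[OF V(1), of q] q by blast
      have yW: "Y.cl y \<in> W" "Y.cl y \<in> W \<inter> V" using q y by auto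
      have "\<forall>\<^sub>F z in nhds y. pair_value (V', s, W, g) z = pair_value (V', s, W \<inter> V, restrict g (W \<inter> V)) z"
        using Y.eventually_torus_class[OF pairsD(3)[OF r'] yW(2)]
        by eventually_elim (simp add: pair_value_def)
      from germ_at_cong[OF this] show ?thesis
        using q r(4)[of q] germ_eq_germ_at[OF r(1) yW(1)] germ_eq_germ_at[OF r' yW(2)] y by simp
    qed
    with r' p r(2) show "\<exists>V' s W g. (V', s, W, g) \<in> pairs \<and> p \<in> W \<and> W \<subseteq> V \<and>
        (\<forall>q\<in>W. restrict \<sigma> V q = germ q (V', s, W, g))" by blast
  qed simp
  show "?\<Psi> V (res P U V \<sigma>) y = ?\<Psi> U \<sigma> y" if "Y.cl y \<in> V" for y
    using that V(2) by (auto simp: res section_value_def)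
qed

text \<open>A local section of \<open>F\<close> near the image point, paired with the zero function,
  supplies the local sections of the pullback.\<close>

theorem pullback_line_bundle: "tropical_line_bundle Y P"
proof (rule Y.trivialization_line_bundle[OF pullback_trivialization])
  fix y
  obtain V s where V: "X.opn V" "X.cl (j y) \<in> V" "s \<in> sections F V" by (rule X.local_section)
  define W where "W = {p \<in> torus_points Y. \<iota> p \<in> V}"
  have "Y.cl -` W = j -` (X.cl -` V)" by (auto simp: W_def lift torus_points_def)
  moreover have "open (j -` (X.cl -` V))"
    by (intro open_vimage X.open_vimage_torus_class[OF V(1)] continuous_intros)
  ultimately have W: "Y.opn W" by (auto simp: openin_torus_topology W_def)
  have "(V, s, W, \<lambda>p\<in>W. 0) \<in> pairs" using V W Y.Aff_zero[OF W] by (auto simp: pb_pairs_def W_def)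
  then have "(\<lambda>p\<in>W. germ p (V, s, W, \<lambda>p\<in>W. 0)) \<in> sections P W"
    by (intro sectionI) (auto intro!: exI[of _ V] exI[of _ s] exI[of _ W])
  moreover have "Y.cl y \<in> W" using V(2) by (simp add: W_def lift torus_points_def)
  ultimately show "\<exists>W. Y.opn W \<and> Y.cl y \<in> W \<and> sections P W \<noteq> {}" using W by blast
qed

end

section \<open>The trivial bundle and the bundles \<open>\<L>(E, l)\<close>\<close>

context period_group
begin

lemma trivial_line_bundle_trivialization:
  "trivialization X (\<lambda>_ _. 0) (trivial_line_bundle X) (\<lambda>U f. \<lambda>x\<in>cl -` U. f (cl x))"
  (is "trivialization X _ ?F ?\<Phi>")
  unfolding trivialization_def
proof (intro allI impI conjI ballI)
  fix U assume U: "opn U"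
  have sec: "sections ?F = Aff X" by (simp add: trivial_line_bundle_def)
  show "bij_betw (?\<Phi> U) (sections ?F U) (cocycle_sections X (\<lambda>_ _. 0) U)"
    unfolding bij_betw_def sec
  proof (intro conjI inj_onI equalityI subsetI)
    fix f g assume fg: "f \<in> Aff X U" "g \<in> Aff X U" and eq: "?\<Phi> U f = ?\<Phi> U g"
    show "f = g"
    proof (rule Aff_eqI[OF fg U])
      fix x assume "cl x \<in> U"
      then show "f (cl x) = g (cl x)" using fun_cong[OF eq, of x] by simp
    qed
  next
    fix u assume "u \<in> ?\<Phi> U ` Aff X U"
    then obtain f where f: "f \<in> Aff X U" "u = ?\<Phi> U f" by blast
    show "u \<in> cocycle_sections X (\<lambda>_ _. 0) U"
      unfolding f(2) by (rule restrict_in_cocycle_sections[OF U]) (use f in \<open>auto intro: Aff_int_affine_at\<close>)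
  next
    fix u assume u: "u \<in> cocycle_sections X (\<lambda>_ _. 0) U"
    have "\<exists>f\<in>Aff X U. \<forall>x. cl x \<in> U \<longrightarrow> f (cl x) = u x"
      by (rule Aff_descend[OF U]) (use u in \<open>auto simp: cocycle_sections_def\<close>)
    then obtain f where f: "f \<in> Aff X U" "\<And>x. cl x \<in> U \<Longrightarrow> f (cl x) = u x" by blast
    have "u = ?\<Phi> U f"
      using u f(2) by (intro extensionalityI[of _ "cl -` U"]) (auto simp: cocycle_sections_def)
    with f(1) show "u \<in> ?\<Phi> U ` Aff X U" by blast
  qed
  fix s assume s: "s \<in> sections ?F U"
  show "act ?F U f s \<in> sections ?F U" if "f \<in> Aff X U" for f
    using Aff_add[OF U that] s by (simp add: trivial_line_bundle_def)
  show "?\<Phi> U (act ?F U f s) x = f (cl x) + ?\<Phi> U s x" if "cl x \<in> U" for f x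
    using that by (simp add: trivial_line_bundle_def)
  show "res ?F U V s \<in> sections ?F V" if "opn V" "V \<subseteq> U" for V
    using Aff_restrict[OF that] s by (simp add: trivial_line_bundle_def)
  show "?\<Phi> V (res ?F U V s) x = ?\<Phi> U s x" if "opn V" "V \<subseteq> U" "cl x \<in> V" for V x
    using that by (auto simp: trivial_line_bundle_def)
qed

text \<open>Discreteness of the periods provides local sections: a small ball around
  \<open>x\<close> embeds in the torus, and the zero function on it extends to all its translates by
  the cocycle rule.\<close>

lemma trivialization_nonempty:
  assumes triv: "trivialization X a F \<Phi>"
    and coc: "\<And>\<gamma> \<delta> x. \<gamma> \<in> period_lattice X \<Longrightarrow> \<delta> \<in> period_lattice X \<Longrightarrow> a (\<gamma> + \<delta>) x = a \<gamma> x + a \<delta> (x + \<gamma>)"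
    and aff: "\<And>\<gamma> x. \<gamma> \<in> period_lattice X \<Longrightarrow> int_affine_at X (a \<gamma>) x"
    and e: "e > 0" "\<And>\<gamma>. \<gamma> \<in> period_lattice X \<Longrightarrow> norm \<gamma> < e \<Longrightarrow> \<gamma> = 0"
  shows "\<exists>U. opn U \<and> cl x \<in> U \<and> sections F U \<noteq> {}"
proof -
  \<comment> \<open>Two points of a ball of radius \<open>e/2\<close> differ by less than
    \<open>e\<close>, so by no nonzero period.\<close>
  define B where "B = ball x (e/2)"
  define U where "U = cl ` B"
  have U: "opn U" unfolding U_def B_def by (intro openin_torus_class_image open_ball)
  have inj: "y = z" if "y \<in> B" "z \<in> B" "cl y = cl z" for y z
  proof -
    have "norm (z - y) \<le> dist x y + dist x z"
      using dist_triangle[of z y x] by (simp add: dist_norm norm_minus_commute)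
    also have "\<dots> < e" using that by (simp add: B_def)
    finally have "norm (z - y) < e" .
    moreover have "z - y \<in> period_lattice X" using that(3) by (simp add: torus_class_eq_iff)
    ultimately have "z - y = 0" by (intro e(2))
    then show ?thesis by simp
  qed
  define r where "r y = (THE z. z \<in> B \<and> cl z = cl y)" for y
  have r: "r (z + \<gamma>) = z" if "z \<in> B" "\<gamma> \<in> period_lattice X" for z \<gamma>
    unfolding r_def using that inj by (intro the_equality) auto
  \<comment> \<open>For \<open>y = z + \<gamma>\<close> with \<open>z\<close> in \<open>B\<close>
    this is \<open>a \<gamma> z\<close>, the extension of the zero function.\<close>
  define u where "u y = a (y - r y) (r y)" for y
  have u: "u (z + \<gamma>) = a \<gamma> z" if "z \<in> B" "\<gamma> \<in> period_lattice X" for z \<gamma>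
    unfolding u_def r[OF that] by simp
  have "\<exists>s\<in>sections F U. \<forall>x. cl x \<in> U \<longrightarrow> \<Phi> U s x = u x"
  proof (rule trivialization_section[OF triv U])
    fix y assume "cl y \<in> U"
    then obtain z where z: "z \<in> B" "cl z = cl y" by (auto simp: U_def)
    then obtain \<gamma> where \<gamma>: "\<gamma> \<in> period_lattice X" "y = z + \<gamma>" by (meson torus_class_eqE)
    have "\<forall>\<^sub>F w in nhds y. w \<in> (\<lambda>w. w - \<gamma>) -` B"
      using z \<gamma> by (intro eventually_nhds_in_open open_vimage) (auto simp: B_def intro!: continuous_intros)
    then have "\<forall>\<^sub>F w in nhds y. u w = a \<gamma> (blinfun_apply id_blinfun w + - \<gamma>)"
    proof eventually_elim
      case (elim w)
      then show ?case using u[of "w - \<gamma>" \<gamma>] \<gamma> by simp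
    qed
    moreover have "int_affine_at X (\<lambda>w. a \<gamma> (blinfun_apply id_blinfun w + - \<gamma>)) y"
      by (rule int_affine_at_compose[OF aff[OF \<gamma>(1)]]) simp
    ultimately show "int_affine_at X u y" by (rule int_affine_at_cong[rotated])
    fix \<delta> assume \<delta>: "\<delta> \<in> period_lattice X"
    show "u (y + \<delta>) = u y + a \<delta> y"
      using u[OF z(1) add_period[OF \<gamma>(1) \<delta>]] u[OF z(1) \<gamma>(1)] coc[OF \<gamma>(1) \<delta>] \<gamma>(2)
      by (simp add: add.assoc)
  qed
  moreover have "cl x \<in> U" using e(1) by (simp add: U_def B_def)
  ultimately show ?thesis using U by blast
qed

text \<open>The cross term in \<open>E (\<gamma> + \<delta>) (\<gamma> + \<delta>) / 2\<close> is
  \<open>E \<gamma> \<delta>\<close> by symmetry, and it accounts for the shift from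
  \<open>x\<close> to \<open>x + \<gamma>\<close> in the last summand.\<close>

lemma ah_factor_cocycle:
  assumes "\<And>x y. l (x + y) = l x + l y" and "\<And>x y z. E (x + y) z = E x z + E y z"
    and "\<And>x y z. E x (y + z) = E x y + E x z" and "\<And>x y. E x y = E y x"
  shows "ah_factor E l (\<gamma> + \<delta>) x = ah_factor E l \<gamma> x + ah_factor E l \<delta> (x + \<gamma>)"
  unfolding ah_factor_def assms(1-3) assms(4)[of \<delta> \<gamma>] by (simp add: field_simps)

text \<open>An orbit meets the fibre over a given point of the universal cover in exactly one value,
  since the factor at the period \<open>0\<close> vanishes. The cocycle identity makes the orbit
  independent of its representative.\<close>

lemma ah_bundle_trivialization:
  assumes coc: "\<And>\<gamma> \<delta> x. \<gamma> \<in> period_lattice X \<Longrightarrow> \<delta> \<in> period_lattice X \<Longrightarrow>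
    ah_factor E l (\<gamma> + \<delta>) x = ah_factor E l \<gamma> x + ah_factor E l \<delta> (x + \<gamma>)"
  shows "trivialization X (ah_factor E l) (ah_bundle X E l)
    (\<lambda>U \<sigma>. \<lambda>x\<in>cl -` U. THE b. (x, b) \<in> \<sigma> (cl x))"
proof -
  let ?a = "ah_factor E l" and ?F = "ah_bundle X E l"
  define val where "val \<sigma> x = (THE b. (x, b) \<in> \<sigma> (cl x))" for \<sigma> :: "'v set \<Rightarrow> ('v \<times> real) set" and x
  have a0: "?a 0 x = 0" for x using coc[OF zero_period zero_period, of x] by simp
  have orb: "(y, d) \<in> ah_orbit X E l x b \<longleftrightarrow> y - x \<in> period_lattice X \<and> d = b + ?a (y - x) x" for x y b d
    unfolding ah_orbit_def by (auto simp: image_iff) (metis add_diff_cancel_left' diff_add_cancel add.commute)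
  have shift: "ah_orbit X E l (x + \<gamma>) (b + ?a \<gamma> x) = ah_orbit X E l x b"
    if \<gamma>: "\<gamma> \<in> period_lattice X" for x b \<gamma>
  proof -
    have "(y, d) \<in> ah_orbit X E l (x + \<gamma>) (b + ?a \<gamma> x) \<longleftrightarrow> (y, d) \<in> ah_orbit X E l x b" for y d
    proof -
      have iff: "y - (x + \<gamma>) \<in> period_lattice X \<longleftrightarrow> y - x \<in> period_lattice X"
        using torus_class_eq_iff[of "x + \<gamma>" y] torus_class_eq_iff[of x y] \<gamma> by simp
      show ?thesis unfolding orb iff
        using coc[OF \<gamma>, of "y - (x + \<gamma>)" x] iff by (auto simp: algebra_simps)
    qed
    then show ?thesis by auto
  qed
  have val: "val \<sigma> x = b" if "\<sigma> (cl x) = ah_orbit X E l x b" for \<sigma> x b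
    unfolding val_def that using zero_period by (intro the_equality) (auto simp: orb a0)
  have secD: "\<sigma> \<in> extensional U" "\<And>x. cl x \<in> U \<Longrightarrow> \<exists>m \<in> dual_lattice (integral_lattice X). \<exists>c.
      \<forall>\<^sub>F y in nhds x. \<sigma> (cl y) = ah_orbit X E l y (blinfun_apply m y + c)"
    if "\<sigma> \<in> sections ?F U" for \<sigma> U
    using that by (auto simp: ah_bundle_def)
  have orbit_val: "\<sigma> (cl x) = ah_orbit X E l x (val \<sigma> x)" if \<sigma>: "\<sigma> \<in> sections ?F U" "cl x \<in> U" for \<sigma> U x
  proof -
    obtain m c where "\<forall>\<^sub>F y in nhds x. \<sigma> (cl y) = ah_orbit X E l y (blinfun_apply m y + c)"
      using secD(2)[OF \<sigma>] by blast
    from eventually_nhds_x_imp_x[OF this] show ?thesis using val by simp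
  qed
  have val_affine: "int_affine_at X (val \<sigma>) x" if \<sigma>: "\<sigma> \<in> sections ?F U" "cl x \<in> U" for \<sigma> U x
  proof -
    obtain m c where m: "m \<in> dual_lattice (integral_lattice X)"
      "\<forall>\<^sub>F y in nhds x. \<sigma> (cl y) = ah_orbit X E l y (blinfun_apply m y + c)"
      using secD(2)[OF \<sigma>] by blast
    from m(2) have "\<forall>\<^sub>F y in nhds x. val \<sigma> y = blinfun_apply m y + c"
      by eventually_elim (rule val)
    with m(1) show ?thesis unfolding int_affine_at_def by blast
  qed
  have secI: "\<sigma> \<in> sections ?F U" if ext: "\<sigma> \<in> extensional U" and U: "opn U"
    and eq: "\<And>x. cl x \<in> U \<Longrightarrow> \<sigma> (cl x) = ah_orbit X E l x (u x)"
    and aff: "\<And>x. cl x \<in> U \<Longrightarrow> int_affine_at X u x" for \<sigma> U u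
  proof -
    have "\<exists>m \<in> dual_lattice (integral_lattice X). \<exists>c.
      \<forall>\<^sub>F y in nhds x. \<sigma> (cl y) = ah_orbit X E l y (blinfun_apply m y + c)" if x: "cl x \<in> U" for x
    proof -
      obtain m c where m: "m \<in> dual_lattice (integral_lattice X)"
        "\<forall>\<^sub>F y in nhds x. u y = blinfun_apply m y + c"
        using aff[OF x] unfolding int_affine_at_def by blast
      have "\<forall>\<^sub>F y in nhds x. \<sigma> (cl y) = ah_orbit X E l y (blinfun_apply m y + c)"
        using m(2) eventually_torus_class[OF U x] by eventually_elim (simp add: eq)
      with m(1) show ?thesis by blast
    qed
    with ext show ?thesis by (simp add: ah_bundle_def)
  qed
  have act: "act ?F U f \<sigma> (cl x) = ah_orbit X E l x (f (cl x) + val \<sigma> x)"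
    if "\<sigma> \<in> sections ?F U" "cl x \<in> U" for U f \<sigma> x
  proof -
    have "act ?F U f \<sigma> (cl x) = (\<lambda>(y, b). (y, f (cl x) + b)) ` ah_orbit X E l x (val \<sigma> x)"
      using orbit_val[OF that] that by (simp add: ah_bundle_def)
    also have "\<dots> = ah_orbit X E l x (f (cl x) + val \<sigma> x)"
      unfolding ah_orbit_def image_image by (simp add: add.assoc)
    finally show ?thesis .
  qed
  have "trivialization X ?a ?F (\<lambda>U \<sigma>. restrict (val \<sigma>) (cl -` U))" (is "trivialization X _ _ ?\<Phi>")
    unfolding trivialization_def
  proof (intro allI impI conjI ballI)
    fix U assume U: "opn U"
    show "bij_betw (?\<Phi> U) (sections ?F U) (cocycle_sections X ?a U)"
      unfolding bij_betw_def
    proof (intro conjI inj_onI equalityI subsetI)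
      fix \<sigma> \<tau> assume \<sigma>: "\<sigma> \<in> sections ?F U" and \<tau>: "\<tau> \<in> sections ?F U" and eq: "?\<Phi> U \<sigma> = ?\<Phi> U \<tau>"
      show "\<sigma> = \<tau>"
      proof (rule extensionalityI[OF secD(1)[OF \<sigma>] secD(1)[OF \<tau>]])
        fix p assume p: "p \<in> U"
        then obtain x where x: "p = cl x" using openin_subset_points[OF U] by blast
        then have "val \<sigma> x = val \<tau> x" using fun_cong[OF eq, of x] p by simp
        then show "\<sigma> p = \<tau> p" using orbit_val[OF \<sigma>, of x] orbit_val[OF \<tau>, of x] p x by simp
      qed
    next
      fix u assume "u \<in> ?\<Phi> U ` sections ?F U"
      then obtain \<sigma> where \<sigma>: "\<sigma> \<in> sections ?F U" and u: "u = ?\<Phi> U \<sigma>" by blast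
      show "u \<in> cocycle_sections X ?a U" unfolding u
      proof (rule restrict_in_cocycle_sections[OF U val_affine[OF \<sigma>]])
        fix x \<gamma> assume x: "cl x \<in> U" and \<gamma>: "\<gamma> \<in> period_lattice X"
        show "val \<sigma> (x + \<gamma>) = val \<sigma> x + ?a \<gamma> x"
          using orbit_val[OF \<sigma> x] \<gamma> by (intro val) (simp add: shift)
      qed
    next
      fix u assume u: "u \<in> cocycle_sections X ?a U"
      define \<sigma> where "\<sigma> = (\<lambda>p\<in>U. ah_orbit X E l (SOME x. cl x = p) (u (SOME x. cl x = p)))"
      have \<sigma>: "\<sigma> (cl x) = ah_orbit X E l x (u x)" if x: "cl x \<in> U" for x
      proof -
        have "cl (SOME y. cl y = cl x) = cl x" by (rule someI) simp
        then obtain \<gamma> where \<gamma>: "\<gamma> \<in> period_lattice X" "(SOME y. cl y = cl x) = x + \<gamma>"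
          by (metis torus_class_eqE)
        have "u (x + \<gamma>) = u x + ?a \<gamma> x" using u x \<gamma>(1) by (simp add: cocycle_sections_def)
        then show ?thesis using x \<gamma> by (simp add: \<sigma>_def shift)
      qed
      have "\<sigma> \<in> sections ?F U"
      proof (rule secI[OF _ U \<sigma>])
        show "\<sigma> \<in> extensional U" unfolding \<sigma>_def by (rule restrict_extensional)
        show "int_affine_at X u x" if "cl x \<in> U" for x using u that by (simp add: cocycle_sections_def)
      qed
      moreover have "u = ?\<Phi> U \<sigma>"
        using u val[where \<sigma> = \<sigma>, OF \<sigma>] by (intro extensionalityI[of _ "cl -` U"]) (auto simp: cocycle_sections_def)
      ultimately show "u \<in> ?\<Phi> U ` sections ?F U" by blast
    qed
    fix \<sigma> assume \<sigma>: "\<sigma> \<in> sections ?F U"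
    show "act ?F U f \<sigma> \<in> sections ?F U" if f: "f \<in> Aff X U" for f
    proof (rule secI[OF _ U act[OF \<sigma>]])
      show "act ?F U f \<sigma> \<in> extensional U" by (simp add: ah_bundle_def)
      show "int_affine_at X (\<lambda>x. f (cl x) + val \<sigma> x) x" if "cl x \<in> U" for x
        by (rule int_affine_at_add[OF Aff_int_affine_at[OF f that] val_affine[OF \<sigma> that]])
    qed
    show "?\<Phi> U (act ?F U f \<sigma>) x = f (cl x) + ?\<Phi> U \<sigma> x" if "cl x \<in> U" for f x
      using val[where \<sigma> = "act ?F U f \<sigma>", OF act[OF \<sigma> that]] that by simp
    have res: "res ?F U V \<sigma> = restrict \<sigma> V" for V by (simp add: ah_bundle_def)
    show "res ?F U V \<sigma> \<in> sections ?F V" if V: "opn V" "V \<subseteq> U" for V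
    proof (rule secI[OF _ V(1)])
      show "res ?F U V \<sigma> \<in> extensional V" by (simp add: res)
      show "res ?F U V \<sigma> (cl x) = ah_orbit X E l x (val \<sigma> x)" if "cl x \<in> V" for x
        using orbit_val[OF \<sigma>, of x] that V by (auto simp: res)
      show "int_affine_at X (val \<sigma>) x" if "cl x \<in> V" for x
        using val_affine[OF \<sigma>] that V by blast
    qed
    show "?\<Phi> V (res ?F U V \<sigma>) x = ?\<Phi> U \<sigma> x" if "opn V" "V \<subseteq> U" "cl x \<in> V" for V x
      using that by (auto simp: res val_def)
  qed
  then show ?thesis by (simp add: val_def[abs_def])
qed

end

section \<open>Lattices\<close>

text \<open>Induction on the family: the new vector \<open>b0\<close> has positive distance
  \<open>\<delta>\<close> from the span of the others, because the bound for \<open>B\<close> makes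
  that span closed. The result yields discreteness of lattices in whatever norm the space
  carries.\<close>

lemma finite_independent_coeff_bound:
  fixes B :: "'v::real_normed_vector set"
  assumes "finite B" "independent B"
  shows "\<exists>C. \<forall>k. \<forall>b\<in>B. \<bar>k b\<bar> \<le> C * norm (\<Sum>b\<in>B. k b *\<^sub>R b)"
  using assms
proof (induction B rule: finite_induct)
  case empty
  then show ?case by simp
next
  case (insert b0 B)
  have indep: "independent B" using insert.prems independent_mono by blast
  obtain C where C: "\<And>k b. b \<in> B \<Longrightarrow> \<bar>k b\<bar> \<le> C * norm (\<Sum>b\<in>B. k b *\<^sub>R b)"
    using insert.IH[OF indep] by blast
  have "\<exists>\<delta>>0. \<forall>k. \<delta> \<le> norm (b0 + (\<Sum>b\<in>B. k b *\<^sub>R b))"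
  proof (rule ccontr)
    assume "\<not> ?thesis"
    then have "\<forall>n. \<exists>k. norm (b0 + (\<Sum>b\<in>B. k b *\<^sub>R b)) < 1 / real (Suc n)"
      by (metis not_le of_nat_0_less_iff zero_less_Suc zero_less_divide_1_iff)
    then obtain k where k: "\<And>n. norm (b0 + (\<Sum>b\<in>B. k n b *\<^sub>R b)) < 1 / real (Suc n)" by metis
    have lim: "(\<lambda>n. b0 + (\<Sum>b\<in>B. k n b *\<^sub>R b)) \<longlonglongrightarrow> 0"
      by (rule LIMSEQ_norm_0[OF k])
    \<comment> \<open>The bound for \<open>B\<close> makes the coefficients of a Cauchy sequence
      Cauchy; their limits would express \<open>b0\<close> through \<open>B\<close>.\<close>
    have "\<exists>l. (\<lambda>n. k n b) \<longlonglongrightarrow> l" if b: "b \<in> B" for b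
    proof -
      have "Cauchy (\<lambda>n. b0 + (\<Sum>b\<in>B. k n b *\<^sub>R b))" using lim by (rule LIMSEQ_imp_Cauchy)
      moreover have "norm (k m b - k n b) \<le> \<bar>C\<bar> * norm ((b0 + (\<Sum>b\<in>B. k m b *\<^sub>R b)) - (b0 + (\<Sum>b\<in>B. k n b *\<^sub>R b)))"
        for m n
      proof -
        have "norm (k m b - k n b) \<le> C * norm (\<Sum>b\<in>B. (k m b - k n b) *\<^sub>R b)"
          using C[OF b, of "\<lambda>b. k m b - k n b"] by simp
        also have "\<dots> \<le> \<bar>C\<bar> * norm (\<Sum>b\<in>B. (k m b - k n b) *\<^sub>R b)"
          by (intro mult_right_mono) auto
        finally show ?thesis by (simp add: scaleR_left_diff_distrib sum_subtractf)
      qed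
      ultimately have "Cauchy (\<lambda>n. k n b)"
        unfolding Cauchy_iff
      proof (intro allI impI)
        fix e :: real assume "e > 0"
          and c: "\<forall>e>0. \<exists>M. \<forall>m\<ge>M. \<forall>n\<ge>M. norm (b0 + (\<Sum>b\<in>B. k m b *\<^sub>R b) - (b0 + (\<Sum>b\<in>B. k n b *\<^sub>R b))) < e"
          and le: "\<And>m n. norm (k m b - k n b) \<le> \<bar>C\<bar> * norm (b0 + (\<Sum>b\<in>B. k m b *\<^sub>R b) - (b0 + (\<Sum>b\<in>B. k n b *\<^sub>R b)))"
        \<comment> \<open>\<open>\<bar>C\<bar> + 1\<close> is positive whatever the sign of
          \<open>C\<close>, which the induction leaves open.\<close>
        have "e / (\<bar>C\<bar> + 1) > 0" using \<open>e > 0\<close> by simp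
        with c obtain M where M: "\<And>m n. m \<ge> M \<Longrightarrow> n \<ge> M \<Longrightarrow>
            norm (b0 + (\<Sum>b\<in>B. k m b *\<^sub>R b) - (b0 + (\<Sum>b\<in>B. k n b *\<^sub>R b))) < e / (\<bar>C\<bar> + 1)" by blast
        have "norm (k m b - k n b) < e" if "m \<ge> M" "n \<ge> M" for m n
        proof -
          let ?d = "norm (b0 + (\<Sum>b\<in>B. k m b *\<^sub>R b) - (b0 + (\<Sum>b\<in>B. k n b *\<^sub>R b)))"
          have "norm (k m b - k n b) \<le> (\<bar>C\<bar> + 1) * ?d"
            using le[of m n] by (smt (verit) mult_right_mono norm_ge_zero)
          also have "\<dots> < e" using M[OF that] by (simp add: field_simps)
          finally show ?thesis .
        qed
        then show "\<exists>M. \<forall>m\<ge>M. \<forall>n\<ge>M. norm (k m b - k n b) < e" by blast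
      qed
      then show ?thesis using Cauchy_convergent convergent_def by blast
    qed
    then obtain l where "\<And>b. b \<in> B \<Longrightarrow> (\<lambda>n. k n b) \<longlonglongrightarrow> l b" by metis
    then have "(\<lambda>n. b0 + (\<Sum>b\<in>B. k n b *\<^sub>R b)) \<longlonglongrightarrow> b0 + (\<Sum>b\<in>B. l b *\<^sub>R b)"
      by (intro tendsto_intros)
    then have "b0 + (\<Sum>b\<in>B. l b *\<^sub>R b) = 0" using lim LIMSEQ_unique by blast
    then have "b0 = - (\<Sum>b\<in>B. l b *\<^sub>R b)" by (simp add: eq_neg_iff_add_eq_0)
    then have "b0 \<in> span B" by (auto intro!: span_neg span_sum span_scale intro: span_base)
    then show False using insert.prems insert.hyps by (simp add: independent_insert)
  qed
  then obtain \<delta> where \<delta>: "\<delta> > 0" "\<And>k. \<delta> \<le> norm (b0 + (\<Sum>b\<in>B. k b *\<^sub>R b))" by blast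
  \<comment> \<open>The first entry bounds the coefficient of \<open>b0\<close>; the second bounds
    the others, as \<open>S = T - k b0 *\<^sub>R b0\<close> has norm at most
    \<open>(1 + norm b0 / \<delta>) * norm T\<close>.\<close>
  define D where "D = max (1 / \<delta>) (\<bar>C\<bar> * (1 + norm b0 / \<delta>))"
  show ?case
  proof (intro exI[of _ D] allI ballI)
    fix k b assume b: "b \<in> insert b0 B"
    define S where "S = (\<Sum>b\<in>B. k b *\<^sub>R b)"
    define T where "T = (\<Sum>b\<in>insert b0 B. k b *\<^sub>R b)"
    have T: "T = k b0 *\<^sub>R b0 + S" using insert.hyps by (simp add: T_def S_def)
    have k0: "\<bar>k b0\<bar> \<le> norm T / \<delta>"
    proof (cases "k b0 = 0")
      case False
      have "T = k b0 *\<^sub>R (b0 + (\<Sum>b\<in>B. (k b / k b0) *\<^sub>R b))"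
        using False unfolding T S_def by (simp add: scaleR_add_right scaleR_sum_right)
      then have "norm T = \<bar>k b0\<bar> * norm (b0 + (\<Sum>b\<in>B. (k b / k b0) *\<^sub>R b))" by simp
      then have "\<bar>k b0\<bar> * \<delta> \<le> norm T" using mult_left_mono[OF \<delta>(2), of "\<bar>k b0\<bar>"] by simp
      then show ?thesis using \<delta>(1) by (simp add: field_simps)
    qed (use \<delta>(1) in simp)
    show "\<bar>k b\<bar> \<le> D * norm (\<Sum>b\<in>insert b0 B. k b *\<^sub>R b)"
    proof (cases "b = b0")
      case True
      have "norm T / \<delta> \<le> D * norm T"
        using mult_right_mono[of "1 / \<delta>" D "norm T"] by (simp add: D_def)
      with k0 have "\<bar>k b0\<bar> \<le> D * norm T" by (rule order_trans)
      with True show ?thesis unfolding T_def by simp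
    next
      case False
      then have "b \<in> B" using b by simp
      have "S = T - k b0 *\<^sub>R b0" by (simp add: T)
      then have "norm S \<le> norm T + \<bar>k b0\<bar> * norm b0" by (metis norm_triangle_ineq4 norm_scaleR)
      also have "\<dots> \<le> norm T + norm T / \<delta> * norm b0" using k0 by (intro add_left_mono mult_right_mono) auto
      finally have S: "norm S \<le> (1 + norm b0 / \<delta>) * norm T" by (simp add: field_simps)
      have "\<bar>k b\<bar> \<le> C * norm S" using C[OF \<open>b \<in> B\<close>] by (simp add: S_def)
      also have "\<dots> \<le> \<bar>C\<bar> * norm S" by (intro mult_right_mono) auto
      also have "\<dots> \<le> \<bar>C\<bar> * ((1 + norm b0 / \<delta>) * norm T)" using S by (intro mult_left_mono) auto
      also have "\<dots> \<le> D * norm T"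
        using mult_right_mono[of "\<bar>C\<bar> * (1 + norm b0 / \<delta>)" D "norm T"] by (simp add: D_def mult.assoc)
      finally show ?thesis unfolding T_def .
    qed
  qed
qed

lemma full_lattice_group:
  assumes "full_lattice L"
  shows "0 \<in> L" "x \<in> L \<Longrightarrow> y \<in> L \<Longrightarrow> x + y \<in> L" "x \<in> L \<Longrightarrow> - x \<in> L"
proof -
  obtain B where B: "finite B" "L = range (\<lambda>k :: 'a \<Rightarrow> int. \<Sum>b\<in>B. of_int (k b) *\<^sub>R b)"
    using assms unfolding full_lattice_def by blast
  have mem: "(\<Sum>b\<in>B. of_int (k b) *\<^sub>R b) \<in> L" for k :: "'a \<Rightarrow> int" using B(2) by blast
  show "0 \<in> L" using mem[of "\<lambda>_. 0"] by simp
  show "- x \<in> L" if x: "x \<in> L"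
  proof -
    obtain k :: "'a \<Rightarrow> int" where "x = (\<Sum>b\<in>B. of_int (k b) *\<^sub>R b)" using x B(2) by blast
    then show ?thesis using mem[of "\<lambda>b. - k b"] by (simp add: sum_negf)
  qed
  show "x + y \<in> L" if xy: "x \<in> L" "y \<in> L"
  proof -
    obtain k h :: "'a \<Rightarrow> int" where "x = (\<Sum>b\<in>B. of_int (k b) *\<^sub>R b)" "y = (\<Sum>b\<in>B. of_int (h b) *\<^sub>R b)"
      using xy B(2) by blast
    then show ?thesis using mem[of "\<lambda>b. k b + h b"] by (simp add: scaleR_add_left sum.distrib)
  qed
qed

lemma full_lattice_basis:
  fixes L :: "'v::real_normed_vector set"
  assumes "full_lattice L"
  obtains B where "finite B" "span B = UNIV" "B \<subseteq> L"
proof -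
  obtain B where B: "finite B" "span B = UNIV" "L = range (\<lambda>k :: 'v \<Rightarrow> int. \<Sum>b\<in>B. of_int (k b) *\<^sub>R b)"
    using assms(1) unfolding full_lattice_def by blast
  have "b \<in> L" if "b \<in> B" for b
  proof -
    have "(\<Sum>c\<in>B. of_int (if c = b then 1 else 0) *\<^sub>R c) = (\<Sum>c\<in>B. if c = b then c else 0)"
      by (intro sum.cong) auto
    also have "\<dots> = b" using that B(1) by simp
    finally show ?thesis unfolding B(3) by (intro range_eqI[of _ _ "\<lambda>c. if c = b then 1 else 0"]) simp
  qed
  with B that show thesis by blast
qed

text \<open>The lattice contains a spanning set. This is the device for passing identities between
  \<open>N\<close> and \<open>\<Lambda>\<close>.\<close>

lemma full_lattice_spans:
  fixes L :: "'v::real_normed_vector set"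
  assumes "full_lattice L" and "linear f" "linear g" "\<And>x. x \<in> L \<Longrightarrow> f x = g x"
  shows "f x = g x"
proof -
  obtain B where "finite B" "span B = UNIV" "B \<subseteq> L"
    using assms(1) by (rule full_lattice_basis)
  then show ?thesis
    using linear_eq_on_span[OF assms(2,3), of B x] assms(4) by blast
qed

text \<open>A lattice vector of small norm has integer coefficients of absolute value below
  \<open>1\<close>, by the coefficient bound.\<close>

lemma full_lattice_discrete:
  fixes L :: "'v::real_normed_vector set"
  assumes "full_lattice L"
  shows "\<exists>e>0. \<forall>x\<in>L. norm x < e \<longrightarrow> x = 0"
proof -
  obtain B where B: "finite B" "independent B" "L = range (\<lambda>k :: 'v \<Rightarrow> int. \<Sum>b\<in>B. of_int (k b) *\<^sub>R b)"
    using assms unfolding full_lattice_def by blast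
  obtain C where C: "\<And>k b. b \<in> B \<Longrightarrow> \<bar>k b\<bar> \<le> C * norm (\<Sum>b\<in>B. k b *\<^sub>R b)"
    using finite_independent_coeff_bound[OF B(1,2)] by blast
  have "x = 0" if x: "x \<in> L" "norm x < 1 / (\<bar>C\<bar> + 1)" for x
  proof -
    obtain k :: "'v \<Rightarrow> int" where k: "x = (\<Sum>b\<in>B. of_int (k b) *\<^sub>R b)" using x(1) B(3) by blast
    have "k b = 0" if b: "b \<in> B" for b
    proof -
      have "\<bar>real_of_int (k b)\<bar> \<le> C * norm x" using C[OF b, of "\<lambda>b. real_of_int (k b)"] k by simp
      also have "\<dots> \<le> (\<bar>C\<bar> + 1) * norm x" by (intro mult_right_mono) auto
      also have "\<dots> < 1" using x(2) by (simp add: field_simps)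
      finally show ?thesis by linarith
    qed
    then show ?thesis using k by simp
  qed
  then show ?thesis by (intro exI[of _ "1 / (\<bar>C\<bar> + 1)"]) auto
qed

text \<open>Argues with values on a finite spanning subset of \<open>L\<close> instead of a dual
  basis: a functional of small norm takes integer values of absolute value below \<open>1\<close>
  there.\<close>

lemma dual_lattice_discrete:
  fixes L :: "'v::real_normed_vector set"
  assumes "full_lattice L"
  shows "\<exists>e>0. \<forall>m\<in>dual_lattice L. norm m < e \<longrightarrow> m = 0"
proof -
  obtain B where B: "finite B" "span B = UNIV" "B \<subseteq> L"
    using assms by (rule full_lattice_basis)
  \<comment> \<open>The leading \<open>1\<close> keeps \<open>M\<close> positive when
    \<open>B\<close> is empty and makes the bound on its vectors strict.\<close>
  define M where "M = 1 + (\<Sum>b\<in>B. norm b)"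
  have M: "M > 0" "\<And>b. b \<in> B \<Longrightarrow> norm b < M"
  proof -
    show "M > 0" unfolding M_def by (smt (verit) sum_nonneg norm_ge_zero)
    show "norm b < M" if "b \<in> B" for b
      using member_le_sum[OF that, of norm] B(1) by (simp add: M_def)
  qed
  have "m = 0" if m: "m \<in> dual_lattice L" "norm m < 1 / M" for m
  proof -
    have "blinfun_apply m b = 0" if b: "b \<in> B" for b
    proof -
      have "\<bar>blinfun_apply m b\<bar> \<le> norm m * norm b" using norm_blinfun[of m b] by simp
      also have "\<dots> \<le> norm m * M" using M(2)[OF b] by (intro mult_left_mono) auto
      also have "\<dots> < 1" using m(2) M(1) by (simp add: field_simps)
      finally have "\<bar>blinfun_apply m b\<bar> < 1" .
      moreover have "blinfun_apply m b \<in> \<int>" using m(1) b B(3) by (auto simp: dual_lattice_def)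
      ultimately show ?thesis using Ints_nonzero_abs_less1 by blast
    qed
    then have "blinfun_apply m x = 0" for x
      using linear_eq_on_span[OF bounded_linear.linear[OF blinfun.bounded_linear_right[of m]] module_hom_zero, of B x] B(2)
      by auto
    then show ?thesis by (intro blinfun_eqI) simp
  qed
  then show ?thesis using M(1) by (intro exI[of _ "1 / M"]) auto
qed

section \<open>The Poincare bundle\<close>

definition poincare_form :: "'v \<times> ('v::real_normed_vector \<Rightarrow>\<^sub>L real) \<Rightarrow> 'v \<times> ('v \<Rightarrow>\<^sub>L real) \<Rightarrow> real" where
  "poincare_form p q = - (blinfun_apply (snd p) (fst q) + blinfun_apply (snd q) (fst p))"

text \<open>Both conditions can be read off: for \<open>n = 0\<close> the factor is
  \<open>w \<gamma>\<close>, that of the bundle given by \<open>w\<close>, and for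
  \<open>\<gamma> = 0\<close> and \<open>v = 0\<close> it vanishes. The last summand comes from the
  quadratic term.\<close>

lemma ah_factor_poincare_form:
  "ah_factor poincare_form (\<lambda>_. 0) (\<gamma>, n) (v, w)
    = blinfun_apply w \<gamma> + blinfun_apply n v + blinfun_apply n \<gamma>"
  by (simp add: ah_factor_def poincare_form_def)

text \<open>If \<open>r\<close> were nonzero, the multiple with \<open>t = 1 / (2 * r)\<close> would
  be \<open>1/2\<close>.\<close>

lemma real_multiples_Ints_imp_zero:
  fixes r :: real
  assumes "\<And>t. t * r \<in> \<int>"
  shows "r = 0"
proof (rule ccontr)
  assume "r \<noteq> 0"
  then have "(1 / 2 :: real) \<in> \<int>" using assms[of "1 / (2 * r)"] by simp
  then obtain k where "(1 / 2 :: real) = of_int k" by (rule Ints_cases)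
  then have "(1::int) = 2 * k" by linarith
  then show False by presburger
qed

section \<open>The product with the dual torus and its slices\<close>

locale poincare_setup =
  fixes X :: "'v::real_normed_vector torus"
  assumes torus: "real_torus X"
begin

abbreviation "\<Lambda> \<equiv> period_lattice X"
abbreviation "N \<equiv> integral_lattice X"
abbreviation "Xd \<equiv> dual_torus X"
abbreviation "T \<equiv> prod_torus X (dual_torus X)"

lemma full_lattices: "full_lattice N" "full_lattice \<Lambda>"
  using torus by (auto simp: real_torus_def)

lemma lattices [simp]:
  "period_lattice Xd = dual_lattice N" "integral_lattice Xd = dual_lattice \<Lambda>"
  "period_lattice T = \<Lambda> \<times> dual_lattice N" "integral_lattice T = N \<times> dual_lattice \<Lambda>"
  by (simp_all add: dual_torus_def prod_torus_def)

sublocale X: period_group X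
  using full_lattice_group[OF full_lattices(2)] by unfold_locales

sublocale Xd: period_group Xd
  by unfold_locales (auto intro: add_in_dual_lattice uminus_in_dual_lattice)

sublocale T: period_group T
  by unfold_locales (auto simp: zero_prod_def X.zero_period X.add_period X.uminus_period
      intro: add_in_dual_lattice uminus_in_dual_lattice)

lemma torus_class_T: "torus_class T (x, y) = torus_class X x \<times> torus_class Xd y"
  by (auto simp: torus_class_def image_iff)

lemma period_discrete: "\<exists>e>0. \<forall>\<gamma>\<in>period_lattice T. norm \<gamma> < e \<longrightarrow> \<gamma> = 0"
proof -
  obtain d where d: "d > 0" "\<And>x. x \<in> \<Lambda> \<Longrightarrow> norm x < d \<Longrightarrow> x = 0"
    using full_lattice_discrete[OF full_lattices(2)] by blast
  obtain e where e: "e > 0" "\<And>n. n \<in> dual_lattice N \<Longrightarrow> norm n < e \<Longrightarrow> n = 0"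
    using dual_lattice_discrete[OF full_lattices(1)] by blast
  have "\<gamma> = 0" if "\<gamma> \<in> period_lattice T" "norm \<gamma> < min d e" for \<gamma>
  proof -
    have "fst \<gamma> = 0" using d(2)[of "fst \<gamma>"] norm_fst_le[of "fst \<gamma>" "snd \<gamma>"] that by auto
    moreover have "snd \<gamma> = 0" using e(2)[of "snd \<gamma>"] norm_snd_le[of "snd \<gamma>" "fst \<gamma>"] that by auto
    ultimately show ?thesis by (simp add: prod_eq_iff)
  qed
  then show ?thesis using d(1) e(1) by (intro exI[of _ "min d e"]) auto
qed

text \<open>The slice at \<open>l\<close> is covered by the map from \<open>v\<close> to
  \<open>(v, l)\<close>, with translation part \<open>(0, l)\<close>, so a period
  \<open>\<gamma>\<close> of \<open>X\<close> acts through \<open>(\<gamma>, 0)\<close>.\<close>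

lemma restriction_fst:
  assumes Q: "tropical_line_bundle T Q" and triv: "trivialization T a Q \<Phi>"
  shows "\<exists>\<Psi>. trivialization X (\<lambda>\<gamma> v. a (\<gamma>, 0) (v, l)) (pullback T X (\<lambda>p. p \<times> torus_class Xd l) Q) \<Psi>"
    and "tropical_line_bundle X (pullback T X (\<lambda>p. p \<times> torus_class Xd l) Q)"
proof -
  have A: "blinfun_apply (Blinfun (\<lambda>v. (v, 0 :: 'v \<Rightarrow>\<^sub>L real))) v = (v, 0)" for v :: 'v
    by (intro bounded_linear_Blinfun_apply[THEN fun_cong] bounded_linear_Pair bounded_linear_ident bounded_linear_zero)
  interpret pullback_map X T Q "\<lambda>p. p \<times> torus_class Xd l" "Blinfun (\<lambda>v. (v, 0))" "(0, l)" a \<Phi>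
    by unfold_locales (auto simp: A Q triv torus_class_T)
  show "\<exists>\<Psi>. trivialization X (\<lambda>\<gamma> v. a (\<gamma>, 0) (v, l)) (pullback T X (\<lambda>p. p \<times> torus_class Xd l) Q) \<Psi>"
    using pullback_trivialization by (auto simp: A)
  show "tropical_line_bundle X (pullback T X (\<lambda>p. p \<times> torus_class Xd l) Q)"
    by (rule pullback_line_bundle)
qed

lemma restriction_snd:
  assumes Q: "tropical_line_bundle T Q" and triv: "trivialization T a Q \<Phi>"
  shows "\<exists>\<Psi>. trivialization Xd (\<lambda>n w. a (0, n) (0, w)) (pullback T Xd (\<lambda>q. torus_class X 0 \<times> q) Q) \<Psi>"
    and "tropical_line_bundle Xd (pullback T Xd (\<lambda>q. torus_class X 0 \<times> q) Q)"
proof -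
  have A: "blinfun_apply (Blinfun (\<lambda>w. (0 :: 'v, w))) w = (0, w)" for w :: "'v \<Rightarrow>\<^sub>L real"
    by (intro bounded_linear_Blinfun_apply[THEN fun_cong] bounded_linear_Pair bounded_linear_ident bounded_linear_zero)
  interpret pullback_map Xd T Q "\<lambda>q. torus_class X 0 \<times> q" "Blinfun (\<lambda>w. (0, w))" "(0, 0)" a \<Phi>
    by unfold_locales
      (auto simp: A Q triv torus_class_T X.zero_period full_lattice_group(1)[OF full_lattices(1)])
  show "\<exists>\<Psi>. trivialization Xd (\<lambda>n w. a (0, n) (0, w)) (pullback T Xd (\<lambda>q. torus_class X 0 \<times> q) Q) \<Psi>"
    using pullback_trivialization by (auto simp: A)
  show "tropical_line_bundle Xd (pullback T Xd (\<lambda>q. torus_class X 0 \<times> q) Q)"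
    by (rule pullback_line_bundle)
qed

section \<open>Existence and uniqueness of the Poincare bundle\<close>

abbreviation "P \<equiv> ah_bundle T poincare_form (\<lambda>_. 0)"
abbreviation "aP \<equiv> ah_factor (poincare_form :: 'v \<times> ('v \<Rightarrow>\<^sub>L real) \<Rightarrow> _) (\<lambda>_. 0)"

lemma aP_cocycle: "aP (\<gamma> + \<delta>) x = aP \<gamma> x + aP \<delta> (x + \<gamma>)"
  by (rule T.ah_factor_cocycle)
    (simp_all add: poincare_form_def blinfun.add_left blinfun.add_right)

lemma P_trivialization: "\<exists>\<Phi>. trivialization T aP P \<Phi>"
  using T.ah_bundle_trivialization[of poincare_form "\<lambda>_. 0", OF aP_cocycle] by blast

lemma ah_zero_trivialization:
  "\<exists>\<Phi>. trivialization X (\<lambda>\<gamma> _. blinfun_apply l \<gamma>) (ah_bundle X (\<lambda>_ _. 0) (blinfun_apply l)) \<Phi>"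
proof -
  have eq: "ah_factor (\<lambda>_ _. 0) (blinfun_apply l) = (\<lambda>\<gamma> _. blinfun_apply l \<gamma>)"
    by (simp add: ah_factor_def fun_eq_iff)
  show ?thesis
    using X.ah_bundle_trivialization[of "\<lambda>_ _. 0" "blinfun_apply l"] unfolding eq
    by (auto simp: blinfun.add_right)
qed

lemma P_line_bundle: "tropical_line_bundle T P"
proof -
  obtain \<Phi> where triv: "trivialization T aP P \<Phi>" using P_trivialization by blast
  obtain e where e: "e > 0" "\<And>\<gamma>. \<gamma> \<in> period_lattice T \<Longrightarrow> norm \<gamma> < e \<Longrightarrow> \<gamma> = 0"
    using period_discrete by blast
  have aff: "int_affine_at T (aP \<gamma>) x" if "\<gamma> \<in> period_lattice T" for \<gamma> x
  proof -
    \<comment> \<open>The slope of the factor at \<open>\<gamma>\<close>. On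
      \<open>N \<times> dual_lattice \<Lambda>\<close> each summand pairs a lattice vector with an
      element of the dual of its lattice, so it is integral.\<close>
    define m where "m = Blinfun (\<lambda>p. blinfun_apply (snd p) (fst \<gamma>) + blinfun_apply (snd \<gamma>) (fst p))"
    have "bounded_linear (\<lambda>p. blinfun_apply (snd p) (fst \<gamma>) + blinfun_apply (snd \<gamma>) (fst p))"
      by (intro bounded_linear_intros bounded_linear_add bounded_linear_snd bounded_linear_fst
          bounded_linear_compose[OF blinfun.bounded_linear_left] bounded_linear_compose[OF blinfun.bounded_linear_right])
    then have m: "blinfun_apply m p = blinfun_apply (snd p) (fst \<gamma>) + blinfun_apply (snd \<gamma>) (fst p)" for p
      unfolding m_def by (simp add: bounded_linear_Blinfun_apply)
    have "m \<in> dual_lattice (integral_lattice T)"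
      using that by (auto simp: dual_lattice_def m)
    from int_affine_at_affine[OF this, of "blinfun_apply (snd \<gamma>) (fst \<gamma>)" x]
    show ?thesis
      by (rule int_affine_at_cong) (simp add: m ah_factor_def poincare_form_def)
  qed
  show ?thesis
    by (rule T.trivialization_line_bundle[OF triv T.trivialization_nonempty[OF triv aP_cocycle aff e]])
qed

lemma poincare_P: "poincare_bundle X P"
  unfolding poincare_bundle_def
proof (intro conjI ballI P_line_bundle)
  obtain \<Phi> where triv: "trivialization T aP P \<Phi>" using P_trivialization by blast
  fix L l assume L: "L \<in> torus_points Xd" and l: "l \<in> L"
  obtain l' where l': "L = torus_class Xd l'" using L by (auto simp: torus_points_def)
  \<comment> \<open>The slice is lifted at the very \<open>l\<close> chosen in \<open>L\<close>; its
    cocycle is then literally that of the bundle given by \<open>l\<close>, with no correction by an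
    integral functional.\<close>
  have "torus_class Xd l' = torus_class Xd l"
    using l unfolding l' Xd.torus_class_eq_iff by (auto simp: torus_class_def)
  then have L: "L = torus_class Xd l" using l' by simp
  obtain \<Psi> where "trivialization X (\<lambda>\<gamma> v. aP (\<gamma>, 0) (v, l)) (pullback T X (\<lambda>p. p \<times> L) P) \<Psi>"
    using restriction_fst(1)[OF P_line_bundle triv] L by blast
  then have "trivialization X (\<lambda>\<gamma> _. blinfun_apply l \<gamma>) (pullback T X (\<lambda>p. p \<times> L) P) \<Psi>"
    by (simp add: ah_factor_poincare_form)
  then show "line_bundle_iso X (pullback T X (\<lambda>p. p \<times> L) P) (ah_bundle X (\<lambda>_ _. 0) (blinfun_apply l))"
    using ah_zero_trivialization X.trivialization_iso by blast
next
  obtain \<Phi> where triv: "trivialization T aP P \<Phi>" using P_trivialization by blast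
  obtain \<Psi> where "trivialization Xd (\<lambda>n w. aP (0, n) (0, w)) (pullback T Xd (\<lambda>q. torus_class X 0 \<times> q) P) \<Psi>"
    using restriction_snd(1)[OF P_line_bundle triv] by blast
  then have "trivialization Xd (\<lambda>_ _. 0) (pullback T Xd (\<lambda>q. torus_class X 0 \<times> q) P) \<Psi>"
    by (simp add: ah_factor_poincare_form blinfun.zero_right)
  then show "line_bundle_iso Xd (pullback T Xd (\<lambda>q. torus_class X 0 \<times> q) P) (trivial_line_bundle Xd)"
    using Xd.trivial_line_bundle_trivialization Xd.trivialization_iso by blast
qed

text \<open>A cocycle of \<open>Q\<close> is computed at the periods \<open>(\<gamma>, 0)\<close>
  and \<open>(0, n)\<close>, which generate all periods: the linear parts are \<open>m1\<close> to
  \<open>m4\<close>, the constants \<open>c1\<close> and \<open>c2\<close>. They agree with those of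
  \<open>P\<close> up to the coboundary of one integral functional.\<close>

lemma poincare_unique:
  assumes Q: "poincare_bundle X Q"
  shows "line_bundle_iso T Q P"
proof -
  have QT: "tropical_line_bundle T Q"
    and Q1: "\<And>l. line_bundle_iso X (pullback T X (\<lambda>p. p \<times> torus_class Xd l) Q)
      (ah_bundle X (\<lambda>_ _. 0) (blinfun_apply l))"
    and Q2: "line_bundle_iso Xd (pullback T Xd (\<lambda>q. torus_class X 0 \<times> q) Q) (trivial_line_bundle Xd)"
  proof -
    have self: "l \<in> torus_class Xd l" for l by (simp add: torus_class_def image_iff)
    show "tropical_line_bundle T Q"
      "line_bundle_iso X (pullback T X (\<lambda>p. p \<times> torus_class Xd l) Q)
        (ah_bundle X (\<lambda>_ _. 0) (blinfun_apply l))"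
      "line_bundle_iso Xd (pullback T Xd (\<lambda>q. torus_class X 0 \<times> q) Q) (trivial_line_bundle Xd)" for l
      using Q self[of l] unfolding poincare_bundle_def torus_points_def by auto
  qed
  interpret Q: line_bundle T Q by unfold_locales (rule QT)
  obtain m c \<Phi> where m: "\<And>\<gamma>. \<gamma> \<in> period_lattice T \<Longrightarrow> m \<gamma> \<in> dual_lattice (integral_lattice T)"
    and triv: "trivialization T (\<lambda>\<gamma> x. blinfun_apply (m \<gamma>) x + c \<gamma>) Q \<Phi>"
    using Q.ex_trivialization by blast
  let ?a = "\<lambda>\<gamma> x. blinfun_apply (m \<gamma>) x + c \<gamma>"
  \<comment> \<open>The same slice is trivialized with the restricted cocycle and, through the
    isomorphism, with the cocycle \<open>l\<close>; the two differ by an integral functional that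
    depends on \<open>l\<close>.\<close>
  have fst_slice: "\<exists>\<mu>\<in>dual_lattice N. \<forall>\<gamma>\<in>\<Lambda>. \<forall>v.
      blinfun_apply l \<gamma> = ?a (\<gamma>, 0) (v, l) + blinfun_apply \<mu> \<gamma>" for l
  proof -
    interpret S: line_bundle X "pullback T X (\<lambda>p. p \<times> torus_class Xd l) Q"
      by unfold_locales (rule restriction_fst(2)[OF QT triv])
    obtain \<Psi> where \<Psi>: "trivialization X (\<lambda>\<gamma> v. ?a (\<gamma>, 0) (v, l)) (pullback T X (\<lambda>p. p \<times> torus_class Xd l) Q) \<Psi>"
      using restriction_fst(1)[OF QT triv] by blast
    obtain \<Theta> where \<Theta>: "trivialization X (\<lambda>\<gamma> _. blinfun_apply l \<gamma>) (ah_bundle X (\<lambda>_ _. 0) (blinfun_apply l)) \<Theta>"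
      using ah_zero_trivialization by blast
    obtain \<Xi> where \<Xi>: "trivialization X (\<lambda>\<gamma> _. blinfun_apply l \<gamma>) (pullback T X (\<lambda>p. p \<times> torus_class Xd l) Q) \<Xi>"
      using S.trivialization_iso_transfer[OF Q1 \<Theta>] by blast
    show ?thesis by (rule S.trivialization_difference[OF \<Psi> \<Xi>]) blast
  qed
  then obtain \<mu> where \<mu>: "\<And>l. \<mu> l \<in> dual_lattice N" and
    \<mu>_eq: "\<And>l \<gamma> v. \<gamma> \<in> \<Lambda> \<Longrightarrow> blinfun_apply l \<gamma> = ?a (\<gamma>, 0) (v, l) + blinfun_apply (\<mu> l) \<gamma>"
    by metis
  have "\<exists>\<kappa>\<in>dual_lattice (dual_lattice \<Lambda>). \<forall>n\<in>dual_lattice N. \<forall>w. 0 = ?a (0, n) (0, w) + blinfun_apply \<kappa> n"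
  proof -
    interpret S: line_bundle Xd "pullback T Xd (\<lambda>q. torus_class X 0 \<times> q) Q"
      by unfold_locales (rule restriction_snd(2)[OF QT triv])
    obtain \<Psi> where \<Psi>: "trivialization Xd (\<lambda>n w. ?a (0, n) (0, w)) (pullback T Xd (\<lambda>q. torus_class X 0 \<times> q) Q) \<Psi>"
      using restriction_snd(1)[OF QT triv] by blast
    obtain \<Xi> where \<Xi>: "trivialization Xd (\<lambda>_ _. 0) (pullback T Xd (\<lambda>q. torus_class X 0 \<times> q) Q) \<Xi>"
      using S.trivialization_iso_transfer[OF Q2 Xd.trivial_line_bundle_trivialization] by blast
    show ?thesis by (rule S.trivialization_difference[OF \<Psi> \<Xi>]) auto
  qed
  then obtain \<kappa> where \<kappa>: "\<kappa> \<in> dual_lattice (dual_lattice \<Lambda>)" and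
    \<kappa>_eq: "\<And>n w. n \<in> dual_lattice N \<Longrightarrow> 0 = ?a (0, n) (0, w) + blinfun_apply \<kappa> n" by blast
  have split: "blinfun_apply (m \<gamma>) (v, w) = blinfun_apply (m \<gamma>) (v, 0) + blinfun_apply (m \<gamma>) (0, w)" for \<gamma> v w
    using blinfun.add_right[of "m \<gamma>" "(v, 0)" "(0, w)"] by simp
  \<comment> \<open>At \<open>l = 0\<close> the equation holds for every \<open>v\<close>, and the
    linear part is its only term that involves \<open>v\<close>.\<close>
  have m1: "blinfun_apply (m (\<gamma>, 0)) (v, 0) = 0" if "\<gamma> \<in> \<Lambda>" for \<gamma> v
    using \<mu>_eq[OF that, of 0 v] \<mu>_eq[OF that, of 0 0] blinfun.zero_right[of "m (\<gamma>, 0)"]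
    by (simp add: zero_prod_def)
  have m4: "blinfun_apply (m (0, n)) (0, w) = 0" if "n \<in> dual_lattice N" for n w
    using \<kappa>_eq[OF that, of w] \<kappa>_eq[OF that, of 0] blinfun.zero_right[of "m (0, n)"]
    by (simp add: zero_prod_def)
  have c1: "c (\<gamma>, 0) = - blinfun_apply (\<mu> 0) \<gamma>" if "\<gamma> \<in> \<Lambda>" for \<gamma>
    using \<mu>_eq[OF that, of 0 0] m1[OF that, of 0] by simp
  have c2: "c (0, n) = - blinfun_apply \<kappa> n" if "n \<in> dual_lattice N" for n
    using \<kappa>_eq[OF that, of 0] m4[OF that, of 0] by simp
  \<comment> \<open>Subtracting the value at \<open>l = 0\<close> removes the constant
    \<open>c (\<gamma>, 0)\<close>, so that \<open>\<nu>\<close> becomes homogeneous in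
    \<open>l\<close>.\<close>
  define \<nu> where "\<nu> l = \<mu> l - \<mu> 0" for l
  have \<nu>_eq: "blinfun_apply (m (\<gamma>, 0)) (0, l) = blinfun_apply l \<gamma> - blinfun_apply (\<nu> l) \<gamma>" if "\<gamma> \<in> \<Lambda>" for \<gamma> l
    using \<mu>_eq[OF that, of l 0] c1[OF that] by (simp add: \<nu>_def blinfun.diff_left)
  \<comment> \<open>Homogeneity is visible only on \<open>\<Lambda>\<close>; since
    \<open>\<Lambda>\<close> spans, it extends to all \<open>x\<close>, in particular to
    \<open>N\<close>.\<close>
  have \<nu>_scale: "blinfun_apply (\<nu> (t *\<^sub>R l)) x = t * blinfun_apply (\<nu> l) x" for t l x
  proof (rule full_lattice_spans[OF full_lattices(2)])
    show "linear (blinfun_apply (\<nu> (t *\<^sub>R l)))"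
      by (rule bounded_linear.linear[OF blinfun.bounded_linear_right])
    show "linear (\<lambda>x. t * blinfun_apply (\<nu> l) x)"
      by (intro bounded_linear.linear bounded_linear_intros bounded_linear_const_mult blinfun.bounded_linear_right)
    fix \<gamma> assume \<gamma>: "\<gamma> \<in> \<Lambda>"
    have "blinfun_apply (m (\<gamma>, 0)) (0, t *\<^sub>R l) = t * blinfun_apply (m (\<gamma>, 0)) (0, l)"
      using blinfun.scaleR_right[of "m (\<gamma>, 0)" t "(0, l)"] by simp
    then show "blinfun_apply (\<nu> (t *\<^sub>R l)) \<gamma> = t * blinfun_apply (\<nu> l) \<gamma>"
      using \<nu>_eq[OF \<gamma>, of l] \<nu>_eq[OF \<gamma>, of "t *\<^sub>R l"] by (simp add: blinfun.scaleR_left algebra_simps)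
  qed
  have \<nu>_zero: "blinfun_apply (\<nu> l) x = 0" for l x
  proof (rule full_lattice_spans[OF full_lattices(1), of "blinfun_apply (\<nu> l)" "\<lambda>_. 0"])
    show "linear (blinfun_apply (\<nu> l))"
      by (rule bounded_linear.linear[OF blinfun.bounded_linear_right])
    show "linear (\<lambda>_::'v. 0::real)" by (rule module_hom_zero)
    fix n assume n: "n \<in> N"
    have "\<nu> k \<in> dual_lattice N" for k
      using add_in_dual_lattice[OF \<mu> uminus_in_dual_lattice[OF \<mu>]] by (simp add: \<nu>_def)
    \<comment> \<open>Every real multiple of the value at \<open>n\<close> is again the value of
      some \<open>\<nu> k\<close> at \<open>n\<close>, hence an integer.\<close>
    then have "t * blinfun_apply (\<nu> l) n \<in> \<int>" for t
      using n unfolding \<nu>_scale[of t l n, symmetric] by (simp add: dual_lattice_def)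
    then show "blinfun_apply (\<nu> l) n = 0" by (rule real_multiples_Ints_imp_zero)
  qed
  have m2: "blinfun_apply (m (\<gamma>, 0)) (0, w) = blinfun_apply w \<gamma>" if "\<gamma> \<in> \<Lambda>" for \<gamma> w
    using \<nu>_eq[OF that] \<nu>_zero by simp
  \<comment> \<open>The period \<open>(\<gamma>, n)\<close> is reached through its two components in
    either order.\<close>
  have coc: "?a (\<gamma>, n) x = ?a (\<gamma>, 0) x + ?a (0, n) (x + (\<gamma>, 0))"
      "?a (\<gamma>, n) x = ?a (0, n) x + ?a (\<gamma>, 0) (x + (0, n))"
    if "\<gamma> \<in> \<Lambda>" "n \<in> dual_lattice N" for \<gamma> n x
    using Q.trivialization_cocycle_identity[OF triv, of "(\<gamma>, 0)" "(0, n)" x]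
      Q.trivialization_cocycle_identity[OF triv, of "(0, n)" "(\<gamma>, 0)" x] that X.zero_period by simp_all
  have m3: "blinfun_apply (m (0, n)) (v, 0) = blinfun_apply n v" if n: "n \<in> dual_lattice N" for n v
  proof (rule full_lattice_spans[OF full_lattices(2)])
    show "linear (\<lambda>v. blinfun_apply (m (0, n)) (v, 0))"
      by (intro bounded_linear.linear bounded_linear_compose[OF blinfun.bounded_linear_right]
          bounded_linear_Pair bounded_linear_ident bounded_linear_zero)
    show "linear (blinfun_apply n)"
      by (rule bounded_linear.linear[OF blinfun.bounded_linear_right])
    show "blinfun_apply (m (0, n)) (\<gamma>, 0) = blinfun_apply n \<gamma>" if "\<gamma> \<in> \<Lambda>" for \<gamma>
      \<comment> \<open>At \<open>x = 0\<close> the two orders differ only in their cross terms,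
        which must therefore coincide.\<close>
      using coc[OF that n, of 0] m2[OF that, of n] by simp
  qed
  \<comment> \<open>Its coboundary cancels \<open>c (\<gamma>, 0)\<close> and
    \<open>c (0, n)\<close>, which are \<open>- \<mu> 0\<close> and \<open>- \<kappa>\<close>
    evaluated at the periods.\<close>
  define M where "M = (\<mu> 0 o\<^sub>L fst_blinfun) + (\<kappa> o\<^sub>L snd_blinfun)"
  have M: "blinfun_apply M (v, w) = blinfun_apply (\<mu> 0) v + blinfun_apply \<kappa> w" for v w
    by (simp add: M_def blinfun.add_left)
  have "M \<in> dual_lattice (integral_lattice T)"
    using \<mu>[of 0] \<kappa> by (auto simp: dual_lattice_def M)
  note shifted = T.trivialization_shift[OF triv this]
  have "?a \<gamma> x + blinfun_apply M \<gamma> = aP \<gamma> x" if \<gamma>: "\<gamma> \<in> period_lattice T" for \<gamma> x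
  proof -
    obtain g n v w where gn: "\<gamma> = (g, n)" "x = (v, w)" by (metis surj_pair)
    then have g: "g \<in> \<Lambda>" and n: "n \<in> dual_lattice N" using \<gamma> by auto
    have "?a (g, n) (v, w) = blinfun_apply w g - blinfun_apply (\<mu> 0) g
        + blinfun_apply n v + blinfun_apply n g - blinfun_apply \<kappa> n"
      using coc(1)[OF g n, of "(v, w)"] split[of "(g, 0)" v w] split[of "(0, n)" "v + g" w]
        m1[OF g] m2[OF g] m3[OF n] m4[OF n] c1[OF g] c2[OF n]
      by (simp add: blinfun.add_right)
    then show ?thesis unfolding gn ah_factor_poincare_form M by simp
  qed
  from trivialization_cong[OF this shifted] P_trivialization
  show ?thesis using T.trivialization_iso by blast
qed

end

text \<open>The competing bundle may have sections in any type, hence the separate type variable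
  \<open>'s\<close>.\<close>

theorem theorem4p3:
  fixes X :: "'v::real_normed_vector torus"
  assumes "real_torus X"
  shows "\<exists>P :: (('v \<times> ('v \<Rightarrow>\<^sub>L real)) set,
                 ('v \<times> ('v \<Rightarrow>\<^sub>L real)) set \<Rightarrow> (('v \<times> ('v \<Rightarrow>\<^sub>L real)) \<times> real) set) aff_presheaf.
           poincare_bundle X P \<and>
           (\<forall>Q :: (('v \<times> ('v \<Rightarrow>\<^sub>L real)) set, 's) aff_presheaf.
              poincare_bundle X Q \<longrightarrow>
              line_bundle_iso (prod_torus X (dual_torus X)) Q P)"
proof -
  interpret poincare_setup X using assms by unfold_locales
  show ?thesis using poincare_P poincare_unique by blast
qed

end
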